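(* Let $X$ and $Y$ be Banach spaces over $\mathbb K\in\{\mathbb R,\mathbb C\}$. If $X^*$ and $Y^*$ are separable and one of the spaces $X^*$ or $Y^*$ has the approximation property, then $X^*\widehat\otimes_\pi Y^*=\mathrm{INA}(X^*\widehat\otimes_\pi Y^* )$.
   Context: $E\widehat\otimes_\pi F$ is the projective tensor product, i.e. the completion of $E\otimes F$ under $\|z\|_\pi=\inf\{\sum_{i=1}^n\|x_i\|\|y_i\|:z=\sum_{i=1}^nx_i\otimes y_i\}$. For Banach spaces $E,F$, an element $u\in E\widehat\otimes_\pi F$ is an integral projective norm-attaining tensor if there is a finite positive Borel measure $\mu$ on $B_E\times B_F$ (Borel with respect to the product of the norm topologies) with $|\mu|_{\mathrm{TV}}=\mu(B_E\times B_F)=\|u\|_\pi$ such that the map $\psi\colon B_E\times B_F\to E\widehat\otimes_\pi F$, $\psi(x,y)=x\otimes y$, is $\mu$-Bochner integrable and $u=\int_{B_E\times B_F}\psi\,d\mu$ (Bochner integral). $\mathrm{INA}(E\widehat\otimes_\pi F)$ is the set of all integral projective norm-attaining tensors. *)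

theory Defs
  imports "HOL-Analysis.Analysis"
begin

section \<open>The scalar field\<close>

text \<open>The members of this class are \<open>\<real>\<close> and \<open>\<complex>\<close>, up to isometric isomorphism of normed fields.\<close>

class real_or_complex = real_normed_field + banach +
  assumes real_or_complex:
    "(\<forall>z. \<exists>a. z = a *\<^sub>R 1) \<or>
     (\<exists>i. i * i = - 1 \<and> (\<forall>z. \<exists>a b. z = a *\<^sub>R 1 + b *\<^sub>R i) \<and>
          (\<forall>a b. norm (a *\<^sub>R 1 + b *\<^sub>R i) = sqrt (a\<^sup>2 + b\<^sup>2)))"

instance real :: real_or_complex
  by standard auto

instance complex :: real_or_complex
proof
  have "\<exists>a b. z = a *\<^sub>R 1 + b *\<^sub>R \<i>" for z
    by (rule exI[of _ "Re z"], rule exI[of _ "Im z"]) (simp add: complex_eq_iff)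
  moreover have "norm (a *\<^sub>R 1 + b *\<^sub>R \<i>) = sqrt (a\<^sup>2 + b\<^sup>2)" for a b
    by (simp add: cmod_def)
  ultimately show "(\<forall>z::complex. \<exists>a. z = a *\<^sub>R 1) \<or>
     (\<exists>i::complex. i * i = - 1 \<and> (\<forall>z. \<exists>a b. z = a *\<^sub>R 1 + b *\<^sub>R i) \<and>
          (\<forall>a b. norm (a *\<^sub>R 1 + b *\<^sub>R i) = sqrt (a\<^sup>2 + b\<^sup>2)))"
    by (intro disjI2 exI[of _ \<i>]) auto
qed


section \<open>Normed spaces over \<open>\<real>\<close> or \<open>\<complex>\<close>\<close>

text \<open>
  A Banach space over the scalar field \<open>'k\<close> is a closed subspace \<open>E\<close> of a type in class
  \<^class>\<open>banach\<close>, together with a scalar multiplication by \<open>'k\<close> that extends the real one. Spaces are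
  carrier sets rather than types because the dual of a space depends on its scalar multiplication,
  which is a term.
\<close>

locale normed_space_over = vector_space scale
  for scale :: "'k::real_or_complex \<Rightarrow> 'v::real_normed_vector \<Rightarrow> 'v" +
  assumes scale_of_real: "scale (of_real r) x = r *\<^sub>R x"
    and norm_scale: "norm (scale c x) = norm c * norm x"

definition banach_space_over ::
    "('k::real_or_complex \<Rightarrow> 'v::banach \<Rightarrow> 'v) \<Rightarrow> 'v set \<Rightarrow> bool" where
  "banach_space_over s E \<longleftrightarrow> normed_space_over s \<and> module.subspace s E \<and> closed E"

definition linear_on ::
    "('k \<Rightarrow> 'e::ab_group_add \<Rightarrow> 'e) \<Rightarrow> 'e set \<Rightarrow> ('k \<Rightarrow> 'g::ab_group_add \<Rightarrow> 'g) \<Rightarrow> ('e \<Rightarrow> 'g) \<Rightarrow> bool" where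
  "linear_on sE E sG f \<longleftrightarrow>
     (\<forall>x\<in>E. \<forall>y\<in>E. f (x + y) = f x + f y) \<and> (\<forall>c. \<forall>x\<in>E. f (sE c x) = sG c (f x))"

definition bilinear_on ::
    "('k \<Rightarrow> 'e::ab_group_add \<Rightarrow> 'e) \<Rightarrow> 'e set \<Rightarrow> ('k \<Rightarrow> 'f::ab_group_add \<Rightarrow> 'f) \<Rightarrow> 'f set \<Rightarrow>
     ('k \<Rightarrow> 'g::ab_group_add \<Rightarrow> 'g) \<Rightarrow> ('e \<Rightarrow> 'f \<Rightarrow> 'g) \<Rightarrow> bool" where
  "bilinear_on sE E sF F sG A \<longleftrightarrow>
     (\<forall>y\<in>F. linear_on sE E sG (\<lambda>x. A x y)) \<and> (\<forall>x\<in>E. linear_on sF F sG (A x))"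


section \<open>The dual space\<close>

text \<open>
  \<^typ>\<open>'v \<Rightarrow>\<^sub>L 'k\<close> consists of the bounded real-linear maps, normed by the operator norm; the
  dual is the subspace of those that are linear over \<open>'k\<close>.
\<close>

definition dual_space ::
    "('k::real_or_complex \<Rightarrow> 'v::real_normed_vector \<Rightarrow> 'v) \<Rightarrow> ('v \<Rightarrow>\<^sub>L 'k) set" where
  "dual_space s = {f. \<forall>c x. blinfun_apply f (s c x) = c * blinfun_apply f x}"

definition dual_scale :: "'k::real_or_complex \<Rightarrow> ('v::real_normed_vector \<Rightarrow>\<^sub>L 'k) \<Rightarrow> 'v \<Rightarrow>\<^sub>L 'k" where
  "dual_scale c f = blinfun_mult_right c o\<^sub>L f"

lemma dual_scale_apply [simp]: "blinfun_apply (dual_scale c f) x = c * blinfun_apply f x"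
  by (simp add: dual_scale_def)

lemma norm_dual_scale:
  fixes c :: "'k::real_or_complex" and f :: "'v::real_normed_vector \<Rightarrow>\<^sub>L 'k"
  shows "norm (dual_scale c f) = norm c * norm f"
proof (cases "c = 0")
  case True
  then have "dual_scale c f = 0" by (intro blinfun_eqI) simp
  with True show ?thesis by simp
next
  case False
  have le: "norm (dual_scale d g) \<le> norm d * norm g" for d :: 'k and g :: "'v \<Rightarrow>\<^sub>L 'k"
    by (rule norm_blinfun_bound)
      (auto simp: norm_mult mult.assoc intro!: mult_left_mono norm_blinfun)
  have "dual_scale (inverse c) (dual_scale c f) = f"
    using False by (intro blinfun_eqI) (simp add: field_simps)
  with le[of "inverse c" "dual_scale c f"] have "norm c * norm f \<le> norm (dual_scale c f)"
    using False by (simp add: norm_inverse norm_divide field_simps)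
  with le[of c f] show ?thesis by simp
qed

lemma normed_space_over_dual_scale: "normed_space_over dual_scale"
  by unfold_locales
    (auto intro!: blinfun_eqI
      simp: blinfun.bilinear_simps algebra_simps norm_dual_scale scaleR_conv_of_real)

lemma banach_space_over_dual_space: "banach_space_over dual_scale (dual_space s)"
proof -
  interpret normed_space_over dual_scale by (rule normed_space_over_dual_scale)
  have "closed {f. blinfun_apply f (s c x) = c * blinfun_apply f x}" for c x
    by (intro closed_Collect_eq continuous_intros)
  moreover have "dual_space s = (\<Inter>c. \<Inter>x. {f. blinfun_apply f (s c x) = c * blinfun_apply f x})"
    by (auto simp: dual_space_def)
  ultimately have "closed (dual_space s)" by auto
  moreover have "subspace (dual_space s)"
    by (auto simp: subspace_def dual_space_def blinfun.bilinear_simps algebra_simps)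
  ultimately show ?thesis
    by (auto simp: banach_space_over_def normed_space_over_dual_scale)
qed


section \<open>The approximation property\<close>

definition finite_rank_operator_on ::
    "('k::real_or_complex \<Rightarrow> 'e::banach \<Rightarrow> 'e) \<Rightarrow> 'e set \<Rightarrow> ('e \<Rightarrow> 'e) \<Rightarrow> bool" where
  "finite_rank_operator_on s E S \<longleftrightarrow>
     linear_on s E s S \<and> (\<exists>M. \<forall>x\<in>E. norm (S x) \<le> M * norm x) \<and>
     (\<exists>B. finite B \<and> B \<subseteq> E \<and> S ` E \<subseteq> module.span s B)"

definition approximation_property ::
    "('k::real_or_complex \<Rightarrow> 'e::banach \<Rightarrow> 'e) \<Rightarrow> 'e set \<Rightarrow> bool" where
  "approximation_property s E \<longleftrightarrow>
     (\<forall>C \<epsilon>. compact C \<and> C \<subseteq> E \<and> \<epsilon> > 0 \<longrightarrow>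
        (\<exists>S. finite_rank_operator_on s E S \<and> (\<forall>x\<in>C. norm (S x - x) \<le> \<epsilon>)))"


section \<open>The projective tensor product\<close>

text \<open>
  A list \<open>[(x\<^sub>1, y\<^sub>1), \<dots>, (x\<^sub>n, y\<^sub>n)]\<close> over \<open>E \<times> F\<close> stands for the tensor
  \<open>x\<^sub>1 \<otimes> y\<^sub>1 + \<dots> + x\<^sub>n \<otimes> y\<^sub>n\<close> of the algebraic tensor product \<open>E \<otimes> F\<close>, regarded as a functional on
  the space of all (not necessarily bounded) bilinear forms on \<open>E \<times> F\<close>. Lemma
  \<open>same_tensor_imp_sum_eq\<close> below is the universal property.
\<close>

definition same_tensor ::
    "('k::field \<Rightarrow> 'e::ab_group_add \<Rightarrow> 'e) \<Rightarrow> 'e set \<Rightarrow> ('k \<Rightarrow> 'f::ab_group_add \<Rightarrow> 'f) \<Rightarrow> 'f set \<Rightarrow>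
     ('e \<times> 'f) list \<Rightarrow> ('e \<times> 'f) list \<Rightarrow> bool" where
  "same_tensor sE E sF F zs ws \<longleftrightarrow>
     (\<forall>A. bilinear_on sE E sF F (*) A \<longrightarrow> (\<Sum>(x, y)\<leftarrow>zs. A x y) = (\<Sum>(x, y)\<leftarrow>ws. A x y))"

lemma same_tensor_imp_sum_eq:
  fixes sG :: "'k::field \<Rightarrow> 'g::ab_group_add \<Rightarrow> 'g"
  assumes G: "vector_space sG" and B: "bilinear_on sE E sF F sG B"
    and sub: "set zs \<subseteq> E \<times> F" "set ws \<subseteq> E \<times> F" and eq: "same_tensor sE E sF F zs ws"
  shows "(\<Sum>(x, y)\<leftarrow>zs. B x y) = (\<Sum>(x, y)\<leftarrow>ws. B x y)"
proof (rule ccontr)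
  define d where "d = (\<Sum>(x, y)\<leftarrow>zs. B x y) - (\<Sum>(x, y)\<leftarrow>ws. B x y)"
  assume "\<not> ?thesis"
  then have "d \<noteq> 0" by (simp add: d_def)
  interpret vector_space sG by (rule G)
  interpret K: vector_space "(*) :: 'k \<Rightarrow> 'k \<Rightarrow> 'k"
    by unfold_locales (auto simp: algebra_simps)
  interpret P: vector_space_pair sG "(*) :: 'k \<Rightarrow> 'k \<Rightarrow> 'k" ..
  have "independent {d}" using \<open>d \<noteq> 0\<close> by simp
  then obtain h where h: "Vector_Spaces.linear sG (*) h" and hd: "h d = (1::'k)"
    using P.linear_independent_extend[of "{d}" "\<lambda>_. 1"] by auto
  interpret h: Vector_Spaces.linear sG "(*)" h by (rule h)
  have sum: "h (\<Sum>(x, y)\<leftarrow>vs. B x y) = (\<Sum>(x, y)\<leftarrow>vs. h (B x y))" for vs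
    by (induction vs) (auto simp: h.add)
  have "bilinear_on sE E sF F (*) (\<lambda>x y. h (B x y))"
    using B by (auto simp: bilinear_on_def linear_on_def h.add h.scale)
  with eq have "h d = 0"
    by (auto simp: same_tensor_def d_def h.diff sum)
  with hd show False by simp
qed

definition projective_norm ::
    "('k::real_or_complex \<Rightarrow> 'e::banach \<Rightarrow> 'e) \<Rightarrow> 'e set \<Rightarrow> ('k \<Rightarrow> 'f::banach \<Rightarrow> 'f) \<Rightarrow> 'f set \<Rightarrow>
     ('e \<times> 'f) list \<Rightarrow> real" where
  "projective_norm sE E sF F zs =
     Inf {(\<Sum>(x, y)\<leftarrow>ws. norm x * norm y) | ws. set ws \<subseteq> E \<times> F \<and> same_tensor sE E sF F zs ws}"

text \<open>
  The completion of \<open>E \<otimes> F\<close> under the projective norm is determined up to isometric isomorphism: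
  it is a Banach space \<open>T\<close> with a bilinear map \<open>\<tau>\<close> such that the induced map
  from \<open>E \<otimes> F\<close> to \<open>T\<close> is isometric and has dense range.
\<close>

definition projective_tensor_product ::
    "('k::real_or_complex \<Rightarrow> 'e::banach \<Rightarrow> 'e) \<Rightarrow> 'e set \<Rightarrow> ('k \<Rightarrow> 'f::banach \<Rightarrow> 'f) \<Rightarrow> 'f set \<Rightarrow>
     ('k \<Rightarrow> 't::banach \<Rightarrow> 't) \<Rightarrow> 't set \<Rightarrow> ('e \<Rightarrow> 'f \<Rightarrow> 't) \<Rightarrow> bool" where
  "projective_tensor_product sE E sF F sT T \<tau> \<longleftrightarrow>
     banach_space_over sT T \<and> bilinear_on sE E sF F sT \<tau> \<and>
     (\<forall>zs. set zs \<subseteq> E \<times> F \<longrightarrow> norm (\<Sum>(x, y)\<leftarrow>zs. \<tau> x y) = projective_norm sE E sF F zs) \<and>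
     T = closure {(\<Sum>(x, y)\<leftarrow>zs. \<tau> x y) | zs. set zs \<subseteq> E \<times> F}"


section \<open>Integral projective norm-attaining tensors\<close>

text \<open>
  The library's \<^const>\<open>has_bochner_integral\<close> without its restriction to second countable
  target types.
\<close>

definition has_bochner_integral_general ::
    "'m measure \<Rightarrow> ('m \<Rightarrow> 'b::real_normed_vector) \<Rightarrow> 'b \<Rightarrow> bool" where
  "has_bochner_integral_general M f u \<longleftrightarrow>
     f \<in> borel_measurable M \<and>
     (\<exists>s. (\<forall>i. Bochner_Integration.simple_bochner_integrable M (s i)) \<and>
          (\<lambda>i. \<integral>\<^sup>+x. norm (f x - s i x) \<partial>M) \<longlonglongrightarrow> 0 \<and>
          (\<lambda>i. Bochner_Integration.simple_bochner_integral M (s i)) \<longlonglongrightarrow> u)"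

lemma has_bochner_integral_general_iff:
  fixes f :: "'m \<Rightarrow> 'b::{real_normed_vector, second_countable_topology}"
  shows "has_bochner_integral_general M f u \<longleftrightarrow> has_bochner_integral M f u"
  unfolding has_bochner_integral_general_def has_bochner_integral.simps by auto

definition INA ::
    "'e::banach set \<Rightarrow> 'f::banach set \<Rightarrow> 't::banach set \<Rightarrow> ('e \<Rightarrow> 'f \<Rightarrow> 't) \<Rightarrow> 't set" where
  "INA E F T \<tau> =
     {u \<in> T. \<exists>\<mu> :: ('e \<times> 'f) measure.
        sets \<mu> = sets (restrict_space borel ((cball 0 1 \<inter> E) \<times> (cball 0 1 \<inter> F))) \<and>
        finite_measure \<mu> \<and> measure \<mu> (space \<mu>) = norm u \<and>
        has_bochner_integral_general \<mu> (\<lambda>(x, y). \<tau> x y) u}"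

end

theory Submission
  imports Defs "HOL-Probability.Helly_Selection"
begin

text \<open>
  A tensor \<open>u\<close> is the limit of finite tensors of cost tending to \<open>\<parallel>u\<parallel>\<close>, i.e. of integrals of \<open>\<tau>\<close> against
  positive discrete measures on the product of the dual balls. This product is weak* compact and
  metrizable, so these measures have a weak limit \<open>\<nu>\<close> of mass \<open>\<parallel>u\<parallel>\<close>; since the duals are separable,
  norm and weak* Borel sets agree and \<open>v = \<integral>\<tau> d\<nu>\<close> exists as a Bochner integral. The tensors \<open>u\<close> and
  \<open>v\<close> agree on \<open>x \<otimes> y\<close> for all \<open>x\<close>, \<open>y\<close> from sequences norming the duals, and the approximation
  property forces \<open>u = v\<close>. The weak limit is obtained from Helly's selection theorem on \<open>\<real>\<close>, after coding
  the points of the product of the balls by parameters of a curve through the Hilbert cube.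
\<close>

section \<open>Scalars, dual balls and the Hilbert cube\<close>

text \<open>The obstacle is that \<open>\<tau>\<close> is norm continuous but in general not weak*
  continuous on the product of the balls, so weak convergence says nothing about the integral of
  \<open>\<tau>\<close> itself. It can be tested only against the scalar functions (f, g) \<mapsto>
  f (x k) * g (y m), which are weak* continuous there; hence v is built separately and compared with
  u through countably many functionals. That these separate tensors is the injectivity of the map
  from the projective into the injective tensor product, the one place where the approximation
  property enters. Compactness does two more jobs: no mass escapes, so the limit has the full mass
  \<parallel>u\<parallel>, and the parameters that code points form a closed set, so the limit can
  be decoded. A curve can do the coding because only the values on the norming sequences matter: a
  pair of functionals is a point of a cube, and along a continuous curve covering the cube the
  coordinates become continuous functions on the line, while each atom is assigned one parameter by
  choice.\<close>

lemma real_or_complex_coordinates: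
  obtains r1 r2 :: "'k::real_or_complex \<Rightarrow> real" and i :: 'k
  where "bounded_linear r1" "bounded_linear r2" "norm i \<le> 1"
    "\<And>z. \<bar>r1 z\<bar> \<le> norm z" "\<And>z. \<bar>r2 z\<bar> \<le> norm z"
    "\<And>z. z = r1 z *\<^sub>R 1 + r2 z *\<^sub>R i"
  using real_or_complex[where 'a='k]
proof (elim disjE exE conjE)
  assume a: "\<forall>z::'k. \<exists>a. z = a *\<^sub>R 1"
  then obtain r where r: "\<And>z::'k. z = r z *\<^sub>R 1" by metis
  have uniq: "r (a *\<^sub>R 1) = a" for a
    using r[of "a *\<^sub>R 1"] by simp
  have nr: "norm z = \<bar>r z\<bar>" for z
    using arg_cong[OF r[of z], of norm] by simp
  have "bounded_linear r"
  proof (rule bounded_linear_intro[where K=1])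
    show "r (z + w) = r z + r w" for z w
      using uniq[of "r z + r w"] r[of z] r[of w] by (simp add: scaleR_add_left)
    show "r (a *\<^sub>R z) = a *\<^sub>R r z" for a z
      using uniq[of "a * r z"] r[of z] by (metis real_scaleR_def scaleR_scaleR)
    show "norm (r z) \<le> norm z * 1" for z
      by (simp add: nr)
  qed
  \<comment> \<open>Real scalars fit the same format with i = 0 and second coordinate 0; this is why
    the conclusion asks for norm i \<le> 1 instead of norm 1.\<close>
  then show thesis
    using r by (intro that[of r "\<lambda>_. 0" 0]) (auto simp flip: nr)
next
  fix i :: 'k
  assume ex: "\<forall>z. \<exists>a b. z = a *\<^sub>R 1 + b *\<^sub>R i"
    and n: "\<forall>a b. norm (a *\<^sub>R 1 + b *\<^sub>R i) = sqrt (a\<^sup>2 + b\<^sup>2)"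
  from ex obtain r s where r: "\<And>z. z = r z *\<^sub>R 1 + s z *\<^sub>R i" by metis
  \<comment> \<open>The norm formula makes 1 and i independent over the reals: a combination of norm
    0 has both coefficients 0.\<close>
  have uniq: "r (a *\<^sub>R 1 + b *\<^sub>R i) = a" "s (a *\<^sub>R 1 + b *\<^sub>R i) = b" for a b
  proof -
    let ?z = "a *\<^sub>R 1 + b *\<^sub>R i"
    have "(a - r ?z) *\<^sub>R 1 + (b - s ?z) *\<^sub>R i = 0"
      using r[of ?z] by (simp add: algebra_simps)
    with n[rule_format, of "a - r ?z" "b - s ?z"] show "r ?z = a" "s ?z = b"
      by (simp_all add: sum_power2_eq_zero_iff)
  qed
  have nrs: "norm z = sqrt ((r z)\<^sup>2 + (s z)\<^sup>2)" for z
    using n[rule_format, of "r z" "s z"] r[of z] by metis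
  have bnd: "\<bar>r z\<bar> \<le> norm z" "\<bar>s z\<bar> \<le> norm z" for z
    unfolding nrs by (auto intro!: real_le_rsqrt)
  have add: "z + w = (r z + r w) *\<^sub>R 1 + (s z + s w) *\<^sub>R i" for z w
    using r[of z] r[of w] by (simp add: algebra_simps)
  have sc: "a *\<^sub>R z = (a * r z) *\<^sub>R 1 + (a * s z) *\<^sub>R i" for a z
    using arg_cong[OF r[of z], of "scaleR a"] by (simp add: scaleR_add_right)
  have lin: "r (z + w) = r z + r w" "s (z + w) = s z + s w"
    "r (a *\<^sub>R z) = a *\<^sub>R r z" "s (a *\<^sub>R z) = a *\<^sub>R s z" for a z w
    unfolding add[of z w] sc[of a z] uniq by simp_all
  have "bounded_linear r"
    by (rule bounded_linear_intro[where K=1]) (simp_all only: lin mult_1_right real_norm_def bnd)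
  moreover have "bounded_linear s"
    by (rule bounded_linear_intro[where K=1]) (simp_all only: lin mult_1_right real_norm_def bnd)
  moreover have "norm i \<le> 1"
    using n[rule_format, of 0 1] by simp
  ultimately show thesis
    using bnd r by (intro that[of r s i]) auto
qed

text \<open>Two real coordinates reduce the claim to compactness of a square, of whose continuous
  image the ball is a closed subset.\<close>

lemma compact_cball_real_or_complex: "compact (cball (0::'k::real_or_complex) r)"
proof -
  obtain r1 r2 :: "'k \<Rightarrow> real" and i where *:
    "\<And>z. \<bar>r1 z\<bar> \<le> norm z" "\<And>z. \<bar>r2 z\<bar> \<le> norm z"
    "\<And>z. z = r1 z *\<^sub>R 1 + r2 z *\<^sub>R i"
    by (rule real_or_complex_coordinates) blast
  let ?I = "(\<lambda>(a, b). a *\<^sub>R 1 + b *\<^sub>R i) ` ({-r..r} \<times> {-r..r})"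
  have "compact ?I"
    by (intro compact_continuous_image compact_Times compact_Icc)
      (auto simp: case_prod_beta intro!: continuous_intros)
  moreover have "cball 0 r \<subseteq> ?I"
  proof
    fix z :: 'k assume "z \<in> cball 0 r"
    then have "\<bar>r1 z\<bar> \<le> r" "\<bar>r2 z\<bar> \<le> r"
      using *(1,2)[of z] by auto
    then show "z \<in> ?I"
      using *(3)[of z] by (intro image_eqI[of _ _ "(r1 z, r2 z)"]) (auto simp: abs_le_iff)
  qed
  ultimately show ?thesis
    by (metis closed_cball compact_Int_closed inf.absorb_iff2)
qed

section \<open>Weak* compactness of the dual balls\<close>

text \<open>Banach-Alaoglu: functions carry the topology of pointwise convergence, which is the
  weak* topology on functionals. The pointwise bounds give a Tychonoff product of compact balls, and
  linearity is a closed condition in it.\<close>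

lemma dual_space_ball_compact:
  fixes s :: "'k::real_or_complex \<Rightarrow> 'v::real_normed_vector \<Rightarrow> 'v"
  shows "compact (blinfun_apply ` (cball 0 1 \<inter> dual_space s))"
proof -
  define B where "B = PiE (UNIV::'v set) (\<lambda>x. cball (0::'k) (norm x))"
  \<comment> \<open>Real homogeneity is a clause of its own because nothing here ties
    \<open>s\<close> to the real scaling.\<close>
  define L where "L = {h::'v \<Rightarrow> 'k. (\<forall>x y. h (x + y) = h x + h y) \<and> (\<forall>c x. h (s c x) = c * h x) \<and>
     (\<forall>(a::real) x. h (a *\<^sub>R x) = a *\<^sub>R h x)}"
  have "compactin (product_topology (\<lambda>_. euclidean) UNIV) B"
    unfolding B_def by (subst compactin_PiE) (auto simp: compact_cball_real_or_complex)
  then have "compact B"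
    by (simp add: euclidean_product_topology)
  moreover have "closed L"
  proof -
    have c: "continuous_on UNIV (\<lambda>h::'v \<Rightarrow> 'k. h x)" for x
      by (rule continuous_on_product_coordinates)
    have "L = (\<Inter>x y. {h. h (x + y) = h x + h y}) \<inter> (\<Inter>b x. {h. h (s b x) = b * h x}) \<inter>
       (\<Inter>(a::real) x. {h. h (a *\<^sub>R x) = a *\<^sub>R h x})"
      by (auto simp: L_def)
    also have "closed \<dots>"
      by (intro closed_Int closed_INT ballI closed_Collect_eq continuous_intros c)
    finally show ?thesis .
  qed
  moreover have "blinfun_apply ` (cball 0 1 \<inter> dual_space s) = B \<inter> L"
  proof (intro equalityI subsetI)
    fix h assume "h \<in> blinfun_apply ` (cball 0 1 \<inter> dual_space s)"
    then obtain f where f: "h = blinfun_apply f" "norm f \<le> 1" "f \<in> dual_space s" by auto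
    have "norm (blinfun_apply f x) \<le> norm x" for x
      using norm_blinfun[of f x] mult_right_mono[OF f(2), of "norm x"] by simp
    then show "h \<in> B \<inter> L"
      using f by (auto simp: B_def L_def dual_space_def blinfun.bilinear_simps)
  next
    fix h assume h: "h \<in> B \<inter> L"
    have nh: "norm (h x) \<le> norm x" for x
      using h by (auto simp: B_def PiE_iff)
    then have bl: "bounded_linear h"
      using h by (intro bounded_linear_intro[where K=1]) (auto simp: L_def)
    have "norm (Blinfun h) \<le> 1"
      using nh by (intro norm_blinfun_bound) (auto simp: bounded_linear_Blinfun_apply[OF bl])
    then show "h \<in> blinfun_apply ` (cball 0 1 \<inter> dual_space s)"
      using h by (intro image_eqI[of _ _ "Blinfun h"])
        (auto simp: bounded_linear_Blinfun_apply[OF bl] dual_space_def L_def)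
  qed
  ultimately show ?thesis
    by (simp add: compact_Int_closed)
qed

text \<open>Restricting a functional to the sequence \<open>x\<close> is continuous for pointwise
  convergence, so the restrictions of the ball form a compact, hence closed, set of scalar
  sequences; the set in question is its preimage under the continuous map given by the
  \<open>c n\<close>.\<close>

lemma closed_dual_ball_coordinates:
  fixes s :: "'k::real_or_complex \<Rightarrow> 'v::real_normed_vector \<Rightarrow> 'v" and c :: "nat \<Rightarrow> 'a::topological_space \<Rightarrow> 'k"
  assumes c: "\<And>n. continuous_on UNIV (c n)"
  shows "closed {t. \<exists>f\<in>cball 0 1 \<inter> dual_space s. \<forall>n. blinfun_apply f (x n) = c n t}"
proof -
  let ?r = "\<lambda>h n. h (x n) :: 'k"
  have "continuous_on UNIV ?r"
    by (intro continuous_on_coordinatewise_then_product continuous_on_product_coordinates)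
  then have "compact (?r ` blinfun_apply ` (cball 0 1 \<inter> dual_space s))"
    by (intro compact_continuous_image dual_space_ball_compact) (auto intro: continuous_on_subset)
  then have "closed (?r ` blinfun_apply ` (cball 0 1 \<inter> dual_space s))"
    by (rule compact_imp_closed)
  moreover have "continuous_on UNIV (\<lambda>t n. c n t)"
    by (intro continuous_on_coordinatewise_then_product c)
  ultimately have "closed ((\<lambda>t n. c n t) -` (?r ` blinfun_apply ` (cball 0 1 \<inter> dual_space s)))"
    by (rule closed_vimage)
  also have "\<dots> = {t. \<exists>f\<in>cball 0 1 \<inter> dual_space s. \<forall>n. blinfun_apply f (x n) = c n t}"
    unfolding image_image vimage_def image_iff fun_eq_iff by (simp add: eq_commute)
  finally show ?thesis .
qed

section \<open>A continuous curve through the Hilbert cube\<close>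

text \<open>Multiplying by \<open>3 ^ j\<close> turns the digits before position j into an even
  integer, since all ternary digits are 0 or 2. What remains starts with digit j, followed by a
  series of the same kind divided by 3, whose value r lies in [0,1].\<close>

lemma sum_ternary_split:
  fixes b :: "nat \<Rightarrow> real"
  assumes b: "\<And>j. b j \<in> {0, 1}"
  defines "t \<equiv> \<Sum>j. 2 * b j / 3 ^ (j + 1)"
  shows "t \<in> {0..1}"
    and "\<exists>(m::int) r. 3 ^ j * t = 2 * of_int m + (2 * b j + r) / 3 \<and> 0 \<le> r \<and> r \<le> 1"
proof -
  have g: "(\<lambda>j. 2 / 3 ^ (j + 1) :: real) sums 1"
    using sums_mult[OF geometric_sums[of "1/3::real"], of "2/3"] by (simp add: power_divide field_simps)
  have bb: "0 \<le> b j" "b j \<le> 1" for j using b[of j] by auto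
  have tern: "summable (\<lambda>j. 2 * d j / 3 ^ (j + 1))" "(\<Sum>j. 2 * d j / 3 ^ (j + 1)) \<in> {0..1}"
    if d: "\<And>j. 0 \<le> d j \<and> d j \<le> (1::real)" for d
  proof -
    have le: "2 * d j / 3 ^ (j + 1) \<le> 2 / 3 ^ (j + 1)" for j
      using d[of j] by (intro divide_right_mono) auto
    show s: "summable (\<lambda>j. 2 * d j / 3 ^ (j + 1))"
      by (rule summable_comparison_test'[OF sums_summable[OF g], of 0]) (use le d in auto)
    show "(\<Sum>j. 2 * d j / 3 ^ (j + 1)) \<in> {0..1}"
      using suminf_le[OF le s sums_summable[OF g]] sums_unique[OF g] suminf_nonneg[OF s] d by auto
  qed
  show "t \<in> {0..1}"
    unfolding t_def using bb by (intro tern) auto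
  have "\<exists>(m::int) r. 3 ^ j * (\<Sum>i. 2 * d i / 3 ^ (i + 1)) = 2 * of_int m + (2 * d j + r) / 3 \<and> 0 \<le> r \<and> r \<le> 1"
    if "\<And>i. d i \<in> {0, 1::real}" for d
    using that
  proof (induction j arbitrary: d)
    case 0
    have d: "0 \<le> d j \<and> d j \<le> 1" for j using 0[of j] by auto
    have "(\<Sum>i. 2 * d i / 3 ^ (i + 1)) = 2 * d 0 / 3 + (\<Sum>i. 2 * d (Suc i) / 3 ^ (Suc i + 1))"
      using suminf_split_head[OF tern(1)[of d, OF d]] by simp
    also have "(\<Sum>i. 2 * d (Suc i) / 3 ^ (Suc i + 1)) = (\<Sum>i. (2 * d (Suc i) / 3 ^ (i + 1)) / 3)"
      by simp
    also have "\<dots> = (\<Sum>i. 2 * d (Suc i) / 3 ^ (i + 1)) / 3"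
      by (rule suminf_divide[OF tern(1)]) (use d in auto)
    finally have "3 ^ 0 * (\<Sum>i. 2 * d i / 3 ^ (i + 1)) = 2 * of_int 0 + (2 * d 0 + (\<Sum>i. 2 * d (Suc i) / 3 ^ (i + 1))) / 3"
      by (simp add: field_simps)
    moreover have "(\<Sum>i. 2 * d (Suc i) / 3 ^ (i + 1)) \<in> {0..1}"
      using d by (intro tern(2)) auto
    ultimately show ?case
      unfolding atLeastAtMost_iff by blast
  next
    case (Suc j)
    have d: "0 \<le> d j \<and> d j \<le> 1" for j using Suc.prems[of j] by auto
    have "(\<Sum>i. 2 * d i / 3 ^ (i + 1)) = 2 * d 0 / 3 + (\<Sum>i. 2 * d (Suc i) / 3 ^ (Suc i + 1))"
      using suminf_split_head[OF tern(1)[of d, OF d]] by simp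
    also have "(\<Sum>i. 2 * d (Suc i) / 3 ^ (Suc i + 1)) = (\<Sum>i. (2 * d (Suc i) / 3 ^ (i + 1)) / 3)"
      by simp
    also have "\<dots> = (\<Sum>i. 2 * d (Suc i) / 3 ^ (i + 1)) / 3"
      by (rule suminf_divide[OF tern(1)]) (use d in auto)
    finally have e: "3 * (\<Sum>i. 2 * d i / 3 ^ (i + 1)) = 2 * d 0 + (\<Sum>i. 2 * d (Suc i) / 3 ^ (i + 1))"
      by (simp add: field_simps)
    obtain m r where m: "3 ^ j * (\<Sum>i. 2 * d (Suc i) / 3 ^ (i + 1)) = 2 * of_int m + (2 * d (Suc j) + r) / 3" "0 \<le> r" "r \<le> 1"
      using Suc.IH[of "\<lambda>i. d (Suc i)"] Suc.prems by auto
    obtain k :: int where k: "d 0 = of_int k"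
      using Suc.prems[of 0] that[of 0] that[of 1] by auto
    have "3 ^ Suc j * (\<Sum>i. 2 * d i / 3 ^ (i + 1)) = 2 * of_int (3 ^ j * k + m) + (2 * d (Suc j) + r) / 3"
    proof -
      have "3 ^ Suc j * (\<Sum>i. 2 * d i / 3 ^ (i + 1)) = 3 ^ j * (3 * (\<Sum>i. 2 * d i / 3 ^ (i + 1)))"
        by simp
      also have "\<dots> = 2 * (3 ^ j * d 0) + 3 ^ j * (\<Sum>i. 2 * d (Suc i) / 3 ^ (i + 1))"
        unfolding e by (simp only: distrib_left mult.left_commute)
      finally show ?thesis unfolding m(1) k by simp
    qed
    with m(2,3) show ?case by blast
  qed
  from this[of b, OF b] show "\<exists>(m::int) r. 3 ^ j * t = 2 * of_int m + (2 * b j + r) / 3 \<and> 0 \<le> r \<and> r \<le> 1"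
    unfolding t_def .
qed

text \<open>Greedy digits: \<open>r k\<close> is the remainder scaled by 2 ^ k. The rule keeps [0,1]
  invariant including the endpoint 1, whose digits are all 1.\<close>

lemma binary_expansion:
  fixes a :: real
  assumes "a \<in> {0..1}"
  obtains b where "\<And>k::nat. b k \<in> {0, 1::real}" "(\<lambda>k. b k / 2 ^ (k + 1)) sums a"
proof -
  define bit where "bit x = (if x \<ge> 1/2 then 1 else 0 :: real)" for x :: real
  define r where "r = rec_nat a (\<lambda>_ x. 2 * x - bit x)"
  have r0: "r 0 = a" and rS: "r (Suc k) = 2 * r k - bit (r k)" for k
    by (auto simp: r_def)
  have r01: "r k \<in> {0..1}" for k
    by (induction k) (use assms in \<open>auto simp: r0 rS bit_def\<close>)
  have part: "(\<Sum>i<k. bit (r i) / 2 ^ (i + 1)) = a - r k / 2 ^ k" for k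
    by (induction k) (auto simp: r0 rS field_simps)
  have "(\<lambda>k. r k / 2 ^ k) \<longlonglongrightarrow> 0"
  proof (rule tendsto_sandwich[of "\<lambda>_. 0" _ _ "\<lambda>k. (1/2) ^ k"])
    show "(\<lambda>k. (1/2::real) ^ k) \<longlonglongrightarrow> 0" by (rule LIMSEQ_realpow_zero) auto
  qed (use r01 in \<open>auto simp: power_divide intro!: always_eventually divide_right_mono\<close>)
  from tendsto_diff[OF tendsto_const this, of a]
  have "(\<lambda>k. bit (r k) / 2 ^ (k + 1)) sums a"
    unfolding sums_def part by simp
  moreover have "bit (r k) \<in> {0, 1}" for k by (simp add: bit_def)
  ultimately show thesis by (rule that[rotated])
qed

text \<open>
  A continuous curve through the Hilbert cube, after Schoenberg: the function
  \<open>wave\<close> below reads off the \<open>j\<close>-th ternary digit of \<open>t\<close> from \<open>3 ^ j * t\<close> when all digits are \<open>0\<close> or \<open>2\<close>.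
\<close>

lemma hilbert_cube_curve:
  obtains c :: "nat \<Rightarrow> real \<Rightarrow> real" where "\<And>n. continuous_on UNIV (c n)"
    "\<And>n t. c n t \<in> {0..1}"
    "\<And>a. (\<And>n. a n \<in> {0..1}) \<Longrightarrow> \<exists>t\<in>{0..1}. \<forall>n. c n t = a n"
proof -
  \<comment> \<open>A clipped cosine of period 2 that is 0 on [0,1/3] and 1 on [2/3,1], so it tells
    a leading ternary digit 0 from a leading digit 2 whatever digits follow.\<close>
  define wave where "wave t = max 0 (min 1 (1/2 - cos (pi * t)))" for t
  have w01: "wave t \<in> {0..1}" for t by (simp add: wave_def)
  have wc: "continuous_on UNIV wave" unfolding wave_def[abs_def] by (intro continuous_intros)
  have wave_digit: "wave (2 * of_int m + (2 * b + r) / 3) = b"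
    if "b \<in> {0, 1}" "0 \<le> r" "r \<le> 1" for m b r
  proof -
    have "pi * (2 * of_int m + (2 * b + r) / 3) = pi * ((2 * b + r) / 3) + 2 * pi * of_int m"
      by (simp add: distrib_left)
    then have c: "cos (pi * (2 * of_int m + (2 * b + r) / 3)) = cos (pi * ((2 * b + r) / 3))"
      by (simp add: cos_add cos_int_2pin sin_int_2pin)
    show ?thesis
    proof (cases "b = 0")
      case True
      have "cos (pi / 3) \<le> cos (pi * (r / 3))"
        using that by (intro cos_monotone_0_pi_le) auto
      then show ?thesis using c True by (simp add: wave_def cos_60)
    next
      case False
      then have b: "b = 1" using that by auto
      have "cos (pi * ((2 + r) / 3)) \<le> cos (2 * pi / 3)"
        using that by (intro cos_monotone_0_pi_le) (auto simp: field_simps)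
      then show ?thesis using c b by (simp add: wave_def cos_120)
    qed
  qed
  \<comment> \<open>All binary expansions are interleaved in one digit string: binary digit k of
    coordinate n is stored at ternary position \<open>prod_encode (n, k)\<close>.\<close>
  define c where "c n t = (\<Sum>k. wave (3 ^ prod_encode (n, k) * t) / 2 ^ (k + 1))" for n t
  have g: "(\<lambda>k. 1 / 2 ^ (k + 1) :: real) sums 1"
    using sums_mult[OF geometric_sums[of "1/2::real"], of "1/2"] by (simp add: power_divide field_simps)
  have le: "wave x / 2 ^ (k + 1) \<le> 1 / 2 ^ (k + 1)" "0 \<le> wave x / 2 ^ (k + 1)" for x k
    using w01[of x] by (auto intro!: divide_right_mono)
  have sm: "summable (\<lambda>k. wave (x k) / 2 ^ (k + 1))" for x
    by (rule summable_comparison_test'[OF sums_summable[OF g], of 0]) (use le w01 in auto)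
  show thesis
  proof (rule that[of c])
    fix n
    have "uniform_limit UNIV (\<lambda>N t. \<Sum>k<N. wave (3 ^ prod_encode (n, k) * t) / 2 ^ (k + 1)) (c n) sequentially"
      unfolding c_def[abs_def]
      by (rule Weierstrass_m_test[OF _ sums_summable[OF g]]) (use le w01 in auto)
    then show "continuous_on UNIV (c n)"
      by (rule uniform_limit_theorem[rotated])
        (auto intro!: always_eventually continuous_intros continuous_on_compose2[OF wc])
  next
    fix n t
    show "c n t \<in> {0..1}"
      using suminf_le[OF le(1) sm sums_summable[OF g]] sums_unique[OF g] suminf_nonneg[OF sm] le(2)
      by (auto simp: c_def)
  next
    fix a :: "nat \<Rightarrow> real" assume "\<And>n. a n \<in> {0..1}"
    then have "\<exists>b. (\<forall>k::nat. b k \<in> {0, 1::real}) \<and> (\<lambda>k. b k / 2 ^ (k + 1)) sums a n" for n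
      by (rule binary_expansion) blast
    then obtain b where b: "\<And>n k::nat. b n k \<in> {0, 1::real}" "\<And>n. (\<lambda>k. b n k / 2 ^ (k + 1)) sums a n"
      by metis
    define d where "d j = (case prod_decode j of (n, k) \<Rightarrow> b n k)" for j
    have d: "d j \<in> {0, 1}" for j using b by (auto simp: d_def split: prod.split)
    define t where "t = (\<Sum>j. 2 * d j / 3 ^ (j + 1))"
    have "t \<in> {0..1}" unfolding t_def using d by (rule sum_ternary_split)
    moreover have "wave (3 ^ j * t) = d j" for j
    proof -
      obtain m r where "3 ^ j * t = 2 * of_int m + (2 * d j + r) / 3" "0 \<le> r" "r \<le> 1"
        using sum_ternary_split(2)[of d j, OF d] unfolding t_def by blast
      then show ?thesis using wave_digit[OF d[of j]] by simp
    qed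
    then have "c n t = a n" for n
      using b(2)[of n] by (simp add: c_def d_def sums_iff)
    ultimately show "\<exists>t\<in>{0..1}. \<forall>n. c n t = a n" by blast
  qed
qed

text \<open>Even and odd coordinates of the real curve, stretched from [0,1] to [-1,1], serve as the
  two real coordinates of a scalar. Values outside the unit disc may occur, hence the bound 2 for
  arbitrary parameters, while coverage is claimed for norms up to 1.\<close>

lemma scalar_cube_curve:
  obtains c :: "nat \<Rightarrow> real \<Rightarrow> 'k::real_or_complex" where "\<And>n. continuous_on UNIV (c n)"
    "\<And>n t. norm (c n t) \<le> 2"
    "\<And>a. (\<And>n. norm (a n) \<le> 1) \<Longrightarrow> \<exists>t\<in>{0..1}. \<forall>n. c n t = a n"
proof -
  obtain h :: "nat \<Rightarrow> real \<Rightarrow> real" where h: "\<And>n. continuous_on UNIV (h n)"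
    "\<And>n t. h n t \<in> {0..1}" "\<And>a. (\<And>n. a n \<in> {0..1}) \<Longrightarrow> \<exists>t\<in>{0..1}. \<forall>n. h n t = a n"
    by (rule hilbert_cube_curve) blast
  obtain r1 r2 :: "'k \<Rightarrow> real" and i where r:
    "norm i \<le> 1" "\<And>z. \<bar>r1 z\<bar> \<le> norm z" "\<And>z. \<bar>r2 z\<bar> \<le> norm z"
    "\<And>z. z = r1 z *\<^sub>R 1 + r2 z *\<^sub>R i"
    by (rule real_or_complex_coordinates) blast
  define c where "c n t = (2 * h (2 * n) t - 1) *\<^sub>R 1 + (2 * h (2 * n + 1) t - 1) *\<^sub>R i" for n t
  show thesis
  proof (rule that[of c])
    show "continuous_on UNIV (c n)" for n
      unfolding c_def[abs_def] by (intro continuous_intros h)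
    show "norm (c n t) \<le> 2" for n t
    proof -
      have "\<bar>2 * h (2 * n) t - 1\<bar> \<le> 1" "\<bar>2 * h (2 * n + 1) t - 1\<bar> \<le> 1"
        using h(2)[of "2 * n" t] h(2)[of "2 * n + 1" t] by auto
      then have "norm ((2 * h (2 * n) t - 1) *\<^sub>R (1::'k)) \<le> 1" "norm ((2 * h (2 * n + 1) t - 1) *\<^sub>R i) \<le> 1"
        using mult_mono[of "\<bar>2 * h (2 * n + 1) t - 1\<bar>" 1 "norm i" 1] r(1) by auto
      from norm_triangle_mono[OF this] show ?thesis unfolding c_def by simp
    qed
    fix a :: "nat \<Rightarrow> 'k" assume a: "\<And>n. norm (a n) \<le> 1"
    define e where "e n = (if even n then (r1 (a (n div 2)) + 1) / 2 else (r2 (a (n div 2)) + 1) / 2)" for n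
    have "e n \<in> {0..1}" for n
      using r(2,3)[of "a (n div 2)"] a[of "n div 2"] by (auto simp: e_def abs_le_iff)
    then obtain t where t: "t \<in> {0..1}" "\<And>n. h n t = e n"
      using h(3) by metis
    have "c n t = a n" for n
    proof -
      have "2 * e (2 * n) - 1 = r1 (a n)" "2 * e (2 * n + 1) - 1 = r2 (a n)"
        by (auto simp: e_def field_simps)
      then show ?thesis
        using r(4)[of "a n"] by (simp add: c_def t)
    qed
    then show "\<exists>t\<in>{0..1}. \<forall>n. c n t = a n" using t by blast
  qed
qed

section \<open>Bochner integrals and weak limits\<close>

text \<open>Only the range is assumed separable. The trace of an open set on it is covered by
  countably many balls around the \<open>d i\<close> with radii 1/(n+1), of which only those
  contained in the open set are used.\<close>

lemma borel_measurable_separable_range: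
  fixes p :: "'a \<Rightarrow> 'm::metric_space" and d :: "nat \<Rightarrow> 'm"
  assumes dense: "\<And>q e. q \<in> space M \<Longrightarrow> 0 < e \<Longrightarrow> \<exists>i. dist (p q) (d i) < e"
    and meas: "\<And>i. (\<lambda>q. dist (p q) (d i)) \<in> borel_measurable M"
  shows "p \<in> borel_measurable M"
proof (rule borel_measurableI)
  fix S :: "'m set" assume "open S"
  have "p -` S \<inter> space M =
    (\<Union>(i, n)\<in>{(i, n). ball (d i) (1 / real (Suc n)) \<subseteq> S}. {q\<in>space M. dist (p q) (d i) < 1 / real (Suc n)})"
  proof (intro equalityI subsetI)
    fix q assume q: "q \<in> p -` S \<inter> space M"
    then obtain e where e: "0 < e" "ball (p q) e \<subseteq> S"
      using \<open>open S\<close> by (auto simp: open_contains_ball)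
    obtain n where n: "1 / real (Suc n) < e / 2"
      using nat_approx_posE[of "e / 2"] e by auto
    obtain i where i: "dist (p q) (d i) < 1 / real (Suc n)"
      using dense[of q "1 / real (Suc n)"] q by auto
    have "ball (d i) (1 / real (Suc n)) \<subseteq> ball (p q) e"
    proof
      fix z assume "z \<in> ball (d i) (1 / real (Suc n))"
      then show "z \<in> ball (p q) e"
        using i n dist_triangle[of "p q" z "d i"] by (auto simp del: of_nat_Suc)
    qed
    with e i q show "q \<in> (\<Union>(i, n)\<in>{(i, n). ball (d i) (1 / real (Suc n)) \<subseteq> S}. {q\<in>space M. dist (p q) (d i) < 1 / real (Suc n)})"
      by blast
  qed (auto simp: dist_commute)
  also have "\<dots> \<in> sets M"
  proof -
    have "{q \<in> space M. dist (p q) (d i) < 1 / real (Suc n)} \<in> sets M" for i n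
      using meas by measurable
    then show ?thesis by (intro sets.countable_UN'') auto
  qed
  finally show "p -` S \<inter> space M \<in> sets M" .
qed

text \<open>Each point is assigned a nearby centre among the first N ones. Points without one form a
  set \<open>A N\<close> of small measure, where the default value 0 costs at most the bound K.
  Measurability of the error is carried along because the type of values is not assumed second
  countable.\<close>

lemma simple_approximation:
  fixes \<psi> :: "'a \<Rightarrow> 't::real_normed_vector" and d :: "nat \<Rightarrow> 't"
  assumes M: "finite_measure M" and \<psi>: "\<psi> \<in> borel_measurable M"
    and bound: "\<And>q. q \<in> space M \<Longrightarrow> norm (\<psi> q) \<le> K"
    and dense: "\<And>q e. q \<in> space M \<Longrightarrow> 0 < e \<Longrightarrow> \<exists>i. norm (\<psi> q - d i) < e"
    and "0 < e"
  obtains s where "Bochner_Integration.simple_bochner_integrable M s" "range s \<subseteq> insert 0 (range d)"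
    "(\<lambda>q. norm (\<psi> q - s q)) \<in> borel_measurable M" "(\<integral>\<^sup>+q. norm (\<psi> q - s q) \<partial>M) \<le> ennreal e"
proof -
  interpret finite_measure M by fact
  define m where "m = measure M (space M)"
  have "0 \<le> m" by (simp add: m_def)
  \<comment> \<open>Chosen so that the error e' * m off the exceptional set plus |K| * e' on it is
    at most e; the summand 1 keeps the denominator positive.\<close>
  define e' where "e' = e / (m + \<bar>K\<bar> + 1)"
  have e': "0 < e'" using \<open>0 < e\<close> \<open>0 \<le> m\<close> by (simp add: e'_def)
  have norm_meas[measurable]: "(\<lambda>q. norm (\<psi> q - y)) \<in> borel_measurable M" for y
    by (rule measurable_compose[OF \<psi>]) (intro borel_measurable_continuous_onI continuous_intros)
  define A where "A N = {q\<in>space M. \<forall>i<N. e' \<le> norm (\<psi> q - d i)}" for N :: nat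
  have [measurable]: "A N \<in> sets M" for N unfolding A_def by measurable
  have "(\<Inter>N. A N) = {}"
  proof (intro equals0I)
    fix q assume q: "q \<in> (\<Inter>N. A N)"
    then have "q \<in> space M" by (auto simp: A_def)
    then obtain i where "norm (\<psi> q - d i) < e'" using dense[OF _ e'] by blast
    moreover have "q \<in> A (Suc i)" using q by blast
    ultimately show False by (auto simp: A_def)
  qed
  moreover have "decseq A" by (auto simp: decseq_def A_def)
  ultimately have "(\<lambda>N. measure M (A N)) \<longlonglongrightarrow> 0"
    using finite_Lim_measure_decseq[of A] by (auto simp: image_subset_iff)
  from order_tendstoD(2)[OF this e'] obtain N where N: "measure M (A N) < e'"
    by (auto simp: eventually_sequentially)
  have "\<exists>s. simple_function M s \<and> range s \<subseteq> insert 0 (range d) \<and> (\<lambda>q. norm (\<psi> q - s q)) \<in> borel_measurable M \<and>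
    (\<forall>q\<in>space M. if q \<in> A N then s q = 0 else norm (\<psi> q - s q) < e')" for N
  proof (induction N)
    case 0
    show ?case by (intro exI[of _ "\<lambda>_. 0"]) (use norm_meas[of 0] in \<open>auto simp: A_def\<close>)
  next
    case (Suc N)
    then obtain s where s: "simple_function M s" "range s \<subseteq> insert 0 (range d)"
      "(\<lambda>q. norm (\<psi> q - s q)) \<in> borel_measurable M"
      "\<And>q. q \<in> space M \<Longrightarrow> if q \<in> A N then s q = 0 else norm (\<psi> q - s q) < e'" by blast
    \<comment> \<open>A newly available centre overrides the old value where it is close; elsewhere
      the earlier choice, or the default 0, stays.\<close>
    let ?s = "\<lambda>q. if norm (\<psi> q - d N) < e' then d N else s q"
    have "simple_function M ?s"
      by (intro simple_function_If s simple_function_const) measurable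
    moreover have "(\<lambda>q. if norm (\<psi> q - d N) < e' then norm (\<psi> q - d N) else norm (\<psi> q - s q)) \<in> borel_measurable M"
      using s(3) by measurable
    then have "(\<lambda>q. norm (\<psi> q - ?s q)) \<in> borel_measurable M"
      by (rule measurable_cong[THEN iffD1, rotated]) auto
    moreover have "range ?s \<subseteq> insert 0 (range d)" using s(2) by auto
    moreover have "if q \<in> A (Suc N) then ?s q = 0 else norm (\<psi> q - ?s q) < e'" if "q \<in> space M" for q
      using s(4)[OF that] that by (auto simp: A_def less_Suc_eq split: if_splits)
    ultimately show ?case by blast
  qed
  then obtain s where s: "simple_function M s" "range s \<subseteq> insert 0 (range d)"
      "(\<lambda>q. norm (\<psi> q - s q)) \<in> borel_measurable M"
      "\<And>q. q \<in> space M \<Longrightarrow> if q \<in> A N then s q = 0 else norm (\<psi> q - s q) < e'" by meson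
  show thesis
  proof (rule that[of s])
    show "Bochner_Integration.simple_bochner_integrable M s"
      using s(1) by (intro simple_bochner_integrable.intros) auto
    have "(\<integral>\<^sup>+q. norm (\<psi> q - s q) \<partial>M) \<le> (\<integral>\<^sup>+q. ennreal e' + ennreal \<bar>K\<bar> * indicator (A N) q \<partial>M)"
    proof (intro nn_integral_mono)
      fix q assume q: "q \<in> space M"
      show "ennreal (norm (\<psi> q - s q)) \<le> ennreal e' + ennreal \<bar>K\<bar> * indicator (A N) q"
        using s(4)[OF q] bound[OF q] e'
        by (auto split: if_splits intro!: ennreal_leI simp flip: ennreal_plus)
    qed
    also have "\<dots> = ennreal (e' * m + \<bar>K\<bar> * measure M (A N))"
      using e' by (subst nn_integral_add)
        (auto simp: nn_integral_cmult_indicator emeasure_eq_measure m_def ennreal_mult ennreal_plus)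
    also have "\<dots> \<le> ennreal e"
    proof (intro ennreal_leI)
      have "e' * m + \<bar>K\<bar> * measure M (A N) \<le> e' * m + \<bar>K\<bar> * e'"
        using N by (intro add_left_mono mult_left_mono) auto
      also have "\<dots> \<le> e' * (m + \<bar>K\<bar> + 1)"
        using e' by (simp add: algebra_simps)
      also have "\<dots> = e"
        using \<open>0 \<le> m\<close> by (simp add: e'_def)
      finally show "e' * m + \<bar>K\<bar> * measure M (A N) \<le> e" .
    qed
    finally show "(\<integral>\<^sup>+q. norm (\<psi> q - s q) \<partial>M) \<le> ennreal e" .
  qed (use s in auto)
qed

lemma simple_bochner_integral_diff_le:
  fixes \<psi> :: "'a \<Rightarrow> 't::real_normed_vector"
  assumes s: "Bochner_Integration.simple_bochner_integrable M s" "Bochner_Integration.simple_bochner_integrable M t"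
    and [measurable]: "(\<lambda>q. norm (\<psi> q - s q)) \<in> borel_measurable M" "(\<lambda>q. norm (\<psi> q - t q)) \<in> borel_measurable M"
  shows "ennreal (norm (Bochner_Integration.simple_bochner_integral M s - Bochner_Integration.simple_bochner_integral M t)) \<le>
    (\<integral>\<^sup>+q. norm (\<psi> q - s q) \<partial>M) + (\<integral>\<^sup>+q. norm (\<psi> q - t q) \<partial>M)"
proof -
  have st: "Bochner_Integration.simple_bochner_integrable M (\<lambda>q. s q - t q)"
    "Bochner_Integration.simple_bochner_integrable M (\<lambda>q. norm (s q - t q))"
    by (auto intro!: s simple_bochner_integrable_compose2[where p="\<lambda>x y. x - y"]
      simple_bochner_integrable_compose2[where p="\<lambda>x y. norm (x - y)"])
  have "ennreal (norm (Bochner_Integration.simple_bochner_integral M s - Bochner_Integration.simple_bochner_integral M t)) \<le>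
      ennreal (Bochner_Integration.simple_bochner_integral M (\<lambda>q. norm (s q - t q)))"
    using simple_bochner_integral_norm_bound[OF st(1)] s
    by (simp add: simple_bochner_integral_diff)
  also have "\<dots> = (\<integral>\<^sup>+q. norm (s q - t q) \<partial>M)"
    by (rule simple_bochner_integral_eq_nn_integral[OF st(2)]) auto
  also have "\<dots> \<le> (\<integral>\<^sup>+q. ennreal (norm (\<psi> q - s q)) + ennreal (norm (\<psi> q - t q)) \<partial>M)"
  proof (intro nn_integral_mono)
    fix q
    have "norm (s q - t q) \<le> norm (\<psi> q - s q) + norm (\<psi> q - t q)"
      by (metis dual_order.refl norm_diff_triangle_le norm_minus_commute)
    then show "ennreal (norm (s q - t q)) \<le> ennreal (norm (\<psi> q - s q)) + ennreal (norm (\<psi> q - t q))"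
      by (simp flip: ennreal_plus)
  qed
  also have "\<dots> = (\<integral>\<^sup>+q. norm (\<psi> q - s q) \<partial>M) + (\<integral>\<^sup>+q. norm (\<psi> q - t q) \<partial>M)"
    by (rule nn_integral_add) auto
  finally show ?thesis .
qed

text \<open>The integral is the limit of the integrals of simple functions, which form a Cauchy
  sequence as these functions approach \<open>\<psi>\<close> in mean. The simple functions take
  their values in 0 and the range of d, so everything stays in T; this matters because the
  functionals l are linear and bounded on T only.\<close>

lemma bochner_integral_in_subspace:
  fixes \<psi> :: "'a \<Rightarrow> 't::banach" and d :: "nat \<Rightarrow> 't"
  assumes M: "finite_measure M" and \<psi>: "\<psi> \<in> borel_measurable M"
    and bound: "\<forall>q\<in>space M. norm (\<psi> q) \<le> K"
    and dense: "\<forall>q\<in>space M. \<forall>e>0. \<exists>i. norm (\<psi> q - d i) < e"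
    and T: "subspace T" "closed T" "range d \<subseteq> T" "\<forall>q\<in>space M. \<psi> q \<in> T"
  obtains v where "v \<in> T" "has_bochner_integral_general M \<psi> v"
    "\<forall>(l::'t \<Rightarrow> real) C. linear_on (*\<^sub>R) T (*\<^sub>R) l \<longrightarrow> (\<forall>z\<in>T. \<bar>l z\<bar> \<le> C * norm z) \<longrightarrow>
      (\<lambda>q. l (\<psi> q)) \<in> borel_measurable M \<longrightarrow> l v = (\<integral>q. l (\<psi> q) \<partial>M)"
proof -
  let ?I = "Bochner_Integration.simple_bochner_integral M"
  define good where "good n s \<longleftrightarrow> Bochner_Integration.simple_bochner_integrable M s \<and> range s \<subseteq> insert 0 (range d) \<and>
    (\<lambda>q. norm (\<psi> q - s q)) \<in> borel_measurable M \<and> (\<integral>\<^sup>+q. norm (\<psi> q - s q) \<partial>M) \<le> ennreal (1 / real (Suc n))"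
    for n and s :: "'a \<Rightarrow> 't"
  have "\<exists>s. good n s" for n
  proof -
    have "0 < 1 / real (Suc n)" by simp
    from M \<psi> bound[rule_format] dense[rule_format] this show ?thesis unfolding good_def
      by (rule simple_approximation) (assumption | intro exI conjI)+
  qed
  then obtain s where "\<And>n. good n (s n)" by metis
  then have s: "\<And>n. Bochner_Integration.simple_bochner_integrable M (s n)"
    and rng: "\<And>n. range (s n) \<subseteq> insert 0 (range d)"
    and ms: "\<And>n. (\<lambda>q. norm (\<psi> q - s n q)) \<in> borel_measurable M"
    and le: "\<And>n. (\<integral>\<^sup>+q. norm (\<psi> q - s n q) \<partial>M) \<le> ennreal (1 / real (Suc n))"
    by (simp_all only: good_def)
  have sT: "s n q \<in> T" for n q
  proof -
    have "s n q \<in> insert 0 (range d)" using rng[of n] rangeI[of "s n" q] by (rule subsetD)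
    then show ?thesis using T(3) subspace_0[OF T(1)] by (metis insertE subsetD)
  qed
  have conv: "(\<lambda>n. \<integral>\<^sup>+q. norm (\<psi> q - s n q) \<partial>M) \<longlonglongrightarrow> 0"
  proof (rule tendsto_sandwich[of "\<lambda>_. 0" _ _ "\<lambda>n. ennreal (1 / real (Suc n))"])
    show "(\<lambda>n. ennreal (1 / real (Suc n))) \<longlonglongrightarrow> 0"
      using tendsto_ennrealI[OF LIMSEQ_Suc[OF lim_1_over_n]] by simp
  qed (use le in auto)
  have diff: "norm (?I (s n) - ?I (s m)) \<le> 1 / real (Suc n) + 1 / real (Suc m)" for n m
  proof -
    have "ennreal (norm (?I (s n) - ?I (s m))) \<le> ennreal (1 / real (Suc n)) + ennreal (1 / real (Suc m))"
      using simple_bochner_integral_diff_le[OF s s ms ms, of n m] add_mono[OF le[of n] le[of m]]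
      by (rule order_trans)
    also have "\<dots> = ennreal (1 / real (Suc n) + 1 / real (Suc m))"
      by (rule ennreal_plus[symmetric]) auto
    finally show ?thesis by (subst (asm) ennreal_le_iff) auto
  qed
  have "Cauchy (\<lambda>n. ?I (s n))"
  proof (rule metric_CauchyI)
    fix e :: real assume "0 < e"
    obtain N where N: "1 / real (Suc N) < e / 2"
      using nat_approx_posE[of "e / 2"] \<open>0 < e\<close> by auto
    have "dist (?I (s m)) (?I (s n)) < e" if "N \<le> m" "N \<le> n" for m n
    proof -
      have "1 / real (Suc m) \<le> 1 / real (Suc N)" "1 / real (Suc n) \<le> 1 / real (Suc N)"
        using that by (auto intro!: divide_left_mono)
      then show ?thesis using diff[of m n] N by (auto simp: dist_norm)
    qed
    then show "\<exists>N. \<forall>m\<ge>N. \<forall>n\<ge>N. dist (?I (s m)) (?I (s n)) < e" by blast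
  qed
  then obtain v where v: "(\<lambda>n. ?I (s n)) \<longlonglongrightarrow> v"
    using Cauchy_convergent_iff convergent_def by blast
  have IT: "?I (s n) \<in> T" for n
    unfolding simple_bochner_integral_def using T(1) sT
    by (intro subspace_sum subspace_scale) auto
  then have "v \<in> T"
    using closed_sequentially[OF T(2) _ v] by auto
  moreover have "has_bochner_integral_general M \<psi> v"
    unfolding has_bochner_integral_general_def using \<psi> s conv v by blast
  moreover have "l v = (\<integral>q. l (\<psi> q) \<partial>M)"
    if l: "linear_on (*\<^sub>R) T (*\<^sub>R) l" and C: "\<forall>z\<in>T. \<bar>l z\<bar> \<le> C * norm z"
      and lm: "(\<lambda>q. l (\<psi> q)) \<in> borel_measurable M" for l :: "'t \<Rightarrow> real" and C
  proof -
    have l_add: "l (x + y) = l x + l y" if "x \<in> T" "y \<in> T" for x y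
      using l that by (auto simp: linear_on_def)
    have l_sc: "l (c *\<^sub>R x) = c * l x" if "x \<in> T" for c x
      using l that by (auto simp: linear_on_def)
    have l_0: "l 0 = 0" using l_sc[of 0 0] subspace_0[OF T(1)] by simp
    have l_diff: "l (x - y) = l x - l y" if "x \<in> T" "y \<in> T" for x y
      using l_add[of x "-1 *\<^sub>R y"] l_sc[of y "-1"] that subspace_scale[OF T(1), of y "-1"] by simp
    have l_sum: "l (\<Sum>i\<in>S. c i *\<^sub>R y i) = (\<Sum>i\<in>S. c i * l (y i))" if "\<And>i. i \<in> S \<Longrightarrow> y i \<in> T"
      for S :: "'t set" and c y
      using that
      by (induction S rule: infinite_finite_induct)
        (auto simp: l_0 l_add l_sc subspace_sum[OF T(1)] subspace_scale[OF T(1)])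
    have lC: "\<bar>l x - l y\<bar> \<le> \<bar>C\<bar> * norm (x - y)" if "x \<in> T" "y \<in> T" for x y
      using C[rule_format, OF subspace_diff[OF T(1) that]] l_diff[OF that]
        mult_right_mono[OF abs_ge_self[of C] norm_ge_zero[of "x - y"]] by linarith
    \<comment> \<open>Composition with l gives simple functions again, converging in mean to l of
      \<open>\<psi>\<close>; grouping by the values of \<open>s n\<close> then pulls l out of the
      integral.\<close>
    have ls: "Bochner_Integration.simple_bochner_integrable M (\<lambda>q. l (s n q))" for n
      using simple_bochner_integrable_compose2[where p="\<lambda>x y. l x", OF _ s[of n] s[of n]] l_0 by simp
    have "Bochner_Integration.simple_bochner_integral M (\<lambda>q. l (s n q)) = l (?I (s n))" for n
    proof -
      have "Bochner_Integration.simple_bochner_integral M (\<lambda>q. l (s n q)) =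
         (\<Sum>y\<in>s n ` space M. measure M {x\<in>space M. s n x = y} *\<^sub>R l y)"
        using s[of n] by (intro simple_bochner_integral_partition ls) (auto elim: simple_bochner_integrable.cases)
      also have "\<dots> = l (?I (s n))"
        unfolding simple_bochner_integral_def using sT by (subst l_sum) auto
      finally show ?thesis .
    qed
    moreover have "(\<lambda>n. l (?I (s n))) \<longlonglongrightarrow> l v"
    proof (rule Lim_null_comparison[THEN LIM_zero_cancel])
      show "(\<lambda>n. \<bar>C\<bar> * norm (?I (s n) - v)) \<longlonglongrightarrow> 0"
        using v by (intro tendsto_mult_right_zero tendsto_norm_zero LIM_zero)
      show "\<forall>\<^sub>F n in sequentially. norm (l (?I (s n)) - l v) \<le> \<bar>C\<bar> * norm (?I (s n) - v)"
        using lC[OF IT \<open>v \<in> T\<close>] by simp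
    qed
    moreover have "(\<lambda>n. \<integral>\<^sup>+q. norm (l (\<psi> q) - l (s n q)) \<partial>M) \<longlonglongrightarrow> 0"
    proof (rule tendsto_sandwich[of "\<lambda>_. 0" _ _ "\<lambda>n. ennreal \<bar>C\<bar> * (\<integral>\<^sup>+q. norm (\<psi> q - s n q) \<partial>M)"])
      show "(\<lambda>n. ennreal \<bar>C\<bar> * (\<integral>\<^sup>+q. norm (\<psi> q - s n q) \<partial>M)) \<longlonglongrightarrow> 0"
        using ennreal_tendsto_cmult[OF _ conv, of "ennreal \<bar>C\<bar>"] by simp
      have "(\<integral>\<^sup>+q. norm (l (\<psi> q) - l (s n q)) \<partial>M) \<le> ennreal \<bar>C\<bar> * (\<integral>\<^sup>+q. norm (\<psi> q - s n q) \<partial>M)" for n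
      proof -
        have "(\<integral>\<^sup>+q. norm (l (\<psi> q) - l (s n q)) \<partial>M) \<le> (\<integral>\<^sup>+q. ennreal \<bar>C\<bar> * norm (\<psi> q - s n q) \<partial>M)"
          using lC[OF T(4)[rule_format] sT] by (intro nn_integral_mono) (auto simp flip: ennreal_mult intro!: ennreal_leI)
        also have "\<dots> = ennreal \<bar>C\<bar> * (\<integral>\<^sup>+q. norm (\<psi> q - s n q) \<partial>M)"
          using ms by (intro nn_integral_cmult) auto
        finally show ?thesis .
      qed
      then show "\<forall>\<^sub>F n in sequentially. (\<integral>\<^sup>+q. norm (l (\<psi> q) - l (s n q)) \<partial>M) \<le> ennreal \<bar>C\<bar> * (\<integral>\<^sup>+q. norm (\<psi> q - s n q) \<partial>M)"
        by simp
    qed simp_all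
    ultimately have "has_bochner_integral M (\<lambda>q. l (\<psi> q)) (l v)"
      using lm ls by (intro has_bochner_integral.intros[of _ _ "\<lambda>n q. l (s n q)"]) auto
    then show ?thesis by (simp add: has_bochner_integral_integral_eq)
  qed
  ultimately show thesis by (intro that) blast+
qed

section \<open>Weak limits of discrete measures on the line\<close>

text \<open>All atoms lie in [0,1], so the measures are tight and a subsequence converges weakly.
  Closedness of \<open>C\<close> puts the limit on \<open>C\<close>: a truncated distance to
  \<open>C\<close> has integral 0 against every measure of the sequence, hence against the
  limit.\<close>

lemma discrete_measures_weak_limit:
  fixes zs :: "nat \<Rightarrow> (real \<times> real) list" and C :: "real set"
  assumes nonneg: "\<And>n w t. (w, t) \<in> set (zs n) \<Longrightarrow> 0 \<le> w"
    and total: "\<And>n. (\<Sum>(w, t)\<leftarrow>zs n. w) = 1"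
    and supp: "\<And>n w t. (w, t) \<in> set (zs n) \<Longrightarrow> t \<in> C \<and> t \<in> {0..1}" and "closed C"
  obtains r M where "strict_mono (r :: nat \<Rightarrow> nat)" "real_distribution M" "AE t in M. t \<in> C"
    "\<forall>\<phi> B. continuous_on UNIV \<phi> \<longrightarrow> (\<forall>t. \<bar>\<phi> t\<bar> \<le> B) \<longrightarrow>
       (\<lambda>n. \<Sum>(w, t)\<leftarrow>zs (r n). w * \<phi> t) \<longlonglongrightarrow> (\<integral>t. \<phi> t \<partial>M)"
proof -
  \<comment> \<open>The weights are put on list positions, since a parameter may occur more than
    once in the list; the image measure adds such weights up.\<close>
  define P where "P n = point_measure {..<length (zs n)} (\<lambda>i. ennreal (fst (zs n ! i)))" for n
  define D where "D n = distr (P n) borel (\<lambda>i. snd (zs n ! i))" for n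
  have ls: "(\<Sum>(w, t)\<leftarrow>zs n. h w t) = (\<Sum>i<length (zs n). h (fst (zs n ! i)) (snd (zs n ! i)))" for n and h :: "real \<Rightarrow> real \<Rightarrow> real"
    by (simp add: sum_list_sum_nth atLeast0LessThan case_prod_beta)
  have w0: "0 \<le> fst (zs n ! i)" if "i < length (zs n)" for n i
    using nonneg[of "fst (zs n ! i)" "snd (zs n ! i)" n] that by simp
  have t0: "snd (zs n ! i) \<in> C" "snd (zs n ! i) \<in> {0..1}" if "i < length (zs n)" for n i
    using supp[of "fst (zs n ! i)" "snd (zs n ! i)" n] that by simp_all
  have "prob_space (P n)" for n
  proof
    have "emeasure (P n) (space (P n)) = (\<Sum>i<length (zs n). ennreal (fst (zs n ! i)))"
      by (simp add: P_def space_point_measure emeasure_point_measure_finite)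
    also have "\<dots> = ennreal (\<Sum>i<length (zs n). fst (zs n ! i))"
      using w0 by (intro sum_ennreal) auto
    also have "\<dots> = 1"
      using total[of n] unfolding ls by simp
    finally show "emeasure (P n) (space (P n)) = 1" .
  qed
  then have D: "real_distribution (D n)" for n
    unfolding D_def real_distribution_def real_distribution_axioms_def
    by (auto intro!: prob_space.prob_space_distr simp: P_def)
  have int: "(\<integral>t. \<phi> t \<partial>D n) = (\<Sum>(w, t)\<leftarrow>zs n. w * \<phi> t)" if "\<phi> \<in> borel_measurable borel" for \<phi> :: "real \<Rightarrow> real" and n
  proof -
    have "(\<integral>t. \<phi> t \<partial>D n) = (\<integral>i. \<phi> (snd (zs n ! i)) \<partial>P n)"
      unfolding D_def using that by (intro integral_distr) (auto simp: P_def)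
    also have "\<dots> = (\<Sum>i<length (zs n). fst (zs n ! i) * \<phi> (snd (zs n ! i)))"
      unfolding P_def by (subst lebesgue_integral_point_measure_finite) (use w0 in auto)
    finally show ?thesis by (simp add: ls)
  qed
  \<comment> \<open>Tightness is phrased with half-open intervals; the left end -1 keeps the
    parameter 0 inside.\<close>
  have one: "measure (D n) {-1<..1} = 1" for n
  proof -
    interpret real_distribution "D n" by (rule D)
    have "measure (D n) {-1<..1} = (\<integral>t. indicator {-1<..1} t \<partial>D n)" by simp
    also have "\<dots> = (\<Sum>(w, t)\<leftarrow>zs n. w * indicator {-1<..1} t)" by (rule int) auto
    also have "\<dots> = (\<Sum>(w, t)\<leftarrow>zs n. w)"
      unfolding ls using t0(2) by (intro sum.cong) (auto simp: indicator_def, fastforce+)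
    finally show ?thesis using total by simp
  qed
  have "tight D"
    unfolding tight_def
    by (intro conjI allI impI exI[of _ "-1"] exI[of _ 1]) (use D in \<open>simp_all add: one\<close>)
  from tight_imp_convergent_subsubsequence[OF this, of id] obtain r M where r: "strict_mono r"
    and M: "real_distribution M" and w: "weak_conv_m (D \<circ> id \<circ> r) M"
    by (auto simp: strict_mono_def)
  interpret M: real_distribution M by (rule M)
  have conv: "(\<lambda>n. \<Sum>(w, t)\<leftarrow>zs (r n). w * \<phi> t) \<longlonglongrightarrow> (\<integral>t. \<phi> t \<partial>M)"
    if "continuous_on UNIV \<phi>" "\<And>t. \<bar>\<phi> t\<bar> \<le> B" for \<phi> B
    using weak_conv_imp_integral_bdd_continuous_conv[OF _ M w, of \<phi> B] that D
      int[OF borel_measurable_continuous_onI[OF that(1)]]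
    by (simp add: continuous_on_eq_continuous_at)
  have "AE t in M. t \<in> C"
  proof (cases "C = {}")
    \<comment> \<open>The distance to the empty set is 0 by convention, so the empty case is
      excluded first: it would leave no atoms, contradicting total weight 1.\<close>
    case True
    then have "zs 0 = []" using supp[of _ _ 0] by (metis empty_iff last_in_set prod.collapse)
    then show ?thesis using total[of 0] by simp
  next
    case False
    let ?\<phi> = "\<lambda>t. min 1 (infdist t C)"
    have c: "continuous_on UNIV ?\<phi>" by (intro continuous_intros)
    have z: "(\<Sum>(w, t)\<leftarrow>zs (r n). w * ?\<phi> t) = 0" for n
      unfolding ls using t0(1) by (intro sum.neutral) auto
    have "(\<lambda>n. \<Sum>(w, t)\<leftarrow>zs (r n). w * ?\<phi> t) \<longlonglongrightarrow> (\<integral>t. ?\<phi> t \<partial>M)"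
      by (rule conv[OF c, of 1]) (simp add: infdist_nonneg)
    then have "(\<integral>t. ?\<phi> t \<partial>M) = 0"
      unfolding z by (simp add: LIMSEQ_const_iff)
    moreover have "integrable M ?\<phi>"
      by (rule M.integrable_const_bound[of _ 1])
        (use borel_measurable_continuous_onI[OF c] in \<open>auto simp: infdist_nonneg\<close>)
    ultimately have "AE t in M. ?\<phi> t = 0"
      using integral_nonneg_eq_0_iff_AE[of M ?\<phi>] by (auto simp: infdist_nonneg)
    then show ?thesis
      by eventually_elim (use in_closed_iff_infdist_zero[OF \<open>closed C\<close> False] in \<open>auto simp: min_def split: if_splits\<close>)
  qed
  with conv show thesis by (intro that[OF r M] allI impI) blast+
qed

section \<open>Countable norming and dense sequences\<close>

text \<open>The last clause makes the norm of f the supremum of the norms of f (x n), the other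
  inequality being automatic on the unit ball. The sequence x turns norms into countable suprema of
  weak* continuous functions, and d provides the centres that separability of the dual
  allows.\<close>

definition norming_sequences ::
    "('k::real_or_complex \<Rightarrow> 'v::real_normed_vector \<Rightarrow> 'v) \<Rightarrow> (nat \<Rightarrow> 'v) \<Rightarrow> (nat \<Rightarrow> 'v \<Rightarrow>\<^sub>L 'k) \<Rightarrow> bool" where
  "norming_sequences s x d \<longleftrightarrow> (\<forall>n. norm (x n) \<le> 1) \<and> range d \<subseteq> dual_space s \<and>
     (\<forall>f\<in>dual_space s. \<forall>e>0. \<exists>i. norm (f - d i) < e) \<and>
     (\<forall>f\<in>dual_space s. \<forall>r. (\<forall>n. norm (blinfun_apply f (x n)) \<le> r) \<longrightarrow> norm f \<le> r)"

lemma norming_sequencesD: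
  assumes "norming_sequences s x d"
  shows "norm (x n) \<le> 1" "range d \<subseteq> dual_space s"
    "f \<in> dual_space s \<Longrightarrow> 0 < e \<Longrightarrow> \<exists>i. norm (f - d i) < e"
    "f \<in> dual_space s \<Longrightarrow> (\<And>n. norm (blinfun_apply f (x n)) \<le> r) \<Longrightarrow> norm f \<le> r"
  using assms by (simp_all add: norming_sequences_def)

text \<open>Each member \<open>d n\<close> of a dense sequence attains its norm up to 1/(m+1) at
  some vector of the unit ball; all these vectors together norm every functional by
  approximation.\<close>

lemma norming_sequences_exist:
  fixes s :: "'k::real_or_complex \<Rightarrow> 'v::real_normed_vector \<Rightarrow> 'v"
  assumes "separable_space (top_of_set (dual_space s))"
  obtains x d where "norming_sequences s x d"
proof -
  obtain D where D: "countable D" "D \<subseteq> dual_space s" "top_of_set (dual_space s) closure_of D = dual_space s"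
    using assms by (auto simp: separable_space_def)
  have D': "dual_space s \<subseteq> closure D"
    using D(3) closure_mono[of "dual_space s \<inter> D" D] by (auto simp: closure_of_subtopology)
  have "0 \<in> dual_space s" by (simp add: dual_space_def)
  then have "D \<noteq> {}" using D' by auto
  define d where "d = from_nat_into D"
  have rd: "range d = D" using D(1) \<open>D \<noteq> {}\<close> by (simp add: d_def)
  have dense: "\<exists>i. norm (f - d i) < e" if fe: "f \<in> dual_space s" "0 < e" for f e
  proof -
    have "f \<in> closure D" using fe(1) D' by (rule rev_subsetD)
    then obtain g where g: "g \<in> D" "dist g f < e"
      using fe(2) unfolding closure_approachable by (elim allE[of _ e]) auto
    moreover obtain i where "g = d i" using g(1) unfolding rd[symmetric] by (rule rangeE)
    ultimately show ?thesis by (auto simp: dist_norm norm_minus_commute)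
  qed
  have "\<exists>y. norm y \<le> 1 \<and> norm (d n) - 1 / real (Suc m) \<le> norm (blinfun_apply (d n) y)" for n m
  proof (rule ccontr)
    assume "\<not> ?thesis"
    then have *: "norm (blinfun_apply (d n) y) < norm (d n) - 1 / real (Suc m)" if "norm y \<le> 1" for y
      using that by force
    have "norm (d n) \<le> norm (d n) - 1 / real (Suc m)"
    proof (rule norm_blinfun_bound)
      show "0 \<le> norm (d n) - 1 / real (Suc m)" using *[of 0] by simp
      fix y
      show "norm (blinfun_apply (d n) y) \<le> (norm (d n) - 1 / real (Suc m)) * norm y"
      proof (cases "y = 0")
        case False
        then show ?thesis
          using *[of "y /\<^sub>R norm y"] by (simp add: blinfun.scaleR_right divide_simps)
      qed simp
    qed
    then show False by simp
  qed
  then obtain y where y: "\<And>n m. norm (y n m) \<le> 1"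
    "\<And>n m. norm (d n) - 1 / real (Suc m) \<le> norm (blinfun_apply (d n) (y n m))" by metis
  define x where "x k = (case prod_decode k of (n, m) \<Rightarrow> y n m)" for k
  have "norm f \<le> r" if f: "f \<in> dual_space s" and r: "\<And>n. norm (blinfun_apply f (x n)) \<le> r" for f r
  proof (rule field_le_epsilon)
    fix e :: real assume "0 < e"
    \<comment> \<open>Three thirds: f is replaced by \<open>d n\<close> twice, once in the norm and
      once in the value, and \<open>d n\<close> misses its norm by less than e / 3.\<close>
    obtain n where n: "norm (f - d n) < e / 3" using dense[OF f, of "e / 3"] \<open>0 < e\<close> by auto
    obtain m where m: "1 / real (Suc m) < e / 3"
      using nat_approx_posE[of "e / 3"] \<open>0 < e\<close> by auto
    have "norm (blinfun_apply (d n) (y n m)) \<le> norm (blinfun_apply f (y n m)) + norm (blinfun_apply (f - d n) (y n m))"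
      using norm_triangle_ineq4[of "blinfun_apply f (y n m)" "blinfun_apply (f - d n) (y n m)"]
      by (simp add: blinfun.diff_left)
    also have "norm (blinfun_apply (f - d n) (y n m)) \<le> norm (f - d n) * 1"
      by (rule order_trans[OF norm_blinfun]) (intro mult_left_mono y norm_ge_zero)
    also have "norm (blinfun_apply f (y n m)) \<le> r"
      using r[of "prod_encode (n, m)"] by (simp add: x_def)
    finally have "norm (d n) \<le> r + norm (f - d n) + 1 / real (Suc m)"
      using y(2)[of n m] by linarith
    then show "norm f \<le> r + e"
      using n m norm_triangle_ineq[of "f - d n" "d n"] by (simp del: of_nat_Suc)
  qed
  moreover have "norm (x n) \<le> 1" for n using y(1) by (simp add: x_def split: prod.split)
  ultimately have "norming_sequences s x d"
    using dense rd D(2) by (simp add: norming_sequences_def)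
  then show thesis by (rule that)
qed

section \<open>Banach spaces as carrier sets\<close>

lemma banach_space_overD:
  assumes "banach_space_over s E"
  shows "normed_space_over s" "vector_space s" "closed E" "subspace E" "0 \<in> E"
    "\<And>x y. x \<in> E \<Longrightarrow> y \<in> E \<Longrightarrow> x + y \<in> E" "\<And>c x. x \<in> E \<Longrightarrow> s c x \<in> E"
    "\<And>x y. x \<in> E \<Longrightarrow> y \<in> E \<Longrightarrow> x - y \<in> E" "\<And>x. x \<in> E \<Longrightarrow> - x \<in> E"
    "\<And>x. s (- 1) x = - x" "\<And>a x. s (of_real a) x = a *\<^sub>R x" "\<And>c x. norm (s c x) = norm c * norm x"
proof -
  from assms interpret normed_space_over s by (simp add: banach_space_over_def)
  have E: "module.subspace s E" and "closed E" using assms by (auto simp: banach_space_over_def)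
  then show "closed E" by simp
  show "normed_space_over s" "vector_space s" by unfold_locales
  show "0 \<in> E" "\<And>x y. x \<in> E \<Longrightarrow> y \<in> E \<Longrightarrow> x + y \<in> E" "\<And>c x. x \<in> E \<Longrightarrow> s c x \<in> E"
    "\<And>x y. x \<in> E \<Longrightarrow> y \<in> E \<Longrightarrow> x - y \<in> E" "\<And>x. x \<in> E \<Longrightarrow> - x \<in> E"
    using E by (auto simp: subspace_0 subspace_add subspace_scale subspace_diff subspace_neg)
  show "s (- 1) x = - x" for x by simp
  show sc: "s (of_real a) x = a *\<^sub>R x" for a x by (rule scale_of_real)
  show "norm (s c x) = norm c * norm x" for c x by (rule norm_scale)
  show "Real_Vector_Spaces.subspace E"
    unfolding Real_Vector_Spaces.subspace_def
    using subspace_0[OF E] subspace_add[OF E] subspace_scale[OF E] by (metis sc)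
qed

lemma sum_list_in_space:
  assumes "banach_space_over s E" "\<And>i. i \<in> set is \<Longrightarrow> f i \<in> E"
  shows "(\<Sum>i\<leftarrow>is. f i) \<in> E"
  using assms(2) by (induction "is") (auto simp: banach_space_overD[OF assms(1)])

lemma linear_on_sum_list:
  assumes "banach_space_over sE E" "vector_space sG" "linear_on sE E sG f" "\<And>i. i \<in> set is \<Longrightarrow> g i \<in> E"
  shows "f (\<Sum>i\<leftarrow>is. g i) = (\<Sum>i\<leftarrow>is. f (g i))"
proof -
  interpret G: vector_space sG by fact
  interpret EE: vector_space sE using assms(1) by (rule banach_space_overD)
  have "f (sE 0 0) = sG 0 (f 0)"
    using assms(3) banach_space_overD(5)[OF assms(1)] unfolding linear_on_def by blast
  then have "f 0 = 0" by simp
  have add: "f (x + y) = f x + f y" if "x \<in> E" "y \<in> E" for x y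
    using assms(3) that by (auto simp: linear_on_def)
  show ?thesis
    using assms(4)
  proof (induction "is")
    case (Cons i "is")
    then show ?case
      using add[of "g i" "\<Sum>i\<leftarrow>is. g i"] sum_list_in_space[OF assms(1), of "is" g] by simp
  qed (simp add: \<open>f 0 = 0\<close>)
qed

lemma linear_on_diff:
  assumes E: "banach_space_over sE E" and G: "vector_space sG" and f: "linear_on sE E sG f" and "x \<in> E" "y \<in> E"
  shows "f (x - y) = f x - f y"
proof -
  interpret G: vector_space sG by fact
  have "f (x + sE (- 1) y) = f x + sG (- 1) (f y)"
    using f assms(4,5) banach_space_overD(7)[OF E] by (auto simp: linear_on_def)
  then show ?thesis by (simp add: banach_space_overD(10)[OF E])
qed

lemma linear_on_sums:
  fixes f :: "'e::banach \<Rightarrow> 'g::real_normed_vector"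
  assumes E: "banach_space_over sE E" and G: "vector_space sG" and f: "linear_on sE E sG f"
    and K: "\<And>x. x \<in> E \<Longrightarrow> norm (f x) \<le> K * norm x"
    and u: "\<And>k. u k \<in> E" "u sums U"
  shows "U \<in> E" "(\<lambda>k. f (u k)) sums f U"
proof -
  have part: "(\<Sum>k<n. u k) \<in> E" for n
    using u(1) by (intro real_vector.subspace_sum banach_space_overD(4)[OF E]) auto
  have lim: "(\<lambda>n. \<Sum>k<n. u k) \<longlonglongrightarrow> U" using u(2) by (simp add: sums_def)
  show U: "U \<in> E"
    using closed_sequentially[OF banach_space_overD(3)[OF E] _ lim] part by auto
  have fp: "f (\<Sum>k<n. u k) = (\<Sum>k<n. f (u k))" for n
    using linear_on_sum_list[OF E G f, of "[0..<n]" u] u(1)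
    by (simp add: sum_list_distinct_conv_sum_set atLeast0LessThan)
  show "(\<lambda>k. f (u k)) sums f U"
    unfolding sums_def
  proof (rule Lim_null_comparison[THEN LIM_zero_cancel])
    show "(\<lambda>n. K * norm ((\<Sum>k<n. u k) - U)) \<longlonglongrightarrow> 0"
      using lim by (intro tendsto_mult_right_zero tendsto_norm_zero LIM_zero)
    show "\<forall>\<^sub>F n in sequentially. norm ((\<Sum>k<n. f (u k)) - f U) \<le> K * norm ((\<Sum>k<n. u k) - U)"
      using K[OF banach_space_overD(8)[OF E part U]]
      by (simp add: linear_on_diff[OF E G f part U] fp)
  qed
qed

section \<open>Bounded coordinates in finite dimension\<close>

text \<open>Induction on the basis: bounded coordinates make the span of \<open>B\<close> closed, so
  the new vector \<open>b\<close> has positive distance d from it. This bounds the coefficient of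
  \<open>b\<close>; then the vector left after removing that term is bounded as well, and the
  induction hypothesis applies to it.\<close>

lemma (in normed_space_over) finite_dim_coordinates_bounded:
  fixes B :: "'v set"
  assumes "finite B" "independent B"
  shows "\<exists>M\<ge>0. \<forall>c. \<forall>b\<in>B. norm (c b) \<le> M * norm (\<Sum>b\<in>B. scale (c b) b)"
  using assms
proof (induction B)
  case empty
  show ?case by auto
next
  case (insert b B)
  have ind: "independent B" "b \<notin> span B"
    using insert.prems insert.hyps(2) by (auto simp: independent_insert)
  obtain M where M: "0 \<le> M" "\<And>c b. b \<in> B \<Longrightarrow> norm (c b) \<le> M * norm (\<Sum>b\<in>B. scale (c b) b)"
    using insert.IH[OF ind(1)] by auto
  have lim: "(\<lambda>n. scale (f n) v) \<longlonglongrightarrow> scale a v" if "f \<longlonglongrightarrow> a" for f :: "nat \<Rightarrow> 'k" and a v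
  proof (rule Lim_null_comparison[THEN LIM_zero_cancel])
    show "(\<lambda>n. norm (f n - a) * norm v) \<longlonglongrightarrow> 0"
      using that by (intro tendsto_mult_left_zero tendsto_norm_zero LIM_zero)
    show "\<forall>\<^sub>F n in sequentially. norm (scale (f n) v - scale a v) \<le> norm (f n - a) * norm v"
      by (simp flip: scale_left_diff_distrib add: norm_scale)
  qed
  have "closed (span B)"
    unfolding closed_sequential_limits
  proof (intro allI impI, elim conjE)
    fix v l assume v: "\<forall>n. v n \<in> span B" "v \<longlonglongrightarrow> l"
    then have "\<forall>n. \<exists>c. v n = (\<Sum>b\<in>B. scale (c b) b)"
      unfolding span_finite[OF insert.hyps(1)] by auto
    then obtain c where c: "\<And>n. v n = (\<Sum>b\<in>B. scale (c n b) b)" by metis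
    have "convergent (\<lambda>n. c n b)" if "b \<in> B" for b
    proof (rule Cauchy_convergent, rule metric_CauchyI)
      fix e :: real assume "0 < e"
      have "Cauchy v" using v(2) by (rule LIMSEQ_imp_Cauchy)
      then obtain N where N: "\<And>m n. N \<le> m \<Longrightarrow> N \<le> n \<Longrightarrow> dist (v m) (v n) < e / (M + 1)"
        using metric_CauchyD[of v "e / (M + 1)"] \<open>0 < e\<close> M(1) by auto
      have "dist (c m b) (c n b) < e" if "N \<le> m" "N \<le> n" for m n
      proof -
        have "norm (c m b - c n b) \<le> M * norm (v m - v n)"
          using M(2)[OF \<open>b \<in> B\<close>, of "\<lambda>b. c m b - c n b"]
          by (simp add: c scale_left_diff_distrib sum_subtractf)
        also have "\<dots> \<le> (M + 1) * norm (v m - v n)"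
          by (intro mult_right_mono) auto
        also have "\<dots> < e"
          using N[OF that] M(1) by (simp add: dist_norm field_simps)
        finally show ?thesis by (simp add: dist_norm)
      qed
      then show "\<exists>N. \<forall>m\<ge>N. \<forall>n\<ge>N. dist (c m b) (c n b) < e" by blast
    qed
    then obtain a where a: "\<And>b. b \<in> B \<Longrightarrow> (\<lambda>n. c n b) \<longlonglongrightarrow> a b"
      unfolding convergent_def by metis
    have "v \<longlonglongrightarrow> (\<Sum>b\<in>B. scale (a b) b)"
      unfolding c[abs_def] by (intro tendsto_sum lim a)
    then have "l = (\<Sum>b\<in>B. scale (a b) b)"
      using v(2) LIMSEQ_unique by blast
    then show "l \<in> span B"
      unfolding \<open>l = _\<close> by (intro span_sum span_scale span_base)
  qed
  then have "open (- span B)" by (rule open_Compl)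
  then obtain d where d: "0 < d" "ball b d \<subseteq> - span B"
    using ind(2) by (auto simp: open_contains_ball)
  have far: "d \<le> norm (b - w)" if "w \<in> span B" for w
    using d(2) that by (force simp: dist_norm)
  \<comment> \<open>First summand: the coefficient of \<open>b\<close> is at most norm v / d.
    Second: the remainder w has norm at most norm v * (1 + norm b / d) and costs a further factor
    M.\<close>
  define M' where "M' = 1 / d + M * (1 + norm b / d)"
  have "norm (c x) \<le> M' * norm (\<Sum>b\<in>insert b B. scale (c b) b)" if "x \<in> insert b B" for c x
  proof -
    define w where "w = (\<Sum>b\<in>B. scale (c b) b)"
    define v where "v = scale (c b) b + w"
    have v: "v = (\<Sum>b\<in>insert b B. scale (c b) b)"
      using insert.hyps by (simp add: v_def w_def)
    have w: "w \<in> span B"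
      unfolding w_def by (intro span_sum span_scale span_base)
    have cb: "norm (c b) \<le> norm v / d"
    proof (cases "c b = 0")
      case False
      \<comment> \<open>Dividing by the coefficient turns v into b minus a vector of the span, whose
        norm is at least d.\<close>
      have "scale (c b) (b - scale (- inverse (c b)) w) = v"
        using False by (simp add: v_def scale_right_distrib)
      then have "norm v = norm (c b) * norm (b - scale (- inverse (c b)) w)"
        by (metis norm_scale)
      also have "norm (c b) * d \<le> \<dots>"
        by (intro mult_left_mono far span_scale w) auto
      finally show ?thesis using d(1) by (simp add: field_simps)
    qed (use d(1) in simp)
    have "norm w \<le> norm v + norm (c b) * norm b"
      using norm_triangle_ineq4[of v "scale (c b) b"] by (simp add: v_def norm_scale)
    also have "\<dots> \<le> norm v + norm v / d * norm b"
      using cb by (intro add_left_mono mult_right_mono) auto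
    finally have wv: "norm w \<le> norm v * (1 + norm b / d)" by (simp add: field_simps)
    have "M * norm w \<le> M * (norm v * (1 + norm b / d))"
      using wv M(1) by (rule mult_left_mono)
    moreover have "0 \<le> M * (norm v * (1 + norm b / d))" "0 \<le> norm v / d"
      using M(1) d(1) by auto
    moreover have "M' * norm v = norm v / d + M * (norm v * (1 + norm b / d))"
      by (simp add: M'_def algebra_simps)
    moreover have "norm (c x) \<le> norm v / d \<or> norm (c x) \<le> M * norm w"
      using that cb M(2)[of x c] by (auto simp: w_def)
    ultimately show ?thesis unfolding v[symmetric] by linarith
  qed
  moreover have "0 \<le> M'" using M(1) d(1) by (simp add: M'_def)
  ultimately show ?case by blast
qed

section \<open>The projective tensor product\<close>

locale projective_tensor =
  fixes sE :: "'k::real_or_complex \<Rightarrow> 'e::banach \<Rightarrow> 'e" and E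
    and sF :: "'k \<Rightarrow> 'f::banach \<Rightarrow> 'f" and F
    and sT :: "'k \<Rightarrow> 't::banach \<Rightarrow> 't" and T \<tau>
  assumes E: "banach_space_over sE E" and F: "banach_space_over sF F"
    and tensor: "projective_tensor_product sE E sF F sT T \<tau>"
begin

abbreviation tsum :: "('e \<times> 'f) list \<Rightarrow> 't" where
  "tsum zs \<equiv> \<Sum>(x, y)\<leftarrow>zs. \<tau> x y"

abbreviation cost :: "('e \<times> 'f) list \<Rightarrow> real" where
  "cost zs \<equiv> \<Sum>(x, y)\<leftarrow>zs. norm x * norm y"

lemma T: "banach_space_over sT T"
  and bilinear: "bilinear_on sE E sF F sT \<tau>"
  and norm_tsum: "set zs \<subseteq> E \<times> F \<Longrightarrow> norm (tsum zs) = projective_norm sE E sF F zs"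
  and T_eq: "T = closure {tsum zs | zs. set zs \<subseteq> E \<times> F}"
  using tensor by (auto simp: projective_tensor_product_def)

lemma \<tau>_in_T: "x \<in> E \<Longrightarrow> y \<in> F \<Longrightarrow> \<tau> x y \<in> T"
  unfolding T_eq by (rule closure_subset[THEN subsetD]) (auto intro!: exI[of _ "[(x, y)]"])

lemma tsum_in_T: "set zs \<subseteq> E \<times> F \<Longrightarrow> tsum zs \<in> T"
  unfolding T_eq by (rule closure_subset[THEN subsetD]) auto

lemma cost_nonneg: "0 \<le> cost zs"
  by (induction zs) auto

lemma norm_tsum_le_cost: "set zs \<subseteq> E \<times> F \<Longrightarrow> norm (tsum zs) \<le> cost zs"
  unfolding norm_tsum projective_norm_def
  by (rule cInf_lower) (auto simp: same_tensor_def intro!: bdd_belowI[of _ 0] cost_nonneg)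

lemma norm_\<tau>_le: "x \<in> E \<Longrightarrow> y \<in> F \<Longrightarrow> norm (\<tau> x y) \<le> norm x * norm y"
  using norm_tsum_le_cost[of "[(x, y)]"] by simp

lemma almost_optimal_representation:
  assumes zs: "set zs \<subseteq> E \<times> F" and "0 < e"
  obtains ws where "set ws \<subseteq> E \<times> F" "same_tensor sE E sF F zs ws" "tsum ws = tsum zs"
    "cost ws < norm (tsum zs) + e"
proof -
  let ?S = "{cost ws | ws. set ws \<subseteq> E \<times> F \<and> same_tensor sE E sF F zs ws}"
  have "cost zs \<in> ?S" using zs by (auto simp: same_tensor_def)
  moreover have "Inf ?S < norm (tsum zs) + e"
    using \<open>0 < e\<close> unfolding norm_tsum[OF zs] projective_norm_def by simp
  ultimately obtain ws where ws: "set ws \<subseteq> E \<times> F" "same_tensor sE E sF F zs ws"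
    "cost ws < norm (tsum zs) + e"
    using cInf_lessD[of ?S "norm (tsum zs) + e"] by blast
  moreover have "tsum zs = tsum ws"
    by (rule same_tensor_imp_sum_eq[OF banach_space_overD(2)[OF T] bilinear zs ws(1,2)])
  ultimately show thesis by (intro that) auto
qed

lemma approximate_representation:
  assumes "z \<in> T" "0 < e"
  obtains zs where "set zs \<subseteq> E \<times> F" "norm (tsum zs - z) < e" "cost zs < norm z + e"
proof -
  have "\<exists>y\<in>{tsum zs | zs. set zs \<subseteq> E \<times> F}. dist y z < e / 2"
    using assms(1) half_gt_zero[OF assms(2)] unfolding T_eq closure_approachable by blast
  then obtain zs where zs: "set zs \<subseteq> E \<times> F" "norm (tsum zs - z) < e / 2"
    by (auto simp: dist_norm)
  obtain ws where ws: "set ws \<subseteq> E \<times> F" "same_tensor sE E sF F zs ws" "tsum ws = tsum zs"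
    "cost ws < norm (tsum zs) + e / 2"
    using half_gt_zero[OF assms(2)] by (rule almost_optimal_representation[OF zs(1)])
  have "norm (tsum zs) \<le> norm z + norm (tsum zs - z)"
    by (metis add.commute norm_triangle_sub)
  then show thesis
    using ws zs(2) \<open>0 < e\<close> by (intro that[of ws]) auto
qed

lemma uminus_left:
  fixes sG :: "'k \<Rightarrow> 'g::ab_group_add \<Rightarrow> 'g"
  assumes "vector_space sG" "bilinear_on sE E sF F sG A" "x \<in> E" "y \<in> F"
  shows "A (- x) y = - A x y"
proof -
  interpret G: vector_space sG by fact
  have "A (sE (- 1) x) y = sG (- 1) (A x y)"
    using assms(2-4) by (auto simp: bilinear_on_def linear_on_def)
  then show ?thesis by (simp add: banach_space_overD(10)[OF E])
qed

text \<open>Represents the negative tensor, so that \<open>zs @ neg ws\<close> stands for a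
  difference although lists have no subtraction.\<close>

definition neg :: "('e \<times> 'f) list \<Rightarrow> ('e \<times> 'f) list" where
  "neg = map (\<lambda>(x, y). (- x, y))"

lemma set_neg: "set zs \<subseteq> E \<times> F \<Longrightarrow> set (neg zs) \<subseteq> E \<times> F"
  using banach_space_overD(9)[OF E] by (auto simp: neg_def)

lemma sum_list_neg:
  fixes sG :: "'k \<Rightarrow> 'g::ab_group_add \<Rightarrow> 'g"
  assumes "vector_space sG" "bilinear_on sE E sF F sG A" "set zs \<subseteq> E \<times> F"
  shows "(\<Sum>(x, y)\<leftarrow>neg zs. A x y) = - (\<Sum>(x, y)\<leftarrow>zs. A x y)"
  using assms(3) by (induction zs) (auto simp: neg_def uminus_left[OF assms(1,2)])

lemma vector_space_scalars: "vector_space ((*) :: 'k \<Rightarrow> 'k \<Rightarrow> 'k)"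
  by unfold_locales (auto simp: algebra_simps)

text \<open>The sum depends only on the tensor that the list represents, so the list may be
  exchanged for one of nearly minimal cost, where the pointwise bound on \<open>A\<close> gives K
  times the cost.\<close>

lemma bilinear_form_sum_le:
  fixes A :: "'e \<Rightarrow> 'f \<Rightarrow> 'k"
  assumes A: "bilinear_on sE E sF F (*) A"
    and K: "\<And>x y. x \<in> E \<Longrightarrow> y \<in> F \<Longrightarrow> norm (A x y) \<le> K * (norm x * norm y)" "0 \<le> K"
    and zs: "set zs \<subseteq> E \<times> F"
  shows "norm (\<Sum>(x, y)\<leftarrow>zs. A x y) \<le> K * norm (tsum zs)"
proof (rule field_le_epsilon)
  fix e :: real assume "0 < e"
  then have "0 < e / (K + 1)" using K(2) by simp
  then obtain ws where ws: "set ws \<subseteq> E \<times> F" "same_tensor sE E sF F zs ws" "tsum ws = tsum zs"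
    "cost ws < norm (tsum zs) + e / (K + 1)"
    by (rule almost_optimal_representation[OF zs])
  have "norm (\<Sum>(x, y)\<leftarrow>zs. A x y) = norm (\<Sum>(x, y)\<leftarrow>ws. A x y)"
    using same_tensor_imp_sum_eq[OF vector_space_scalars A zs ws(1,2)] by simp
  also have "\<dots> \<le> K * cost ws"
    using ws(1)
  proof (induction ws)
    case (Cons p ws)
    obtain x y where p: "p = (x, y)" by force
    have "norm (A x y + (\<Sum>(x, y)\<leftarrow>ws. A x y)) \<le> K * (norm x * norm y) + K * cost ws"
      using Cons p by (intro norm_triangle_mono K) auto
    then show ?case by (simp add: p distrib_left)
  qed simp
  also have "\<dots> \<le> K * (norm (tsum zs) + e / (K + 1))"
    using ws(4) K(2) by (intro mult_left_mono) auto
  also have "\<dots> \<le> K * norm (tsum zs) + e"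
    using K(2) \<open>0 < e\<close> by (simp add: field_simps)
  finally show "norm (\<Sum>(x, y)\<leftarrow>zs. A x y) \<le> K * norm (tsum zs) + e" .
qed

text \<open>The functional on \<open>T\<close> is the limit of \<open>A\<close> along approximating finite tensors.\<close>

lemma bilinear_form_extends:
  fixes A :: "'e \<Rightarrow> 'f \<Rightarrow> 'k"
  assumes A: "bilinear_on sE E sF F (*) A"
    and K: "\<And>x y. x \<in> E \<Longrightarrow> y \<in> F \<Longrightarrow> norm (A x y) \<le> K * (norm x * norm y)" "0 \<le> K"
  obtains L where "linear_on sT T (*) L" "\<And>z. z \<in> T \<Longrightarrow> norm (L z) \<le> K * norm z"
    "\<And>zs. set zs \<subseteq> E \<times> F \<Longrightarrow> L (tsum zs) = (\<Sum>(x, y)\<leftarrow>zs. A x y)"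
proof -
  let ?A = "\<lambda>zs. \<Sum>(x, y)\<leftarrow>zs. A x y"
  note VT = banach_space_overD(2)[OF T]
  have diff: "norm (?A zs - ?A ws) \<le> K * norm (tsum zs - tsum ws)"
    if "set zs \<subseteq> E \<times> F" "set ws \<subseteq> E \<times> F" for zs ws
    using bilinear_form_sum_le[OF A K, of "zs @ neg ws"] set_neg[OF that(2)] that
    by (simp add: sum_list_neg[OF vector_space_scalars A] sum_list_neg[OF VT bilinear])
  have "\<exists>zs. set zs \<subseteq> E \<times> F \<and> norm (tsum zs - z) < 1 / real (Suc n)" if "z \<in> T" for z n
    by (rule approximate_representation[OF that, of "1 / real (Suc n)"]) auto
  then obtain r where r: "\<And>z n. z \<in> T \<Longrightarrow> set (r z n) \<subseteq> E \<times> F"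
    "\<And>z n. z \<in> T \<Longrightarrow> norm (tsum (r z n) - z) < 1 / real (Suc n)" by metis
  have r_lim: "(\<lambda>n. tsum (r z n)) \<longlonglongrightarrow> z" if "z \<in> T" for z
  proof (rule Lim_null_comparison[THEN LIM_zero_cancel])
    show "(\<lambda>n. 1 / real (Suc n)) \<longlonglongrightarrow> 0" by (rule LIMSEQ_Suc[OF lim_1_over_n])
    show "\<forall>\<^sub>F n in sequentially. norm (tsum (r z n) - z) \<le> 1 / real (Suc n)"
      using r(2)[OF that] by (simp add: less_imp_le)
  qed
  define L where "L z = lim (\<lambda>n. ?A (r z n))" for z
  have "(\<lambda>n. ?A (r z n)) \<longlonglongrightarrow> L z" if "z \<in> T" for z
  proof -
    have "Cauchy (\<lambda>n. ?A (r z n))"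
    proof (rule metric_CauchyI)
      fix e :: real assume "0 < e"
      have "Cauchy (\<lambda>n. tsum (r z n))" using r_lim[OF that] by (rule LIMSEQ_imp_Cauchy)
      then obtain N where N: "\<And>m n. N \<le> m \<Longrightarrow> N \<le> n \<Longrightarrow> dist (tsum (r z m)) (tsum (r z n)) < e / (K + 1)"
        using metric_CauchyD[of "\<lambda>n. tsum (r z n)" "e / (K + 1)"] \<open>0 < e\<close> K(2) by auto
      have "dist (?A (r z m)) (?A (r z n)) < e" if "N \<le> m" "N \<le> n" for m n
      proof -
        have "dist (?A (r z m)) (?A (r z n)) \<le> K * dist (tsum (r z m)) (tsum (r z n))"
          unfolding dist_norm by (rule diff[OF r(1) r(1)]) fact+
        also have "\<dots> \<le> (K + 1) * dist (tsum (r z m)) (tsum (r z n))"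
          by (intro mult_right_mono) auto
        also have "\<dots> < e"
          using N[OF that] K(2) by (simp add: field_simps)
        finally show ?thesis .
      qed
      then show "\<exists>N. \<forall>m\<ge>N. \<forall>n\<ge>N. dist (?A (r z m)) (?A (r z n)) < e" by blast
    qed
    then show ?thesis unfolding L_def by (simp add: Cauchy_convergent_iff convergent_LIMSEQ_iff)
  qed
  \<comment> \<open>The value does not depend on the approximating sequence. Additivity and
    homogeneity follow by using concatenated and rescaled lists in place of the chosen ones.\<close>
  then have L_lim: "(\<lambda>n. ?A (zs n)) \<longlonglongrightarrow> L z"
    if zs: "\<And>n. set (zs n) \<subseteq> E \<times> F" "(\<lambda>n. tsum (zs n)) \<longlonglongrightarrow> z" and "z \<in> T" for zs z
  proof -
    have "(\<lambda>n. ?A (zs n) - ?A (r z n)) \<longlonglongrightarrow> 0"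
    proof (rule Lim_null_comparison)
      show "\<forall>\<^sub>F n in sequentially. norm (?A (zs n) - ?A (r z n)) \<le> K * norm (tsum (zs n) - tsum (r z n))"
        using diff zs(1) r(1)[OF \<open>z \<in> T\<close>] by simp
      have "(\<lambda>n. tsum (zs n) - tsum (r z n)) \<longlonglongrightarrow> 0"
        using tendsto_diff[OF zs(2) r_lim[OF \<open>z \<in> T\<close>]] by simp
      then show "(\<lambda>n. K * norm (tsum (zs n) - tsum (r z n))) \<longlonglongrightarrow> 0"
        by (intro tendsto_mult_right_zero tendsto_norm_zero)
    qed
    from tendsto_add[OF this \<open>\<And>z. z \<in> T \<Longrightarrow> (\<lambda>n. ?A (r z n)) \<longlonglongrightarrow> L z\<close>[OF \<open>z \<in> T\<close>]]
    show ?thesis by simp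
  qed
  show thesis
  proof (rule that[of L])
    show "L (tsum zs) = ?A zs" if "set zs \<subseteq> E \<times> F" for zs
      using L_lim[of "\<lambda>_. zs" "tsum zs"] that tsum_in_T by (simp add: LIMSEQ_const_iff)
    show "norm (L z) \<le> K * norm z" if "z \<in> T" for z
    proof (rule LIMSEQ_le)
      show "(\<lambda>n. norm (?A (r z n))) \<longlonglongrightarrow> norm (L z)"
        by (intro tendsto_norm L_lim r r_lim that)
      show "(\<lambda>n. K * norm (tsum (r z n))) \<longlonglongrightarrow> K * norm z"
        by (intro tendsto_intros r_lim that)
      show "\<exists>N. \<forall>n\<ge>N. norm (?A (r z n)) \<le> K * norm (tsum (r z n))"
        using bilinear_form_sum_le[OF A K r(1)[OF that]] by blast
    qed
    have "L (z + w) = L z + L w" if "z \<in> T" "w \<in> T" for z w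
    proof (rule LIMSEQ_unique)
      have "(\<lambda>n. tsum (r z n @ r w n)) \<longlonglongrightarrow> z + w"
        using tendsto_add[OF r_lim r_lim, OF that] by simp
      then show "(\<lambda>n. ?A (r z n @ r w n)) \<longlonglongrightarrow> L (z + w)"
        using r(1) that by (intro L_lim banach_space_overD(6)[OF T]) auto
      show "(\<lambda>n. ?A (r z n @ r w n)) \<longlonglongrightarrow> L z + L w"
        using tendsto_add[OF L_lim[OF r(1) r_lim] L_lim[OF r(1) r_lim], OF that(1) that(1) that(1) that(2) that(2) that(2)]
        by simp
    qed
    moreover have "L (sT c z) = c * L z" if "z \<in> T" for c z
    proof (rule LIMSEQ_unique)
      define q where "q n = map (\<lambda>(x, y). (sE c x, y)) (r z n)" for n
      have q: "set (q n) \<subseteq> E \<times> F" for n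
        using r(1)[OF that, of n] banach_space_overD(7)[OF E] by (auto simp: q_def)
      have scale: "(\<Sum>(x, y)\<leftarrow>map (\<lambda>(x, y). (sE c x, y)) zs. B x y) = sG c (\<Sum>(x, y)\<leftarrow>zs. B x y)"
        if "vector_space sG" "bilinear_on sE E sF F sG B" "set zs \<subseteq> E \<times> F"
        for sG :: "'k \<Rightarrow> 'g::ab_group_add \<Rightarrow> 'g" and B zs
      proof -
        interpret G: vector_space sG by fact
        show ?thesis
          using that(3) by (induction zs) (use that(2) in \<open>auto simp: G.scale_right_distrib bilinear_on_def linear_on_def\<close>)
      qed
      have "tsum (q n) = sT c (tsum (r z n))" for n
        unfolding q_def by (rule scale[OF VT bilinear r(1)[OF that]])
      moreover have "(\<lambda>n. sT c (tsum (r z n))) \<longlonglongrightarrow> sT c z"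
      proof (rule Lim_null_comparison[THEN LIM_zero_cancel])
        interpret TT: vector_space sT by (rule VT)
        show "(\<lambda>n. norm c * norm (tsum (r z n) - z)) \<longlonglongrightarrow> 0"
          using r_lim[OF that] by (intro tendsto_mult_right_zero tendsto_norm_zero LIM_zero)
        show "\<forall>\<^sub>F n in sequentially. norm (sT c (tsum (r z n)) - sT c z) \<le> norm c * norm (tsum (r z n) - z)"
          by (simp flip: TT.scale_right_diff_distrib add: banach_space_overD(12)[OF T])
      qed
      ultimately show "(\<lambda>n. ?A (q n)) \<longlonglongrightarrow> L (sT c z)"
        using that by (intro L_lim q banach_space_overD(7)[OF T]) auto
      have "?A (q n) = c * ?A (r z n)" for n
        unfolding q_def by (rule scale[OF vector_space_scalars A r(1)[OF that]])
      then show "(\<lambda>n. ?A (q n)) \<longlonglongrightarrow> c * L z"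
        by (simp add: tendsto_mult_left L_lim[OF r(1) r_lim] that)
    qed
    ultimately show "linear_on sT T (*) L" by (simp add: linear_on_def)
  qed
qed

text \<open>Telescoping: z is approximated up to (1/4)^n and consecutive differences are represented
  anew at almost their norm, so the costs decay at the same rate. The ratio 1/4 is later split as
  1/2 * 1/2 between first and second factors.\<close>

lemma series_representation:
  assumes "z \<in> T"
  obtains zs C where "\<And>k. set (zs k) \<subseteq> E \<times> F" "\<And>k. cost (zs k) \<le> C * (1 / 4) ^ k"
    "(\<lambda>k. tsum (zs k)) sums z"
proof -
  note VT = banach_space_overD(2)[OF T]
  have "\<exists>zs. set zs \<subseteq> E \<times> F \<and> norm (tsum zs - z) < (1 / 4) ^ n" for n :: nat
    by (rule approximate_representation[OF assms, of "(1 / 4) ^ n"]) auto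
  then obtain a where a: "\<And>n. set (a n) \<subseteq> E \<times> F" "\<And>n::nat. norm (tsum (a n) - z) < (1 / 4) ^ n"
    by metis
  have "\<exists>ws. set ws \<subseteq> E \<times> F \<and> tsum ws = tsum (a (Suc n)) - tsum (a n) \<and>
    cost ws < norm (tsum (a (Suc n)) - tsum (a n)) + (1 / 4) ^ n" for n
  proof -
    have "set (a (Suc n) @ neg (a n)) \<subseteq> E \<times> F" using a(1) set_neg[OF a(1)] by auto
    moreover have "0 < (1 / 4 :: real) ^ n" by simp
    ultimately obtain ws where "set ws \<subseteq> E \<times> F" "same_tensor sE E sF F (a (Suc n) @ neg (a n)) ws" "tsum ws = tsum (a (Suc n) @ neg (a n))"
      "cost ws < norm (tsum (a (Suc n) @ neg (a n))) + (1 / 4) ^ n"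
      by (rule almost_optimal_representation)
    then show ?thesis by (intro exI[of _ ws]) (simp add: sum_list_neg[OF VT bilinear a(1)])
  qed
  then obtain w where w: "\<And>n. set (w n) \<subseteq> E \<times> F" "\<And>n. tsum (w n) = tsum (a (Suc n)) - tsum (a n)"
    "\<And>n. cost (w n) < norm (tsum (a (Suc n)) - tsum (a n)) + (1 / 4) ^ n" by metis
  define zs where "zs k = (case k of 0 \<Rightarrow> a 0 | Suc n \<Rightarrow> w n)" for k
  have zsE: "set (zs k) \<subseteq> E \<times> F" for k
    using a(1) w(1) by (simp add: zs_def split: nat.split)
  have "(\<Sum>k<Suc n. tsum (zs k)) = tsum (a n)" for n
    by (induction n) (simp_all add: zs_def w(2))
  moreover have "(\<lambda>n. tsum (a n)) \<longlonglongrightarrow> z"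
  proof (rule Lim_null_comparison[THEN LIM_zero_cancel])
    show "(\<lambda>n. (1 / 4) ^ n :: real) \<longlonglongrightarrow> 0" by (rule LIMSEQ_realpow_zero) auto
    show "\<forall>\<^sub>F n in sequentially. norm (tsum (a n) - z) \<le> (1 / 4) ^ n"
      using a(2) by (simp add: less_imp_le)
  qed
  ultimately have "(\<lambda>n. \<Sum>k<Suc n. tsum (zs k)) \<longlonglongrightarrow> z" by simp
  then have sums: "(\<lambda>k. tsum (zs k)) sums z"
    unfolding sums_def by (rule LIMSEQ_imp_Suc)
  \<comment> \<open>For k = n + 1 the cost is at most 3 * (1/4)^n = 12 * (1/4)^k; block 0 is
    \<open>a 0\<close> itself and brings its own cost.\<close>
  define C where "C = max (cost (a 0)) 12"
  have "cost (zs k) \<le> C * (1 / 4) ^ k" for k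
  proof (cases k)
    case (Suc n)
    have "norm (tsum (a (Suc n)) - tsum (a n)) \<le> norm (tsum (a (Suc n)) - z) + norm (tsum (a n) - z)"
      using norm_triangle_ineq4[of "tsum (a (Suc n)) - z" "tsum (a n) - z"] by simp
    also have "\<dots> \<le> (1 / 4) ^ Suc n + (1 / 4) ^ n"
      using a(2)[of n] a(2)[of "Suc n"] by simp
    finally have "cost (w n) \<le> 3 * (1 / 4) ^ n"
      using w(3)[of n] by (simp add: field_simps)
    also have "\<dots> = 12 * (1 / 4) ^ k" by (simp add: Suc)
    also have "\<dots> \<le> C * (1 / 4) ^ k"
      unfolding C_def by (intro mult_right_mono) auto
    finally show ?thesis by (simp add: zs_def Suc)
  qed (simp add: zs_def C_def)
  with zsE sums show thesis by (intro that)
qed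

end

section \<open>Injectivity under the approximation property\<close>

text \<open>A maximal independent subset of a spanning set writes S as a finite sum of terms c b x
  times b. The coordinates are bounded as in any finite-dimensional space, and this is what allows
  them to be applied to infinite series.\<close>

lemma finite_rank_coordinates:
  fixes sE :: "'k::real_or_complex \<Rightarrow> 'e::banach \<Rightarrow> 'e"
  assumes E: "banach_space_over sE E" and S: "finite_rank_operator_on sE E S"
  obtains B c K where "finite B" "B \<subseteq> E" "\<forall>b\<in>B. linear_on sE E (*) (c b)"
    "\<forall>b\<in>B. \<forall>x\<in>E. norm (c b x :: 'k) \<le> K * norm x" "0 \<le> K"
    "\<forall>x\<in>E. S x = (\<Sum>b\<in>B. sE (c b x) b)"
proof -
  interpret normed_space_over sE by (rule banach_space_overD(1)[OF E])
  obtain M0 B0 where lin: "linear_on sE E sE S" and M0: "\<And>x. x \<in> E \<Longrightarrow> norm (S x) \<le> M0 * norm x"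
    and B0: "finite B0" "B0 \<subseteq> E" "S ` E \<subseteq> span B0"
    using S by (auto simp: finite_rank_operator_on_def)
  obtain B where B: "B \<subseteq> B0" "independent B" "B0 \<subseteq> span B"
    by (rule maximal_independent_subset[of B0]) blast
  have fin: "finite B" using B(1) B0(1) by (rule finite_subset)
  have SB: "S x \<in> span B" if "x \<in> E" for x
    using B0(3) span_minimal[OF B(3) subspace_span] that by blast
  define c where "c b x = representation B (S x) b" for b x
  obtain M where M: "0 \<le> M" "\<And>c b. b \<in> B \<Longrightarrow> norm (c b) \<le> M * norm (\<Sum>b\<in>B. sE (c b) b)"
    using finite_dim_coordinates_bounded[OF fin B(2)] by blast
  have Sc: "S x = (\<Sum>b\<in>B. sE (c b x) b)" if "x \<in> E" for x
    unfolding c_def using sum_representation_eq[OF B(2) SB[OF that] fin] by simp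
  show thesis
  proof (rule that[of B c "M * \<bar>M0\<bar>"])
    show "\<forall>b\<in>B. linear_on sE E (*) (c b)"
      using lin B(2) SB by (auto simp: linear_on_def c_def representation_add representation_scale)
    show "\<forall>b\<in>B. \<forall>x\<in>E. norm (c b x) \<le> M * \<bar>M0\<bar> * norm x"
    proof (intro ballI)
      fix b x assume that: "b \<in> B" "x \<in> E"
      have "norm (c b x) \<le> M * norm (S x)"
        using M(2)[OF that(1), of "\<lambda>b. c b x"] by (simp add: Sc[OF that(2), symmetric])
      also have "norm (S x) \<le> \<bar>M0\<bar> * norm x"
        using M0[OF that(2)] by (rule order_trans) (intro mult_right_mono, auto)
      finally show "norm (c b x) \<le> M * \<bar>M0\<bar> * norm x"
        using M(1) by (simp add: mult_left_mono mult.assoc)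
    qed
  qed (use fin B B0 M Sc in auto)
qed

lemma norm_sum_list_le:
  assumes "\<And>p. p \<in> set ps \<Longrightarrow> norm (f p) \<le> g p"
  shows "norm (\<Sum>p\<leftarrow>ps. f p) \<le> (\<Sum>p\<leftarrow>ps. g p)"
  using assms
proof (induction ps)
  case (Cons p ps)
  then have "norm (f p) \<le> g p" "norm (\<Sum>p\<leftarrow>ps. f p) \<le> (\<Sum>p\<leftarrow>ps. g p)" by auto
  then show ?case using norm_triangle_mono by force
qed simp

text \<open>The member of an open cover that contains 0 also contains all but finitely many of the
  sets, and each of these is finite.\<close>

lemma compact_insert_zero_null_sets:
  fixes A :: "nat \<Rightarrow> 'a::real_normed_vector set"
  assumes fin: "\<And>k. finite (A k)" and le: "\<And>k x. x \<in> A k \<Longrightarrow> norm x \<le> (1 / 2) ^ k"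
  shows "compact (insert 0 (\<Union>k. A k))"
  unfolding compact_eq_Heine_Borel
proof (intro allI impI, elim conjE)
  fix \<U> :: "'a set set"
  assume \<U>: "\<forall>U\<in>\<U>. open U" "insert 0 (\<Union>k. A k) \<subseteq> \<Union>\<U>"
  then obtain U where U: "U \<in> \<U>" "0 \<in> U" "open U" by auto
  then obtain e where e: "0 < e" "ball 0 e \<subseteq> U" by (meson openE)
  obtain N where N: "(1 / 2 :: real) ^ N < e" using real_arch_pow_inv[of e "1 / 2"] e(1) by auto
  have tail: "A k \<subseteq> U" if "N \<le> k" for k
  proof
    fix x assume "x \<in> A k"
    then have "norm x \<le> (1 / 2) ^ k" by (rule le)
    also have "\<dots> \<le> (1 / 2) ^ N" using that by (intro power_decreasing) auto
    finally show "x \<in> U" using N e(2) by (auto simp: subset_iff)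
  qed
  have "finite (\<Union>k<N. A k)" using fin by auto
  moreover have "(\<Union>k<N. A k) \<subseteq> \<Union>\<U>" using \<U>(2) by auto
  ultimately obtain \<V> where \<V>: "\<V> \<subseteq> \<U>" "finite \<V>" "(\<Union>k<N. A k) \<subseteq> \<Union>\<V>"
    using finite_subset_Union by (metis finite_imp_compact compactE \<U>(1) subset_iff)
  have "insert 0 (\<Union>k. A k) \<subseteq> \<Union>(insert U \<V>)"
  proof
    fix x assume "x \<in> insert 0 (\<Union>k. A k)"
    then consider "x = 0" | k where "x \<in> A k" "k < N" | k where "x \<in> A k" "N \<le> k"
      by (auto simp: not_less[symmetric])
    then show "x \<in> \<Union>(insert U \<V>)"
      using tail \<V>(3) U(2) by cases blast+
  qed
  then show "\<exists>D\<subseteq>\<U>. finite D \<and> insert 0 (\<Union>k. A k) \<subseteq> \<Union>D"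
    using \<V>(1,2) U(1) by (intro exI[of _ "insert U \<V>"]) auto
qed

text \<open>Every nonzero x is scaled to norm r and the factor is moved to y, so the norms of the y
  add up to the cost divided by r. For blocks of cost C * (1/4)^k and r = (1/2)^k both sides decay
  like (1/2)^k.\<close>

lemma normalize_representation:
  fixes sE :: "'k::real_or_complex \<Rightarrow> 'e::banach \<Rightarrow> 'e" and sF :: "'k \<Rightarrow> 'f::banach \<Rightarrow> 'f"
  assumes E: "banach_space_over sE E" and F: "banach_space_over sF F" and "0 < r"
    and zs: "set zs \<subseteq> E \<times> F"
  obtains ws where "set ws \<subseteq> E \<times> F" "\<forall>(x, y)\<in>set ws. norm x \<le> r"
    "(\<Sum>(x, y)\<leftarrow>ws. norm y) \<le> (\<Sum>(x, y)\<leftarrow>zs. norm x * norm y) / r"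
    "same_tensor sE E sF F zs ws"
proof -
  define a where "a x = (if x = 0 then 0 else r / norm x)" for x :: 'e
  define b where "b x = (if x = 0 then 0 else norm x / r)" for x :: 'e
  define h where "h = (\<lambda>(x, y). (sE (of_real (a x)) x, sF (of_real (b x)) y))"
  have sum_eq: "(\<Sum>(x, y)\<leftarrow>map h zs. A x y) = (\<Sum>(x, y)\<leftarrow>zs. A x y)"
    if A: "bilinear_on sE E sF F (*) A" for A :: "'e \<Rightarrow> 'f \<Rightarrow> 'k"
  proof -
    have pt: "A (sE (of_real (a x)) x) (sF (of_real (b x)) y) = A x y" if "x \<in> E" "y \<in> F" for x y
    proof -
      have A1: "A (sE c x) y = c * A x y" if "x \<in> E" "y \<in> F" for c x y
        using A that by (auto simp: bilinear_on_def linear_on_def)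
      have A2: "A x (sF c y) = c * A x y" if "x \<in> E" "y \<in> F" for c x y
        using A that by (auto simp: bilinear_on_def linear_on_def)
      have "A (sE (of_real (a x)) x) (sF (of_real (b x)) y) = of_real (a x * b x) * A x y"
        using that banach_space_overD(7)[OF F] by (simp add: A1 A2)
      also have "\<dots> = A x y"
      proof (cases "x = 0")
        case True
        then have "A x y = 0 * A x y"
          using A1[OF that, of 0] banach_space_overD(11)[OF E, of 0 x] by simp
        then show ?thesis using True by (simp add: a_def)
      qed (use \<open>0 < r\<close> in \<open>simp add: a_def b_def\<close>)
      finally show ?thesis .
    qed
    show ?thesis using zs by (induction zs) (auto simp: h_def pt)
  qed
  show thesis
  proof (rule that[of "map h zs"])
    show "set (map h zs) \<subseteq> E \<times> F"
      using zs banach_space_overD(7)[OF E] banach_space_overD(7)[OF F] by (auto simp: h_def)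
    show "\<forall>(x, y)\<in>set (map h zs). norm x \<le> r"
      using \<open>0 < r\<close> by (auto simp: h_def a_def banach_space_overD(12)[OF E] norm_divide)
    show "(\<Sum>(x, y)\<leftarrow>map h zs. norm y) \<le> (\<Sum>(x, y)\<leftarrow>zs. norm x * norm y) / r"
      using \<open>0 < r\<close>
      by (induction zs) (auto simp: h_def b_def banach_space_overD(12)[OF F] norm_divide add_divide_distrib)
    show "same_tensor sE E sF F zs (map h zs)"
      unfolding same_tensor_def by (intro allI impI sum_eq[symmetric])
  qed
qed

text \<open>Serves all series over balanced blocks: the first factors stay bounded and enter D,
  while the norms of the second factors are summable; the factor 2 is the geometric sum.\<close>

lemma block_summable:
  fixes f :: "'e::real_normed_vector \<Rightarrow> 'f::real_normed_vector \<Rightarrow> 'g::banach"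
  assumes ws: "\<And>k x y. (x, y) \<in> set (ws k) \<Longrightarrow> norm (f x y) \<le> D * norm y"
    and small: "\<And>k::nat. (\<Sum>(x, y)\<leftarrow>ws k. norm y) \<le> C * (1 / 2) ^ k" and "0 \<le> D"
  shows "summable (\<lambda>k. \<Sum>(x, y)\<leftarrow>ws k. f x y)" "norm (\<Sum>k. \<Sum>(x, y)\<leftarrow>ws k. f x y) \<le> 2 * D * C"
proof -
  have sm: "(\<lambda>k. D * C * (1 / 2) ^ k) sums (D * C * 2)"
    using sums_mult[OF geometric_sums[of "1 / 2 :: real"], of "D * C"] by simp
  have le: "norm (\<Sum>(x, y)\<leftarrow>ws k. f x y) \<le> D * C * (1 / 2) ^ k" for k
  proof -
    have "norm (\<Sum>(x, y)\<leftarrow>ws k. f x y) \<le> (\<Sum>(x, y)\<leftarrow>ws k. D * norm y)"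
      using ws by (intro norm_sum_list_le) (auto simp: case_prod_beta)
    also have "\<dots> = D * (\<Sum>(x, y)\<leftarrow>ws k. norm y)"
      by (simp add: case_prod_unfold sum_list_const_mult)
    also have "\<dots> \<le> D * (C * (1 / 2) ^ k)"
      using small \<open>0 \<le> D\<close> by (intro mult_left_mono)
    finally show ?thesis by (simp add: mult.assoc)
  qed
  have sn: "summable (\<lambda>k. norm (\<Sum>(x, y)\<leftarrow>ws k. f x y))"
    by (rule summable_comparison_test'[OF sums_summable[OF sm], of 0]) (use le in auto)
  then show "summable (\<lambda>k. \<Sum>(x, y)\<leftarrow>ws k. f x y)" by (rule summable_norm_cancel)
  have "norm (\<Sum>k. \<Sum>(x, y)\<leftarrow>ws k. f x y) \<le> (\<Sum>k. norm (\<Sum>(x, y)\<leftarrow>ws k. f x y))"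
    using sn by (rule summable_norm)
  also have "\<dots> \<le> (\<Sum>k. D * C * (1 / 2) ^ k)"
    by (rule suminf_le[OF le sn sums_summable[OF sm]])
  finally show "norm (\<Sum>k. \<Sum>(x, y)\<leftarrow>ws k. f x y) \<le> 2 * D * C"
    using sums_unique[OF sm] by simp
qed

text \<open>
  The injectivity of the map from the projective to the injective tensor product. Applying a
  finite rank operator \<open>S\<close> of \<open>E\<close> that is close to the identity on the compact set of all first
  factors moves \<open>z\<close> only little, and turns it into a finite sum \<open>\<Sum>\<^sub>b b \<otimes> g\<^sub>b\<close> with all \<open>g\<^sub>b = 0\<close>.
\<close>

lemma approximation_property_injective:
  fixes sE :: "'k::real_or_complex \<Rightarrow> 'e::banach \<Rightarrow> 'e" and sF :: "'k \<Rightarrow> 'f::banach \<Rightarrow> 'f"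
    and sT :: "'k \<Rightarrow> 't::banach \<Rightarrow> 't" and p :: "'i \<Rightarrow> 'e \<Rightarrow> 'k" and q :: "'j \<Rightarrow> 'f \<Rightarrow> 'k"
  assumes E: "banach_space_over sE E" and F: "banach_space_over sF F" and VT: "vector_space sT"
    and AP: "approximation_property sE E"
    and bil: "bilinear_on sE E sF F sT \<tau>"
    and bound: "\<And>x y. x \<in> E \<Longrightarrow> y \<in> F \<Longrightarrow> norm (\<tau> x y) \<le> norm x * norm y"
    and p: "\<And>m. linear_on sE E (*) (p m)" "\<And>m x. x \<in> E \<Longrightarrow> norm (p m x) \<le> norm x"
      "\<And>x. x \<in> E \<Longrightarrow> (\<And>m. p m x = 0) \<Longrightarrow> x = 0"
    and q: "\<And>n. linear_on sF F (*) (q n)" "\<And>n y. y \<in> F \<Longrightarrow> norm (q n y) \<le> norm y"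
      "\<And>y. y \<in> F \<Longrightarrow> (\<And>n. q n y = 0) \<Longrightarrow> y = 0"
    and zs: "\<And>k. set (zs k) \<subseteq> E \<times> F" "\<And>k. (\<Sum>(x, y)\<leftarrow>zs k. norm x * norm y) \<le> C * (1 / 4) ^ k"
    and z: "(\<lambda>k. \<Sum>(x, y)\<leftarrow>zs k. \<tau> x y) sums z"
    and zero: "\<And>m n. (\<lambda>k. \<Sum>(x, y)\<leftarrow>zs k. p m x * q n y) sums 0"
  shows "z = 0"
proof -
  have VK: "vector_space ((*) :: 'k \<Rightarrow> 'k \<Rightarrow> 'k)" by unfold_locales (auto simp: algebra_simps)
  interpret EE: normed_space_over sE by (rule banach_space_overD(1)[OF E])
  interpret FF: normed_space_over sF by (rule banach_space_overD(1)[OF F])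
  \<comment> \<open>Balanced blocks: small first factors, summable second factors. The rewritten
    lists are the same tensors, so neither \<open>\<tau>\<close> nor any product of the p m and q n
    notices the change.\<close>
  define good where "good k ws \<longleftrightarrow> set ws \<subseteq> E \<times> F \<and> (\<forall>(x, y)\<in>set ws. norm x \<le> (1 / 2) ^ k) \<and>
    (\<Sum>(x, y)\<leftarrow>ws. norm y) \<le> C * (1 / 2) ^ k \<and> (\<Sum>(x, y)\<leftarrow>ws. \<tau> x y) = (\<Sum>(x, y)\<leftarrow>zs k. \<tau> x y) \<and>
    (\<forall>m n. (\<Sum>(x, y)\<leftarrow>ws. p m x * q n y) = (\<Sum>(x, y)\<leftarrow>zs k. p m x * q n y))" for k ws
  have "\<exists>ws. good k ws" for k
  proof -
    have half: "0 < (1 / 2 :: real) ^ k" by simp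
    obtain ws where ws: "set ws \<subseteq> E \<times> F" "\<forall>(x, y)\<in>set ws. norm x \<le> (1 / 2) ^ k"
      "(\<Sum>(x, y)\<leftarrow>ws. norm y) \<le> (\<Sum>(x, y)\<leftarrow>zs k. norm x * norm y) / (1 / 2) ^ k"
      "same_tensor sE E sF F (zs k) ws"
      by (rule normalize_representation[OF E F half zs(1)[of k]])
    have "(\<Sum>(x, y)\<leftarrow>zs k. norm x * norm y) / (1 / 2) ^ k \<le> C * (1 / 4) ^ k / (1 / 2) ^ k"
      using zs(2) by (intro divide_right_mono) auto
    also have "\<dots> = C * (1 / 2) ^ k"
      by (simp add: power_divide field_simps flip: power_mult_distrib)
    finally have "(\<Sum>(x, y)\<leftarrow>ws. norm y) \<le> C * (1 / 2) ^ k" using ws(3) by linarith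
    moreover have "bilinear_on sE E sF F (*) (\<lambda>x y. p m x * q n y)" for m n
      using p(1)[of m] q(1)[of n] by (auto simp: bilinear_on_def linear_on_def algebra_simps)
    ultimately have "good k ws"
      unfolding good_def
      using ws(1,2,4) same_tensor_imp_sum_eq[OF VT bil zs(1) ws(1,4)] by (auto simp: same_tensor_def)
    then show ?thesis ..
  qed
  then obtain ws where "\<And>k. good k (ws k)" by metis
  then have ws': "\<And>k. set (ws k) \<subseteq> E \<times> F" "\<And>k. \<forall>(x, y)\<in>set (ws k). norm x \<le> (1 / 2) ^ k"
    and small: "\<And>k. (\<Sum>(x, y)\<leftarrow>ws k. norm y) \<le> C * (1 / 2) ^ k"
    and wz: "(\<lambda>k. \<Sum>(x, y)\<leftarrow>ws k. \<tau> x y) sums z"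
    and w0: "\<And>m n. (\<lambda>k. \<Sum>(x, y)\<leftarrow>ws k. p m x * q n y) sums 0"
    using z zero by (simp_all add: good_def)
  have ws: "norm x \<le> (1 / 2) ^ k" if "(x, y) \<in> set (ws k)" for k x y
    using ws'(2)[of k] that by auto
  have wE: "x \<in> E" "y \<in> F" "norm x \<le> 1" if "(x, y) \<in> set (ws k)" for x y k
    using that ws'(1)[of k] order_trans[OF ws[OF that] power_le_one[of "1 / 2 :: real" k]] by auto
  have C: "0 \<le> C"
  proof -
    have "0 \<le> (\<Sum>(x, y)\<leftarrow>ws 0. norm y)" by (rule sum_list_nonneg) auto
    then show ?thesis using small[of 0] by simp
  qed

  \<comment> \<open>Slicing with \<open>q n\<close> yields an element of E, the sum of all q n y
    times x. All \<open>p m\<close> vanish on it by \<open>zero\<close>, and they separate the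
    points of E.\<close>
  have contraction: "(\<lambda>k. \<Sum>(x, y)\<leftarrow>ws k. sE (q n y) x) sums 0" for n
  proof -
    let ?u = "\<lambda>k. \<Sum>(x, y)\<leftarrow>ws k. sE (q n y) x"
    have "summable ?u"
    proof (rule block_summable(1)[OF _ small])
      show "norm (sE (q n y) x) \<le> 1 * norm y" if "(x, y) \<in> set (ws k)" for k x y
        using mult_mono[OF q(2)[OF wE(2)[OF that], of n] wE(3)[OF that]]
        by (simp add: EE.norm_scale)
    qed simp
    then obtain h where h: "?u sums h" by (auto simp: summable_def)
    have uE: "?u k \<in> E" for k
      by (rule sum_list_in_space[OF E]) (auto dest: wE intro: banach_space_overD(7)[OF E])
    have pu: "p m (?u k) = (\<Sum>(x, y)\<leftarrow>ws k. p m x * q n y)" for m k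
    proof -
      have "p m (?u k) = (\<Sum>i\<leftarrow>ws k. p m (case i of (x, y) \<Rightarrow> sE (q n y) x))"
        by (rule linear_on_sum_list[OF E VK p(1)]) (auto dest: wE intro: banach_space_overD(7)[OF E])
      also have "\<dots> = (\<Sum>(x, y)\<leftarrow>ws k. p m x * q n y)"
        using p(1)[of m] by (intro arg_cong[of _ _ sum_list] map_cong) (auto simp: linear_on_def dest: wE)
      finally show ?thesis .
    qed
    have hE: "h \<in> E" and ph: "(\<lambda>k. p m (?u k)) sums p m h" for m
      using linear_on_sums[OF E VK p(1)[of m], where K = 1 and u = ?u and U = h] p(2) uE h by simp_all
    have "p m h = 0" for m
      using ph[of m] w0[of m n] unfolding pu by (rule sums_unique2)
    with hE have "h = 0" by (intro p(3))
    then show ?thesis using h by simp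
  qed

  have le: "norm z \<le> 2 * C * e" if "0 < e" for e
  proof -
    \<comment> \<open>The first factors of block k are finitely many and have norm at most (1/2)^k,
      which makes the set of all of them together with 0 compact.\<close>
    have "compact (insert 0 (\<Union>k. fst ` set (ws k)))"
      by (rule compact_insert_zero_null_sets) (use ws in auto)
    moreover have "insert 0 (\<Union>k. fst ` set (ws k)) \<subseteq> E"
      using banach_space_overD(5)[OF E] by (auto dest: wE)
    ultimately obtain S where S: "finite_rank_operator_on sE E S"
      "\<And>x. x \<in> insert 0 (\<Union>k. fst ` set (ws k)) \<Longrightarrow> norm (S x - x) \<le> e"
      using AP \<open>0 < e\<close> unfolding approximation_property_def by meson
    have close: "norm (x - S x) \<le> e" if "(x, y) \<in> set (ws k)" for x y k
      using S(2)[of x] that by (force simp: norm_minus_commute)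
    obtain B c K where B: "finite B" "B \<subseteq> E" and c: "\<forall>b\<in>B. linear_on sE E (*) (c b)"
      "\<forall>b\<in>B. \<forall>x\<in>E. norm (c b x :: 'k) \<le> K * norm x" and K: "0 \<le> K"
      and Sc: "\<forall>x\<in>E. S x = (\<Sum>b\<in>B. sE (c b x) b)"
      by (rule finite_rank_coordinates[OF E S(1)])
    note c = c(1)[rule_format] c(2)[rule_format] and Sc = Sc[rule_format]
    have SE: "S x \<in> E" if "x \<in> E" for x
      using that B by (auto simp: Sc intro!: real_vector.subspace_sum[OF banach_space_overD(4)[OF E]] banach_space_overD(7)[OF E])
    \<comment> \<open>The vector \<open>g\<^sub>b\<close>, the sum of all c b x times y, is 0:
      applying \<open>q n\<close> gives c b at a slice from \<open>contraction\<close>, hence 0, and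
      the \<open>q n\<close> separate points.\<close>
    have component: "(\<lambda>k. \<Sum>(x, y)\<leftarrow>ws k. sF (c b x) y) sums 0" if b: "b \<in> B" for b
    proof -
      let ?u = "\<lambda>k. \<Sum>(x, y)\<leftarrow>ws k. sF (c b x) y"
      have "summable ?u"
      proof (rule block_summable(1)[OF _ small K])
        show "norm (sF (c b x) y) \<le> K * norm y" if "(x, y) \<in> set (ws k)" for k x y
        proof -
          have "norm (c b x) \<le> K * 1"
            using c(2)[OF b wE(1)[OF that]] mult_left_mono[OF wE(3)[OF that] K] by linarith
          then show ?thesis by (simp add: FF.norm_scale mult_right_mono)
        qed
      qed
      then obtain h where h: "?u sums h" by (auto simp: summable_def)
      have uF: "?u k \<in> F" for k
        by (rule sum_list_in_space[OF F]) (auto dest: wE intro: banach_space_overD(7)[OF F])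
      have "h \<in> F" "q n h = 0" for n
      proof -
        have qu: "q n (?u k) = c b (\<Sum>(x, y)\<leftarrow>ws k. sE (q n y) x)" for k
        proof -
          have "q n (?u k) = (\<Sum>i\<leftarrow>ws k. q n (case i of (x, y) \<Rightarrow> sF (c b x) y))"
            by (rule linear_on_sum_list[OF F VK q(1)]) (auto dest: wE intro: banach_space_overD(7)[OF F])
          also have "\<dots> = (\<Sum>i\<leftarrow>ws k. c b (case i of (x, y) \<Rightarrow> sE (q n y) x))"
          proof (intro arg_cong[of _ _ sum_list] map_cong refl)
            fix i assume "i \<in> set (ws k)"
            moreover obtain x y where i: "i = (x, y)" by force
            ultimately have "x \<in> E" "y \<in> F" using wE by auto
            then show "q n (case i of (x, y) \<Rightarrow> sF (c b x) y) = c b (case i of (x, y) \<Rightarrow> sE (q n y) x)"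
              using q(1)[of n] c(1)[OF b] by (simp add: i linear_on_def mult.commute)
          qed
          also have "\<dots> = c b (\<Sum>(x, y)\<leftarrow>ws k. sE (q n y) x)"
            by (rule linear_on_sum_list[OF E VK c(1)[OF b], symmetric]) (auto dest: wE intro: banach_space_overD(7)[OF E])
          finally show ?thesis .
        qed
        have "(\<lambda>k. c b (\<Sum>(x, y)\<leftarrow>ws k. sE (q n y) x)) sums c b 0"
        proof (rule linear_on_sums(2)[OF E VK c(1)[OF b] c(2)[OF b] _ contraction])
          show "(\<Sum>(x, y)\<leftarrow>ws k. sE (q n y) x) \<in> E" for k
            by (rule sum_list_in_space[OF E]) (auto dest: wE intro: banach_space_overD(7)[OF E])
        qed
        moreover have "c b 0 = 0" using c(2)[OF b banach_space_overD(5)[OF E]] by simp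
        ultimately have "(\<lambda>k. q n (?u k)) sums 0" by (simp only: qu)
        moreover have "(\<lambda>k. q n (?u k)) sums q n h"
          by (rule linear_on_sums(2)[OF F VK q(1), where K = 1]) (use q(2) uF h in auto)
        ultimately show "q n h = 0" by (rule sums_unique2[symmetric])
        show "h \<in> F" by (rule linear_on_sums(1)[OF F VK q(1), where K = 1]) (use q(2) uF h in auto)
      qed
      then have "h = 0" by (intro q(3))
      then show ?thesis using h by simp
    qed
    \<comment> \<open>Expanding S x in coordinates and exchanging the finite sums regroups the
      series into one series for each b, with value \<open>\<tau>\<close> at b and the vanishing
      component.\<close>
    have "(\<lambda>k. \<Sum>(x, y)\<leftarrow>ws k. \<tau> (S x) y) sums (\<Sum>b\<in>B. 0)"
    proof -
      have "(\<lambda>k. \<Sum>b\<in>B. \<tau> b (\<Sum>(x, y)\<leftarrow>ws k. sF (c b x) y)) sums (\<Sum>b\<in>B. \<tau> b 0)"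
      proof (intro sums_sum)
        fix b assume b: "b \<in> B"
        then have "b \<in> E" using B(2) by blast
        then show "(\<lambda>k. \<tau> b (\<Sum>(x, y)\<leftarrow>ws k. sF (c b x) y)) sums \<tau> b 0"
        proof (intro linear_on_sums(2)[OF F VT, where f = "\<tau> b" and K = "norm b"] component b)
          show "linear_on sF F sT (\<tau> b)" if "b \<in> E" using bil that by (simp add: bilinear_on_def)
          show "(\<Sum>(x, y)\<leftarrow>ws k. sF (c b x) y) \<in> F" for k
            by (rule sum_list_in_space[OF F]) (auto dest: wE intro: banach_space_overD(7)[OF F])
        qed (use bound in auto)
      qed
      moreover have "(\<Sum>b\<in>B. \<tau> b (\<Sum>(x, y)\<leftarrow>ws k. sF (c b x) y)) = (\<Sum>(x, y)\<leftarrow>ws k. \<tau> (S x) y)" for k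
      proof -
        have "\<tau> b (\<Sum>(x, y)\<leftarrow>ws k. sF (c b x) y) = (\<Sum>(x, y)\<leftarrow>ws k. \<tau> (sE (c b x) b) y)" if b: "b \<in> B" for b
        proof -
          have bE: "b \<in> E" using b B(2) by blast
          have "\<tau> b (\<Sum>(x, y)\<leftarrow>ws k. sF (c b x) y) = (\<Sum>i\<leftarrow>ws k. \<tau> b (case i of (x, y) \<Rightarrow> sF (c b x) y))"
            using bil bE by (intro linear_on_sum_list[OF F VT, of "\<tau> b"])
              (auto simp: bilinear_on_def dest: wE intro: banach_space_overD(7)[OF F])
          also have "\<dots> = (\<Sum>(x, y)\<leftarrow>ws k. \<tau> (sE (c b x) b) y)"
            using bil bE by (intro arg_cong[of _ _ sum_list] map_cong) (auto simp: bilinear_on_def linear_on_def dest: wE)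
          finally show ?thesis .
        qed
        then have "(\<Sum>b\<in>B. \<tau> b (\<Sum>(x, y)\<leftarrow>ws k. sF (c b x) y)) =
            (\<Sum>b\<in>B. \<Sum>i<length (ws k). \<tau> (sE (c b (fst (ws k ! i))) b) (snd (ws k ! i)))"
          by (simp add: sum_list_sum_nth case_prod_beta atLeast0LessThan)
        also have "\<dots> = (\<Sum>i<length (ws k). \<Sum>b\<in>B. \<tau> (sE (c b (fst (ws k ! i))) b) (snd (ws k ! i)))"
          by (rule sum.swap)
        also have "\<dots> = (\<Sum>i<length (ws k). \<tau> (S (fst (ws k ! i))) (snd (ws k ! i)))"
        proof (intro sum.cong refl)
          fix i assume "i \<in> {..<length (ws k)}"
          then have "(fst (ws k ! i), snd (ws k ! i)) \<in> set (ws k)" by simp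
          note xy = wE[OF this]
          define y where "y = snd (ws k ! i)"
          have y: "y \<in> F" using xy by (simp add: y_def)
          have "\<tau> (\<Sum>b\<in>B'. v b) y = (\<Sum>b\<in>B'. \<tau> (v b) y)" if "B' \<subseteq> B" "\<And>b. b \<in> B \<Longrightarrow> v b \<in> E" for v B'
          proof -
            have add: "\<tau> (x + x') y = \<tau> x y + \<tau> x' y" if "x \<in> E" "x' \<in> E" for x x'
              using bil y that by (auto simp: bilinear_on_def linear_on_def)
            have \<tau>0: "\<tau> 0 y = 0"
              using bound[OF banach_space_overD(5)[OF E] y] by simp
            have "finite B'" using \<open>B' \<subseteq> B\<close> B(1) by (rule finite_subset)
            then show ?thesis
              using \<open>B' \<subseteq> B\<close>
            proof (induction B')
              case (insert b B')
              have "(\<Sum>b\<in>B'. v b) \<in> E"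
                using insert.prems that(2) by (intro real_vector.subspace_sum[OF banach_space_overD(4)[OF E]]) auto
              then show ?case using insert that(2) by (simp add: add)
            qed (simp add: \<tau>0)
          qed
          from this[of B "\<lambda>b. sE (c b (fst (ws k ! i))) b"]
          show "(\<Sum>b\<in>B. \<tau> (sE (c b (fst (ws k ! i))) b) (snd (ws k ! i))) = \<tau> (S (fst (ws k ! i))) (snd (ws k ! i))"
            using B(2) by (auto simp: Sc[OF xy(1)] y_def banach_space_overD(7)[OF E] subset_iff)
        qed
        also have "\<dots> = (\<Sum>(x, y)\<leftarrow>ws k. \<tau> (S x) y)"
          by (simp add: sum_list_sum_nth case_prod_beta atLeast0LessThan)
        finally show ?thesis .
      qed
      moreover have "\<tau> b 0 = 0" if "b \<in> B" for b
        using bound[of b 0] B(2) banach_space_overD(5)[OF F] that by auto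
      ultimately show ?thesis by simp
    qed
    then have "(\<lambda>k. \<Sum>(x, y)\<leftarrow>ws k. \<tau> (S x) y) sums 0" by simp
    from sums_diff[OF wz this] have "(\<lambda>k. (\<Sum>(x, y)\<leftarrow>ws k. \<tau> x y) - (\<Sum>(x, y)\<leftarrow>ws k. \<tau> (S x) y)) sums z" by simp
    moreover have "(\<Sum>(x, y)\<leftarrow>ws k. \<tau> x y) - (\<Sum>(x, y)\<leftarrow>ws k. \<tau> (S x) y) = (\<Sum>(x, y)\<leftarrow>ws k. \<tau> (x - S x) y)" for k
    proof -
      have sub: "\<tau> x y - \<tau> (S x) y = \<tau> (x - S x) y" if "(x, y) \<in> set (ws k)" for x y
        using linear_on_diff[OF E VT _ wE(1)[OF that] SE[OF wE(1)[OF that]], of "\<lambda>x. \<tau> x y"] bil wE(2)[OF that]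
        by (simp add: bilinear_on_def)
      show ?thesis
        unfolding case_prod_unfold sum_list_subtractf[symmetric]
        using sub by (intro arg_cong[of _ _ sum_list] map_cong) auto
    qed
    ultimately have "z = (\<Sum>k. \<Sum>(x, y)\<leftarrow>ws k. \<tau> (x - S x) y)"
      by (simp add: sums_iff)
    also have "norm \<dots> \<le> 2 * e * C"
    proof (rule block_summable(2)[OF _ small])
      show "norm (\<tau> (x - S x) y) \<le> e * norm y" if "(x, y) \<in> set (ws k)" for k x y
      proof -
        have "norm (\<tau> (x - S x) y) \<le> norm (x - S x) * norm y"
          using wE(1,2)[OF that] by (intro bound banach_space_overD(8)[OF E] SE)
        also have "\<dots> \<le> e * norm y" by (intro mult_right_mono close[OF that] norm_ge_zero)
        finally show ?thesis .
      qed
    qed (use \<open>0 < e\<close> in simp)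
    finally show ?thesis by (simp add: mult.commute mult.left_commute)
  qed
  have "norm z \<le> 0 + d" if "0 < d" for d
  proof -
    have "norm z \<le> 2 * C * (d / (2 * C + 1))"
      using that C by (intro le) simp
    also have "\<dots> \<le> d" using that C by (simp add: field_simps)
    finally show ?thesis by simp
  qed
  then have "norm z \<le> 0" by (rule field_le_epsilon)
  then show "z = 0" by simp
qed

section \<open>The limit measure\<close>

lemma (in projective_tensor) continuous_on_\<tau>: "continuous_on (E \<times> F) (\<lambda>(x, y). \<tau> x y)"
  unfolding continuous_on_def
proof
  fix q assume "q \<in> E \<times> F"
  then obtain a b where q: "q = (a, b)" "a \<in> E" "b \<in> F" by auto
  note VT = banach_space_overD(2)[OF T]
  have le: "norm (\<tau> x y - \<tau> a b) \<le> norm (x - a) * norm y + norm a * norm (y - b)"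
    if "x \<in> E" "y \<in> F" for x y
  proof -
    have l: "\<tau> (x - a) y = \<tau> x y - \<tau> a y" "\<tau> a (y - b) = \<tau> a y - \<tau> a b"
      using linear_on_diff[OF E VT, of "\<lambda>x. \<tau> x y" x a] linear_on_diff[OF F VT, of "\<tau> a" y b] bilinear that q
      by (auto simp: bilinear_on_def)
    have "\<tau> x y - \<tau> a b = \<tau> (x - a) y + \<tau> a (y - b)"
      unfolding l by simp
    moreover have "norm (\<tau> (x - a) y) \<le> norm (x - a) * norm y" "norm (\<tau> a (y - b)) \<le> norm a * norm (y - b)"
      using that q banach_space_overD(8)[OF E] banach_space_overD(8)[OF F] by (auto intro!: norm_\<tau>_le)
    ultimately show ?thesis by (simp add: norm_triangle_mono)
  qed
  show "((\<lambda>(x, y). \<tau> x y) \<longlongrightarrow> (case q of (x, y) \<Rightarrow> \<tau> x y)) (at q within E \<times> F)"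
  proof (rule Lim_null_comparison[THEN LIM_zero_cancel])
    show "\<forall>\<^sub>F p in at q within E \<times> F. norm ((case p of (x, y) \<Rightarrow> \<tau> x y) - (case q of (x, y) \<Rightarrow> \<tau> x y)) \<le>
        norm (fst p - a) * norm (snd p) + norm a * norm (snd p - b)"
      unfolding eventually_at_filter by (rule always_eventually) (auto simp: q(1) intro!: le)
    have "((\<lambda>p. norm (fst p - a) * norm (snd p) + norm a * norm (snd p - b)) \<longlongrightarrow>
        norm (fst q - a) * norm (snd q) + norm a * norm (snd q - b)) (at q within E \<times> F)"
      by (intro tendsto_intros)
    then show "((\<lambda>p. norm (fst p - a) * norm (snd p) + norm a * norm (snd p - b)) \<longlongrightarrow> 0) (at q within E \<times> F)"
      by (simp add: q(1))
  qed
qed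

text \<open>The norm is a countable supremum of evaluations, so its sublevel sets are already
  measurable with respect to the evaluations. Together with separability this makes weak* and norm
  Borel sets of the dual agree.\<close>

lemma borel_measurable_norm_dual:
  fixes s :: "'k::real_or_complex \<Rightarrow> 'v::real_normed_vector \<Rightarrow> 'v"
  assumes x: "\<And>n::nat. norm (x n) \<le> 1"
    and norming: "\<And>f r. f \<in> dual_space s \<Longrightarrow> (\<And>n. norm (blinfun_apply f (x n)) \<le> r) \<Longrightarrow> norm f \<le> r"
    and G: "\<And>t. t \<in> space M \<Longrightarrow> G t \<in> dual_space s"
    and meas: "\<And>n. (\<lambda>t. norm (blinfun_apply (G t) (x n))) \<in> borel_measurable M"
  shows "(\<lambda>t. norm (G t)) \<in> borel_measurable M"
  unfolding borel_measurable_iff_le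
proof
  fix a
  have "norm (blinfun_apply f (x n)) \<le> norm f" for f :: "'v \<Rightarrow>\<^sub>L 'k" and n
    using norm_blinfun[of f "x n"] mult_left_mono[OF x[of n] norm_ge_zero[of f]] by simp
  then have "norm (G t) \<le> a \<longleftrightarrow> (\<forall>n. norm (blinfun_apply (G t) (x n)) \<le> a)" if "t \<in> space M" for t
    using norming[OF G[OF that], of a] order_trans by blast
  then have "{t \<in> space M. norm (G t) \<le> a} = {t \<in> space M. \<forall>n. norm (blinfun_apply (G t) (x n)) \<le> a}"
    by blast
  also have "\<dots> \<in> sets M" using meas by measurable
  finally show "{t \<in> space M. norm (G t) \<le> a} \<in> sets M" .
qed

text \<open>Covers f = 0 as well, since \<open>sgn 0 = 0\<close>. It moves an atom into the ball and
  leaves its norm as a weight.\<close>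

lemma dual_space_sgn:
  assumes "f \<in> dual_space s"
  shows "sgn f \<in> cball 0 1 \<inter> dual_space s" "f = norm f *\<^sub>R sgn f"
proof -
  have "norm (sgn f) \<le> 1" by (simp add: norm_sgn)
  moreover have "sgn f \<in> dual_space s"
    using assms by (simp add: dual_space_def sgn_div_norm blinfun.scaleR_left)
  ultimately show "sgn f \<in> cball 0 1 \<inter> dual_space s" by simp
  show "f = norm f *\<^sub>R sgn f" by (cases "f = 0") (simp_all add: sgn_div_norm)
qed

text \<open>
  The measure representing the limit of finite tensors: their atoms are coded by parameters of a
  curve through the cube of all values on the norming sequences, and the weak limit of the coded
  measures is carried by the codes of points of the product of the balls.
\<close>

lemma limit_measure:
  fixes sX :: "'k::real_or_complex \<Rightarrow> 'x::banach \<Rightarrow> 'x" and sY :: "'k \<Rightarrow> 'y::banach \<Rightarrow> 'y"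
    and zs :: "nat \<Rightarrow> (('x \<Rightarrow>\<^sub>L 'k) \<times> ('y \<Rightarrow>\<^sub>L 'k)) list"
  defines "S \<equiv> (cball 0 1 \<inter> dual_space sX) \<times> (cball 0 1 \<inter> dual_space sY)"
  assumes nx: "norming_sequences sX x d" and ny: "norming_sequences sY y d'"
    and zs: "\<And>n. set (zs n) \<subseteq> dual_space sX \<times> dual_space sY"
    and pos: "\<And>n. 0 < (\<Sum>(f, g)\<leftarrow>zs n. norm f * norm g)"
    and mass: "(\<lambda>n. \<Sum>(f, g)\<leftarrow>zs n. norm f * norm g) \<longlonglongrightarrow> N" "0 < N"
    and conv: "\<And>k m. (\<lambda>n. \<Sum>(f, g)\<leftarrow>zs n. blinfun_apply f (x k) * blinfun_apply g (y m)) \<longlonglongrightarrow> \<Lambda> k m"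
  obtains \<nu> where "sets \<nu> = sets (restrict_space borel S)" "finite_measure \<nu>" "measure \<nu> (space \<nu>) = N"
    "\<forall>k m (\<rho> :: 'k \<Rightarrow> real). bounded_linear \<rho> \<longrightarrow>
      (\<integral>q. \<rho> (blinfun_apply (fst q) (x k) * blinfun_apply (snd q) (y m)) \<partial>\<nu>) = \<rho> (\<Lambda> k m)"
proof -
  note x = norming_sequencesD[OF nx] and y = norming_sequencesD[OF ny]
  obtain c :: "nat \<Rightarrow> real \<Rightarrow> 'k" where c: "\<And>n. continuous_on UNIV (c n)" "\<And>n t. norm (c n t) \<le> 2"
    "\<And>a. (\<And>n. norm (a n) \<le> 1) \<Longrightarrow> \<exists>t\<in>{0..1}. \<forall>n. c n t = a n"
    by (rule scalar_cube_curve) blast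
  \<comment> \<open>Even coordinates of the curve encode the values of the first functional, odd
    ones those of the second; \<open>C\<close> consists of the parameters that really come from a
    pair in the product of the balls.\<close>
  define C where "C = {t. \<exists>f\<in>cball 0 1 \<inter> dual_space sX. \<forall>n. blinfun_apply f (x n) = c (2 * n) t} \<inter>
    {t. \<exists>g\<in>cball 0 1 \<inter> dual_space sY. \<forall>n. blinfun_apply g (y n) = c (2 * n + 1) t}"
  have "closed C"
    unfolding C_def by (intro closed_Int closed_dual_ball_coordinates c)
  define coded where "coded f g t \<longleftrightarrow> t \<in> {0..1} \<and> t \<in> C \<and>
      (\<forall>n. blinfun_apply f (x n) = norm f *\<^sub>R c (2 * n) t) \<and>
      (\<forall>n. blinfun_apply g (y n) = norm g *\<^sub>R c (2 * n + 1) t)" for f g t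
  have "\<exists>t. coded f g t" if f: "f \<in> dual_space sX" and g: "g \<in> dual_space sY" for f g
  proof -
    define a where "a n = (if even n then blinfun_apply (sgn f) (x (n div 2)) else blinfun_apply (sgn g) (y (n div 2)))" for n
    have le: "norm (blinfun_apply h v) \<le> 1" if "norm h \<le> 1" "norm v \<le> 1" for h :: "'w::real_normed_vector \<Rightarrow>\<^sub>L 'k" and v
      using norm_blinfun[of h v] mult_mono[OF that] by simp
    have "norm (a n) \<le> 1" for n
      using dual_space_sgn(1)[OF f] dual_space_sgn(1)[OF g] x(1) y(1) by (auto simp: a_def intro!: le)
    then obtain t where t: "t \<in> {0..1}" "\<And>n. c n t = a n" using c(3) by metis
    have cf: "blinfun_apply (sgn f) (x n) = c (2 * n) t" for n by (simp add: t a_def)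
    have cg: "blinfun_apply (sgn g) (y n) = c (2 * n + 1) t" for n by (simp add: t a_def)
    have "t \<in> C"
      unfolding C_def using dual_space_sgn(1)[OF f] dual_space_sgn(1)[OF g] cf cg by blast
    moreover have "blinfun_apply f (x n) = norm f *\<^sub>R c (2 * n) t" for n
      using dual_space_sgn(2)[OF f] cf[of n] by (metis blinfun.scaleR_left)
    moreover have "blinfun_apply g (y n) = norm g *\<^sub>R c (2 * n + 1) t" for n
      using dual_space_sgn(2)[OF g] cg[of n] by (metis blinfun.scaleR_left)
    ultimately show ?thesis using t(1) unfolding coded_def by blast
  qed
  then obtain code where coded: "\<And>f g. f \<in> dual_space sX \<Longrightarrow> g \<in> dual_space sY \<Longrightarrow> coded f g (code f g)"
    by metis
  have code: "\<And>f g. f \<in> dual_space sX \<Longrightarrow> g \<in> dual_space sY \<Longrightarrow> code f g \<in> {0..1}"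
    "\<And>f g. f \<in> dual_space sX \<Longrightarrow> g \<in> dual_space sY \<Longrightarrow> code f g \<in> C"
    "\<And>f g n. f \<in> dual_space sX \<Longrightarrow> g \<in> dual_space sY \<Longrightarrow> blinfun_apply f (x n) = norm f *\<^sub>R c (2 * n) (code f g)"
    "\<And>f g n. f \<in> dual_space sX \<Longrightarrow> g \<in> dual_space sY \<Longrightarrow> blinfun_apply g (y n) = norm g *\<^sub>R c (2 * n + 1) (code f g)"
    using coded unfolding coded_def by blast+

  \<comment> \<open>Dividing by the total cost \<open>m n\<close> gives probability weights; the
    mass is restored at the end by the constant density N.\<close>
  define m where "m n = (\<Sum>(f, g)\<leftarrow>zs n. norm f * norm g)" for n
  define W where "W n = map (\<lambda>(f, g). (norm f * norm g / m n, code f g)) (zs n)" for n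
  have mpos: "0 < m n" for n using pos by (simp add: m_def)
  have "0 \<le> w" if "(w, t) \<in> set (W n)" for n w t
    using that less_imp_le[OF mpos[of n]] by (auto simp: W_def)
  moreover have "(\<Sum>(w, t)\<leftarrow>W n. w) = 1" for n
  proof -
    have "(\<Sum>(w, t)\<leftarrow>W n. w) = m n / m n"
      unfolding W_def m_def[of n, symmetric] using m_def[of n]
      by (simp add: o_def case_prod_unfold divide_inverse sum_list_mult_const)
    then show ?thesis using mpos[of n] by simp
  qed
  moreover have "t \<in> C \<and> t \<in> {0..1}" if "(w, t) \<in> set (W n)" for n w t
  proof -
    from that obtain f g where "(f, g) \<in> set (zs n)" "t = code f g" by (auto simp: W_def)
    then show ?thesis using zs[of n] code(1,2)[of f g] by auto
  qed
  ultimately obtain r M where r: "strict_mono (r :: nat \<Rightarrow> nat)" and M: "real_distribution M"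
    and AE_C: "AE t in M. t \<in> C"
    and lim: "\<forall>\<phi> B. continuous_on UNIV \<phi> \<longrightarrow> (\<forall>t. \<bar>\<phi> t\<bar> \<le> B) \<longrightarrow>
       (\<lambda>n. \<Sum>(w, t)\<leftarrow>W (r n). w * \<phi> t) \<longlonglongrightarrow> (\<integral>t. \<phi> t \<partial>M)"
    using \<open>closed C\<close> by (rule discrete_measures_weak_limit[of W C])
  interpret M: real_distribution M by (rule M)

  \<comment> \<open>Against a test function in the coordinates, the coded measures integrate to
    \<open>\<rho>\<close> of the finite sums divided by their cost, so the weak limit has integral
    \<open>\<rho> (\<Lambda> k j) / N\<close>.\<close>
  have int: "N * (\<integral>t. \<rho> (c (2 * k) t * c (2 * j + 1) t) \<partial>M) = \<rho> (\<Lambda> k j)" if \<rho>: "bounded_linear \<rho>" for \<rho> :: "'k \<Rightarrow> real" and k j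
  proof -
    interpret \<rho>: bounded_linear \<rho> by (rule \<rho>)
    let ?\<phi> = "\<lambda>t. \<rho> (c (2 * k) t * c (2 * j + 1) t)"
    obtain K where K: "0 \<le> K" "\<And>z. norm (\<rho> z) \<le> norm z * K" using \<rho>.nonneg_bounded by blast
    have "\<bar>?\<phi> t\<bar> \<le> 4 * K" for t
    proof -
      have "norm (c (2 * k) t * c (2 * j + 1) t) \<le> 2 * 2"
        unfolding norm_mult by (intro mult_mono c) auto
      then have "norm (c (2 * k) t * c (2 * j + 1) t) * K \<le> 4 * K"
        using K(1) by (intro mult_right_mono) auto
      then show ?thesis using K(2)[of "c (2 * k) t * c (2 * j + 1) t"] by simp
    qed
    then have 1: "(\<lambda>n. \<Sum>(w, t)\<leftarrow>W (r n). w * ?\<phi> t) \<longlonglongrightarrow> (\<integral>t. ?\<phi> t \<partial>M)"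
      by (intro lim[rule_format] \<rho>.continuous_on continuous_intros c)
    let ?P = "\<lambda>n. \<Sum>(f, g)\<leftarrow>zs n. blinfun_apply f (x k) * blinfun_apply g (y j)"
    have sum: "(\<Sum>(w, t)\<leftarrow>W n. w * ?\<phi> t) = \<rho> (?P n) / m n" for n
    proof -
      have pt: "norm f * norm g / m n * ?\<phi> (code f g) = \<rho> (blinfun_apply f (x k) * blinfun_apply g (y j)) / m n"
        if "(f, g) \<in> set (zs n)" for f g
      proof -
        have "f \<in> dual_space sX" "g \<in> dual_space sY" using zs[of n] that by auto
        then have "blinfun_apply f (x k) * blinfun_apply g (y j) =
            (norm f * norm g) *\<^sub>R (c (2 * k) (code f g) * c (2 * j + 1) (code f g))"
          using code(3,4)[of f g] by simp
        then show ?thesis by (simp add: \<rho>.scaleR)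
      qed
      have "(\<Sum>(w, t)\<leftarrow>W n. w * ?\<phi> t) = (\<Sum>(f, g)\<leftarrow>zs n. norm f * norm g / m n * ?\<phi> (code f g))"
        by (simp add: W_def o_def case_prod_unfold)
      also have "\<dots> = (\<Sum>(f, g)\<leftarrow>zs n. \<rho> (blinfun_apply f (x k) * blinfun_apply g (y j)) / m n)"
        using pt by (intro arg_cong[of _ _ sum_list] map_cong) auto
      also have "\<dots> = \<rho> (?P n) / m n"
      proof -
        have "\<rho> (\<Sum>(f, g)\<leftarrow>zs'. blinfun_apply f (x k) * blinfun_apply g (y j)) =
          (\<Sum>(f, g)\<leftarrow>zs'. \<rho> (blinfun_apply f (x k) * blinfun_apply g (y j)))" for zs'
          by (induction zs') (auto simp: \<rho>.add)
        then show ?thesis by (simp add: case_prod_unfold divide_inverse sum_list_mult_const)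
      qed
      finally show ?thesis .
    qed
    have "(\<lambda>n. \<rho> (?P n) / m n) \<longlonglongrightarrow> \<rho> (\<Lambda> k j) / N"
      using mass(2) by (intro tendsto_divide \<rho>.tendsto conv) (auto simp: m_def mass(1))
    from LIMSEQ_subseq_LIMSEQ[OF this r]
    have "(\<lambda>n. \<Sum>(w, t)\<leftarrow>W (r n). w * ?\<phi> t) \<longlonglongrightarrow> \<rho> (\<Lambda> k j) / N"
      by (simp only: o_def sum)
    with 1 have "(\<integral>t. ?\<phi> t \<partial>M) = \<rho> (\<Lambda> k j) / N" by (rule LIMSEQ_unique)
    then show ?thesis using mass(2) by simp
  qed

  \<comment> \<open>Decoding: a parameter of \<open>C\<close> gives a point with the prescribed
    values, all others the origin, which is harmless as the limit is carried by
    \<open>C\<close>.\<close>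
  define point where "point t q \<longleftrightarrow> q \<in> S \<and> (\<forall>n. blinfun_apply (fst q) (x n) = (if t \<in> C then c (2 * n) t else 0)) \<and>
      (\<forall>n. blinfun_apply (snd q) (y n) = (if t \<in> C then c (2 * n + 1) t else 0))" for t q
  have "\<exists>q. point t q" for t
  proof (cases "t \<in> C")
    case True
    then obtain f g where "f \<in> cball 0 1 \<inter> dual_space sX" "\<forall>n. blinfun_apply f (x n) = c (2 * n) t"
      "g \<in> cball 0 1 \<inter> dual_space sY" "\<forall>n. blinfun_apply g (y n) = c (2 * n + 1) t"
      unfolding C_def by blast
    then show ?thesis using True by (intro exI[of _ "(f, g)"]) (simp add: S_def point_def)
  next
    case False
    then show ?thesis by (intro exI[of _ "(0, 0)"]) (simp add: S_def dual_space_def point_def)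
  qed
  then obtain pt where point: "\<And>t. point t (pt t)" by metis
  have pt: "\<And>t. pt t \<in> S"
    "\<And>t n. blinfun_apply (fst (pt t)) (x n) = (if t \<in> C then c (2 * n) t else 0)"
    "\<And>t n. blinfun_apply (snd (pt t)) (y n) = (if t \<in> C then c (2 * n + 1) t else 0)"
    using point by (simp_all add: point_def)
  have [measurable]: "C \<in> sets borel" using \<open>closed C\<close> by (rule borel_closed)
  have cm: "(\<lambda>t. norm ((if t \<in> C then c n t else 0) - a)) \<in> borel_measurable M" for n a
  proof -
    have [measurable]: "(\<lambda>t. norm (c n t - a)) \<in> borel_measurable borel"
      by (intro borel_measurable_continuous_onI continuous_intros c)
    have "(\<lambda>t. if t \<in> C then norm (c n t - a) else norm (0 - a)) \<in> borel_measurable M" by measurable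
    then show ?thesis by (rule measurable_cong[THEN iffD1, rotated]) auto
  qed
  have ptS: "fst (pt t) \<in> dual_space sX" "snd (pt t) \<in> dual_space sY" for t
    using pt(1)[of t] by (auto simp: S_def)
  have diffE: "f - f' \<in> dual_space s" if "f \<in> dual_space s" "f' \<in> dual_space s"
    for f f' :: "'v::banach \<Rightarrow>\<^sub>L 'k" and s
    using banach_space_overD(8)[OF banach_space_over_dual_space that] .
  have mX: "(\<lambda>t. norm (fst (pt t) - d i)) \<in> borel_measurable M" for i
    using x(2) by (intro borel_measurable_norm_dual[OF x(1,4)] diffE ptS)
      (auto simp: blinfun.diff_left pt(2) ptS intro: cm)
  have mY: "(\<lambda>t. norm (snd (pt t) - d' i)) \<in> borel_measurable M" for i
    using y(2) by (intro borel_measurable_norm_dual[OF y(1,4)] diffE ptS)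
      (auto simp: blinfun.diff_left pt(3) ptS intro: cm)
  \<comment> \<open>Measurability starts from the values on the norming sequences alone; distances
    to the countably many centres are recovered from them, and separability does the rest.\<close>
  have "pt \<in> borel_measurable M"
  proof (rule borel_measurable_separable_range)
    let ?d = "\<lambda>i. (d (fst (prod_decode i)), d' (snd (prod_decode i)))"
    have dist: "dist (pt t) (?d i) = sqrt ((norm (fst (pt t) - d (fst (prod_decode i))))\<^sup>2 +
        (norm (snd (pt t) - d' (snd (prod_decode i))))\<^sup>2)" for t i
      by (simp add: dist_prod_def dist_norm)
    show "(\<lambda>t. dist (pt t) (?d i)) \<in> borel_measurable M" for i
      unfolding dist using mX mY by measurable
    show "\<exists>i. dist (pt t) (?d i) < e" if "0 < e" for t e
    proof -
      obtain i where i: "norm (fst (pt t) - d i) < e / 2" using x(3)[OF ptS(1)[of t] half_gt_zero[OF \<open>0 < e\<close>]] by blast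
      obtain j where j: "norm (snd (pt t) - d' j) < e / 2" using y(3)[OF ptS(2)[of t] half_gt_zero[OF \<open>0 < e\<close>]] by blast
      have "dist (pt t) (?d (prod_encode (i, j))) \<le> norm (fst (pt t) - d i) + norm (snd (pt t) - d' j)"
        unfolding dist using sqrt_sum_squares_le_sum[of "norm (fst (pt t) - d i)" "norm (snd (pt t) - d' j)"] by simp
      then show ?thesis using i j by (intro exI[of _ "prod_encode (i, j)"]) linarith
    qed
  qed
  then have ptm: "pt \<in> measurable M (restrict_space borel S)"
    using pt(1) by (intro measurable_restrict_space2) auto
  let ?D = "density M (\<lambda>_. ennreal N)"
  define \<nu> where "\<nu> = distr ?D (restrict_space borel S) pt"
  have ptm': "pt \<in> measurable ?D (restrict_space borel S)" using ptm by simp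
  have em: "emeasure \<nu> (space \<nu>) = ennreal N"
    using measurable_space[OF ptm] emeasure_density_const[of "space M" M "ennreal N"]
    by (simp add: \<nu>_def emeasure_distr[OF ptm'] M.emeasure_space_1[simplified] vimage_def Int_def cong: conj_cong)
  show thesis
  proof (rule that[of \<nu>])
    show "sets \<nu> = sets (restrict_space borel S)" by (simp add: \<nu>_def)
    show "finite_measure \<nu>" using em by (intro finite_measureI) simp
    show "measure \<nu> (space \<nu>) = N" using em mass(2) by (simp add: measure_def)
    show "\<forall>k j (\<rho> :: 'k \<Rightarrow> real). bounded_linear \<rho> \<longrightarrow>
      (\<integral>q. \<rho> (blinfun_apply (fst q) (x k) * blinfun_apply (snd q) (y j)) \<partial>\<nu>) = \<rho> (\<Lambda> k j)"
    proof (intro allI impI)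
      fix k j and \<rho> :: "'k \<Rightarrow> real" assume \<rho>: "bounded_linear \<rho>"
      let ?h = "\<lambda>q. \<rho> (blinfun_apply (fst q) (x k) * blinfun_apply (snd q) (y j))"
      have hm: "?h \<in> borel_measurable (restrict_space borel S)"
        by (intro borel_measurable_continuous_on_restrict bounded_linear.continuous_on[OF \<rho>] continuous_intros)
      have "(\<integral>q. ?h q \<partial>\<nu>) = (\<integral>t. ?h (pt t) \<partial>?D)"
        unfolding \<nu>_def by (rule integral_distr[OF ptm' hm])
      also have "\<dots> = (\<integral>t. N *\<^sub>R ?h (pt t) \<partial>M)"
        using mass(2) measurable_compose[OF ptm hm] by (intro integral_density) auto
      also have "\<dots> = N * (\<integral>t. ?h (pt t) \<partial>M)" by simp
      also have "(\<integral>t. ?h (pt t) \<partial>M) = (\<integral>t. \<rho> (c (2 * k) t * c (2 * j + 1) t) \<partial>M)"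
      proof (rule integral_cong_AE)
        show "(\<lambda>t. ?h (pt t)) \<in> borel_measurable M" by (rule measurable_compose[OF ptm hm])
        have "(\<lambda>t. \<rho> (c (2 * k) t * c (2 * j + 1) t)) \<in> borel_measurable borel"
          by (intro borel_measurable_continuous_onI bounded_linear.continuous_on[OF \<rho>] continuous_intros c)
        then show "(\<lambda>t. \<rho> (c (2 * k) t * c (2 * j + 1) t)) \<in> borel_measurable M" by simp
        show "AE t in M. ?h (pt t) = \<rho> (c (2 * k) t * c (2 * j + 1) t)"
          using AE_C by eventually_elim (simp add: pt)
      qed
      finally show "(\<integral>q. ?h q \<partial>\<nu>) = \<rho> (\<Lambda> k j)" using int[OF \<rho>] by simp
    qed
  qed
qed

section \<open>Evaluation functionals and the equality of tensor and integral\<close>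

lemma evaluation_on_dual_space:
  fixes s :: "'k::real_or_complex \<Rightarrow> 'v::real_normed_vector \<Rightarrow> 'v"
  shows "linear_on dual_scale (dual_space s) (*) (\<lambda>f. blinfun_apply f v)"
    and "norm v \<le> 1 \<Longrightarrow> norm (blinfun_apply f v :: 'k) \<le> norm f"
  using norm_blinfun[of f v] mult_left_mono[of "norm v" 1 "norm f"]
  by (auto simp: linear_on_def blinfun.add_left)

theorem corollary4p7:
  fixes sX :: "'k::real_or_complex \<Rightarrow> 'x::banach \<Rightarrow> 'x"
    and sY :: "'k \<Rightarrow> 'y::banach \<Rightarrow> 'y"
    and sT :: "'k \<Rightarrow> 't::banach \<Rightarrow> 't"
    and T :: "'t set"
    and \<tau> :: "('x \<Rightarrow>\<^sub>L 'k) \<Rightarrow> ('y \<Rightarrow>\<^sub>L 'k) \<Rightarrow> 't"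
  assumes "normed_space_over sX" and "normed_space_over sY"
    and "separable_space (top_of_set (dual_space sX))"
    and "separable_space (top_of_set (dual_space sY))"
    and "approximation_property dual_scale (dual_space sX) \<or>
         approximation_property dual_scale (dual_space sY)"
    and "projective_tensor_product dual_scale (dual_space sX) dual_scale (dual_space sY) sT T \<tau>"
  shows "T = INA (dual_space sX) (dual_space sY) T \<tau>"
proof
  let ?E = "dual_space sX" and ?F = "dual_space sY"
  let ?S = "(cball 0 1 \<inter> ?E) \<times> (cball 0 1 \<inter> ?F)"
  interpret P: projective_tensor dual_scale ?E dual_scale ?F sT T \<tau>
    using assms(6) by unfold_locales (auto intro: banach_space_over_dual_space)
  show "INA ?E ?F T \<tau> \<subseteq> T" by (auto simp: INA_def)

  obtain x d where nx: "norming_sequences sX x d"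
    using assms(3) by (rule norming_sequences_exist)
  obtain y d' where ny: "norming_sequences sY y d'"
    using assms(4) by (rule norming_sequences_exist)
  note x = norming_sequencesD[OF nx] and y = norming_sequencesD[OF ny]
  note ev = evaluation_on_dual_space

  \<comment> \<open>\<open>L k m\<close> is the functional that x k and y m induce on the tensor
    product; the bound is 1 because both vectors lie in the unit balls.\<close>
  define extends where "extends k m L \<longleftrightarrow> linear_on sT T (*) L \<and> (\<forall>z\<in>T. norm (L z) \<le> 1 * norm z) \<and>
    (\<forall>zs. set zs \<subseteq> ?E \<times> ?F \<longrightarrow> L (P.tsum zs) = (\<Sum>(f, g)\<leftarrow>zs. blinfun_apply f (x k) * blinfun_apply g (y m)))" for k m L
  have "\<exists>L. extends k m L" for k m
  proof -
    let ?A = "\<lambda>f g. blinfun_apply f (x k) * blinfun_apply g (y m)"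
    have A: "bilinear_on dual_scale ?E dual_scale ?F (*) ?A"
      by (auto simp: bilinear_on_def linear_on_def blinfun.add_left algebra_simps)
    have le: "norm (?A f g) \<le> 1 * (norm f * norm g)" for f :: "'x \<Rightarrow>\<^sub>L 'k" and g :: "'y \<Rightarrow>\<^sub>L 'k"
      using mult_mono[OF ev(2)[OF x(1), of f k] ev(2)[OF y(1), of g m]] by (simp add: norm_mult)
    show ?thesis
      by (rule P.bilinear_form_extends[OF A le]) (auto simp: extends_def)
  qed
  then obtain L where "\<And>k m. extends k m (L k m)" by metis
  then have L: "\<And>k m. linear_on sT T (*) (L k m)" "\<And>k m z. z \<in> T \<Longrightarrow> norm (L k m z) \<le> 1 * norm z"
    "\<And>k m zs. set zs \<subseteq> ?E \<times> ?F \<Longrightarrow>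
      L k m (P.tsum zs) = (\<Sum>(f, g)\<leftarrow>zs. blinfun_apply f (x k) * blinfun_apply g (y m))"
    unfolding extends_def by blast+
  note LD = linear_on_diff[OF P.T P.vector_space_scalars L(1)]

  \<comment> \<open>These functionals see z only through its image in the injective tensor product;
    the approximation property of one factor makes this enough.\<close>
  have separating: "z = 0" if "z \<in> T" and L0: "\<And>k m. L k m z = 0" for z
  proof -
    obtain zs C where zs: "\<And>k. set (zs k) \<subseteq> ?E \<times> ?F" "\<And>k. P.cost (zs k) \<le> C * (1 / 4) ^ k"
      "(\<lambda>k. P.tsum (zs k)) sums z"
      by (rule P.series_representation[OF \<open>z \<in> T\<close>]) blast
    have zero: "(\<lambda>k. \<Sum>(f, g)\<leftarrow>zs k. blinfun_apply f (x m) * blinfun_apply g (y n)) sums 0" for m n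
      using linear_on_sums(2)[OF P.T P.vector_space_scalars L(1)[of m n] L(2) P.tsum_in_T[OF zs(1)] zs(3)]
      by (simp only: L(3)[OF zs(1)] L0)
    have sepX: "f = 0" if "f \<in> ?E" "\<And>n. blinfun_apply f (x n) = 0" for f
      using x(4)[OF that(1), of 0] that(2) by simp
    have sepY: "g = 0" if "g \<in> ?F" "\<And>n. blinfun_apply g (y n) = 0" for g
      using y(4)[OF that(1), of 0] that(2) by simp
    note VT = banach_space_overD(2)[OF P.T]
    from assms(5) show ?thesis
    proof
      assume "approximation_property dual_scale ?E"
      then show ?thesis
        by (rule approximation_property_injective[OF P.E P.F VT _ P.bilinear P.norm_\<tau>_le
            ev(1) ev(2)[OF x(1)] sepX ev(1) ev(2)[OF y(1)] sepY zs zero])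
    next
      assume AP: "approximation_property dual_scale ?F"
      \<comment> \<open>The injectivity lemma asks for the approximation property of the first
        factor, so here the two factors are exchanged.\<close>
      define ws where "ws k = map prod.swap (zs k)" for k
      have swap: "(\<Sum>(g, f)\<leftarrow>ws k. h g f) = (\<Sum>(f, g)\<leftarrow>zs k. h g f)" for k and h :: "_ \<Rightarrow> _ \<Rightarrow> 'c::monoid_add"
        by (simp add: ws_def o_def case_prod_unfold)
      have bil: "bilinear_on dual_scale ?F dual_scale ?E sT (\<lambda>g f. \<tau> f g)"
        using P.bilinear by (simp add: bilinear_on_def)
      have bd: "norm (\<tau> f g) \<le> norm g * norm f" if "g \<in> ?F" "f \<in> ?E" for f g
        using P.norm_\<tau>_le[OF that(2,1)] by (simp add: mult.commute)
      have ws1: "set (ws k) \<subseteq> ?F \<times> ?E" for k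
        using zs(1)[of k] by (auto simp: ws_def)
      have ws2: "(\<Sum>(g, f)\<leftarrow>ws k. norm g * norm f) \<le> C * (1 / 4) ^ k" for k
        using zs(2)[of k] by (simp add: swap mult.commute)
      have ws3: "(\<lambda>k. \<Sum>(g, f)\<leftarrow>ws k. \<tau> f g) sums z"
        using zs(3) by (simp add: swap)
      have ws4: "(\<lambda>k. \<Sum>(g, f)\<leftarrow>ws k. blinfun_apply g (y n) * blinfun_apply f (x m)) sums 0" for m n
        using zero[of m n] by (simp add: swap mult.commute)
      show ?thesis
        by (rule approximation_property_injective[OF P.F P.E VT AP bil bd
            ev(1) ev(2)[OF y(1)] sepY ev(1) ev(2)[OF x(1)] sepX ws1 ws2 ws3 ws4])
    qed
  qed

  show "T \<subseteq> INA ?E ?F T \<tau>"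
  proof
    fix u assume u: "u \<in> T"
    have cont: "continuous_on ?S (\<lambda>(f, g). \<tau> f g)"
      by (rule continuous_on_subset[OF P.continuous_on_\<tau>]) auto
    show "u \<in> INA ?E ?F T \<tau>"
    proof (cases "u = 0")
      \<comment> \<open>Zero is treated apart: below, weights are divided by total costs, which tend
        to norm u and must have a positive limit.\<close>
      case True
      let ?N = "null_measure (restrict_space borel ?S)"
      have "has_bochner_integral_general ?N (\<lambda>(f, g). \<tau> f g) 0"
        unfolding has_bochner_integral_general_def
      proof (intro conjI exI[of _ "\<lambda>_ _. 0"] allI)
        show "(\<lambda>(f, g). \<tau> f g) \<in> borel_measurable ?N"
          using borel_measurable_continuous_on_restrict[OF cont] by (simp cong: measurable_cong_sets)
        show "Bochner_Integration.simple_bochner_integrable ?N (\<lambda>_. 0)"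
          by (auto intro!: simple_bochner_integrable.intros)
      qed (simp_all add: simple_bochner_integral_def)
      moreover have "finite_measure ?N" by (rule finite_measureI) simp
      ultimately show ?thesis
        using u True by (auto simp: INA_def intro!: exI[of _ ?N])
    next
      case False
      \<comment> \<open>Tolerances proportional to norm u keep every cost positive: it exceeds norm
        u - norm u / (n + 1), which is 0 at worst, for n = 0.\<close>
      have "\<exists>zs. set zs \<subseteq> ?E \<times> ?F \<and> norm (P.tsum zs - u) < norm u / real (Suc n) \<and>
        P.cost zs < norm u + norm u / real (Suc n)" for n
        by (rule P.approximate_representation[OF u, of "norm u / real (Suc n)"]) (use False in auto)
      then obtain zs where zs: "\<And>n. set (zs n) \<subseteq> ?E \<times> ?F"
        "\<And>n. norm (P.tsum (zs n) - u) < norm u / real (Suc n)"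
        "\<And>n. P.cost (zs n) < norm u + norm u / real (Suc n)" by metis
      have e: "(\<lambda>n. norm u / real (Suc n)) \<longlonglongrightarrow> 0"
        by (rule LIMSEQ_Suc[OF lim_const_over_n])
      have tsum_lim: "(\<lambda>n. P.tsum (zs n)) \<longlonglongrightarrow> u"
        by (rule Lim_null_comparison[OF _ e, THEN LIM_zero_cancel]) (use zs(2) in \<open>simp add: less_imp_le\<close>)
      have lower: "norm u - norm u / real (Suc n) < P.cost (zs n)" for n
        using zs(2)[of n] P.norm_tsum_le_cost[OF zs(1)[of n]] norm_triangle_sub[of u "P.tsum (zs n)"]
        by (simp add: norm_minus_commute)
      have pos: "0 < P.cost (zs n)" for n
      proof -
        have "norm u / real (Suc n) \<le> norm u / 1" by (rule divide_left_mono) auto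
        then show ?thesis using lower[of n] by simp
      qed
      \<comment> \<open>The cost is squeezed: from above by near optimality, from below because it
        dominates the norm of the tensor, which tends to norm u.\<close>
      have mass: "(\<lambda>n. P.cost (zs n)) \<longlonglongrightarrow> norm u"
      proof (rule tendsto_sandwich)
        show "(\<lambda>n. norm u - norm u / real (Suc n)) \<longlonglongrightarrow> norm u"
          using tendsto_diff[OF tendsto_const e, of "norm u"] by simp
        show "(\<lambda>n. norm u + norm u / real (Suc n)) \<longlonglongrightarrow> norm u"
          using tendsto_add[OF tendsto_const e, of "norm u"] by simp
      qed (use lower zs(3) in \<open>auto intro!: always_eventually less_imp_le\<close>)
      have conv: "(\<lambda>n. \<Sum>(f, g)\<leftarrow>zs n. blinfun_apply f (x k) * blinfun_apply g (y m)) \<longlonglongrightarrow> L k m u" for k m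
        unfolding L(3)[OF zs(1), symmetric]
      proof (rule Lim_null_comparison[THEN LIM_zero_cancel])
        show "(\<lambda>n. norm (P.tsum (zs n) - u)) \<longlonglongrightarrow> 0"
          using tsum_lim by (intro tendsto_norm_zero LIM_zero)
        show "\<forall>\<^sub>F n in sequentially. norm (L k m (P.tsum (zs n)) - L k m u) \<le> norm (P.tsum (zs n) - u)"
          using L(2)[OF banach_space_overD(8)[OF P.T P.tsum_in_T[OF zs(1)] u]]
          by (simp add: LD[OF P.tsum_in_T[OF zs(1)] u])
      qed
      have "0 < norm u" using False by simp
      obtain \<nu> where \<nu>: "sets \<nu> = sets (restrict_space borel ?S)" "finite_measure \<nu>" "measure \<nu> (space \<nu>) = norm u"
        and int: "\<forall>k m (\<rho> :: 'k \<Rightarrow> real). bounded_linear \<rho> \<longrightarrow>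
          (\<integral>q. \<rho> (blinfun_apply (fst q) (x k) * blinfun_apply (snd q) (y m)) \<partial>\<nu>) = \<rho> (L k m u)"
        by (rule limit_measure[OF nx ny zs(1) pos mass \<open>0 < norm u\<close> conv])
      have space: "space \<nu> = ?S" using sets_eq_imp_space_eq[OF \<nu>(1)] by (simp add: space_restrict_space)
      have meas: "(\<lambda>(f, g). \<tau> f g) \<in> borel_measurable \<nu>"
        using borel_measurable_continuous_on_restrict[OF cont] by (simp add: measurable_cong_sets[OF \<nu>(1) refl])
      have bound: "\<forall>q\<in>space \<nu>. norm (case q of (f, g) \<Rightarrow> \<tau> f g) \<le> 1"
      proof
        fix q assume "q \<in> space \<nu>"
        then obtain f g where q: "q = (f, g)" "f \<in> ?E" "g \<in> ?F" "norm f \<le> 1" "norm g \<le> 1"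
          by (auto simp: space)
        have "norm (\<tau> f g) \<le> norm f * norm g" using q by (intro P.norm_\<tau>_le)
        also have "\<dots> \<le> 1" using mult_mono[OF q(4,5)] by simp
        finally show "norm (case q of (f, g) \<Rightarrow> \<tau> f g) \<le> 1" by (simp add: q)
      qed
      \<comment> \<open>Tensors of members of the dense sequences approximate every value of
        \<open>\<tau>\<close>; this separability of the range is what makes the Bochner integral
        exist.\<close>
      define D where "D i = (case prod_decode i of (a, b) \<Rightarrow> \<tau> (d a) (d' b))" for i
      have dense: "\<forall>q\<in>space \<nu>. \<forall>e>0. \<exists>i. norm ((case q of (f, g) \<Rightarrow> \<tau> f g) - D i) < e"
      proof (intro ballI allI impI)
        fix q and e :: real assume q: "q \<in> space \<nu>" and e: "0 < e"
        have qEF: "q \<in> ?E \<times> ?F" using q by (auto simp: space)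
        obtain \<delta> where \<delta>: "0 < \<delta>" "\<And>q'. q' \<in> ?E \<times> ?F \<Longrightarrow> dist q' q < \<delta> \<Longrightarrow>
            dist (case q' of (f, g) \<Rightarrow> \<tau> f g) (case q of (f, g) \<Rightarrow> \<tau> f g) < e"
          using P.continuous_on_\<tau> qEF e unfolding continuous_on_iff by meson
        obtain i where i: "norm (fst q - d i) < \<delta> / 2" using x(3)[of "fst q" "\<delta> / 2"] qEF \<delta>(1) by auto
        obtain j where j: "norm (snd q - d' j) < \<delta> / 2" using y(3)[of "snd q" "\<delta> / 2"] qEF \<delta>(1) by auto
        have "dist (d i, d' j) q \<le> norm (fst q - d i) + norm (snd q - d' j)"
          using sqrt_sum_squares_le_sum[of "norm (fst q - d i)" "norm (snd q - d' j)"]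
          by (simp add: dist_prod_def dist_norm norm_minus_commute)
        then have "dist (d i, d' j) q < \<delta>" using i j by linarith
        moreover have "(d i, d' j) \<in> ?E \<times> ?F" using x(2) y(2) by auto
        ultimately have "dist (\<tau> (d i) (d' j)) (case q of (f, g) \<Rightarrow> \<tau> f g) < e" using \<delta>(2) by force
        then show "\<exists>i. norm ((case q of (f, g) \<Rightarrow> \<tau> f g) - D i) < e"
          by (intro exI[of _ "prod_encode (i, j)"]) (simp add: D_def dist_norm norm_minus_commute)
      qed
      have DT: "range D \<subseteq> T"
        using x(2) y(2) by (auto simp: D_def image_subset_iff split: prod.split intro!: P.\<tau>_in_T)
      have \<tau>T: "\<forall>q\<in>space \<nu>. (case q of (f, g) \<Rightarrow> \<tau> f g) \<in> T"
        by (auto simp: space intro!: P.\<tau>_in_T)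
      obtain v where v: "v \<in> T" "has_bochner_integral_general \<nu> (\<lambda>(f, g). \<tau> f g) v"
        and vl: "\<forall>(l::'t \<Rightarrow> real) C. linear_on (*\<^sub>R) T (*\<^sub>R) l \<longrightarrow> (\<forall>z\<in>T. \<bar>l z\<bar> \<le> C * norm z) \<longrightarrow>
          (\<lambda>q. l (case q of (f, g) \<Rightarrow> \<tau> f g)) \<in> borel_measurable \<nu> \<longrightarrow> l v = (\<integral>q. l (case q of (f, g) \<Rightarrow> \<tau> f g) \<partial>\<nu>)"
        by (rule bochner_integral_in_subspace[OF \<nu>(2) meas bound dense
            banach_space_overD(4)[OF P.T] banach_space_overD(3)[OF P.T] DT \<tau>T])
      \<comment> \<open>Integrals are exchanged with real functionals only, hence the detour through
        real-linear \<open>\<rho>\<close>; the two coordinates of a scalar are enough to compare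
        \<open>L k m v\<close> with \<open>L k m u\<close>.\<close>
      have coord: "\<rho> (L k m v) = \<rho> (L k m u)" if \<rho>: "bounded_linear \<rho>" for \<rho> :: "'k \<Rightarrow> real" and k m
      proof -
        interpret \<rho>: bounded_linear \<rho> by (rule \<rho>)
        obtain K where K: "0 \<le> K" "\<And>z. norm (\<rho> z) \<le> norm z * K" using \<rho>.nonneg_bounded by blast
        have L\<tau>: "L k m (case q of (f, g) \<Rightarrow> \<tau> f g) = blinfun_apply (fst q) (x k) * blinfun_apply (snd q) (y m)"
          if "q \<in> space \<nu>" for q
          using L(3)[of "[q]" k m] that by (auto simp: space)
        have sc: "L k m (a *\<^sub>R z) = a *\<^sub>R L k m z" if "z \<in> T" for a z
        proof -
          have "L k m (sT (of_real a) z) = of_real a * L k m z"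
            using L(1)[of k m] that by (auto simp: linear_on_def)
          then show ?thesis by (simp add: banach_space_overD(11)[OF P.T] scaleR_conv_of_real)
        qed
        have "\<rho> (L k m v) = (\<integral>q. \<rho> (L k m (case q of (f, g) \<Rightarrow> \<tau> f g)) \<partial>\<nu>)"
        proof (rule vl[rule_format])
          show "linear_on (*\<^sub>R) T (*\<^sub>R) (\<lambda>z. \<rho> (L k m z))"
            using L(1)[of k m] sc by (auto simp: linear_on_def \<rho>.add \<rho>.scaleR)
          show "\<bar>\<rho> (L k m z)\<bar> \<le> K * norm z" if "z \<in> T" for z
            using K(2)[of "L k m z"] mult_left_mono[OF L(2)[OF that, of k m] K(1)] by (simp add: mult.commute)
          have "(\<lambda>q. \<rho> (blinfun_apply (fst q) (x k) * blinfun_apply (snd q) (y m))) \<in> borel_measurable (restrict_space borel ?S)"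
            by (intro borel_measurable_continuous_on_restrict bounded_linear.continuous_on[OF \<rho>] continuous_intros)
          then have "(\<lambda>q. \<rho> (blinfun_apply (fst q) (x k) * blinfun_apply (snd q) (y m))) \<in> borel_measurable \<nu>"
            by (simp add: measurable_cong_sets[OF \<nu>(1) refl])
          then show "(\<lambda>q. \<rho> (L k m (case q of (f, g) \<Rightarrow> \<tau> f g))) \<in> borel_measurable \<nu>"
            by (rule measurable_cong[THEN iffD1, rotated]) (simp add: L\<tau>)
        qed
        also have "\<dots> = (\<integral>q. \<rho> (blinfun_apply (fst q) (x k) * blinfun_apply (snd q) (y m)) \<partial>\<nu>)"
          by (rule Bochner_Integration.integral_cong[OF refl]) (simp add: L\<tau>)
        also have "\<dots> = \<rho> (L k m u)" by (rule int[rule_format, OF \<rho>])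
        finally show ?thesis .
      qed
      obtain r1 r2 :: "'k \<Rightarrow> real" and i where r: "bounded_linear r1" "bounded_linear r2"
        "\<And>z. z = r1 z *\<^sub>R 1 + r2 z *\<^sub>R i"
        by (rule real_or_complex_coordinates) blast
      have "L k m v = L k m u" for k m
        using r(3)[of "L k m v"] r(3)[of "L k m u"] coord[OF r(1)] coord[OF r(2)] by simp
      then have "v - u = 0"
        using u v(1) by (intro separating banach_space_overD(8)[OF P.T]) (simp_all add: LD)
      then have "has_bochner_integral_general \<nu> (\<lambda>(f, g). \<tau> f g) u" using v(2) by simp
      then show ?thesis unfolding INA_def using u \<nu> by blast
    qed
  qed
qed

end
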